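(* Let $\omega_1,\omega_2\in\mathbb{C}$ and $R_1,R_2>0$, let $D_1=\{z\in\mathbb{C}:|z-\omega_1|<R_1\}$ and $D_2=\{z\in\mathbb{C}:|z-\omega_2|>1/R_2\}$, and let $\Omega=D_1\cap D_2$, assumed non-empty. Let $A$ be a bounded linear operator on a complex Hilbert space such that $A-\omega_2 I$ is invertible. If $$\|A-\omega_1 I\|\le R_1\quad\text{and}\quad \|(A-\omega_2 I)^{-1}\|\le R_2,$$ then $\overline\Omega$ is a $(1+\sqrt2)$-spectral set for $A$.
   Context: A closed set $X\subset\mathbb{C}$ is a $K$-spectral set for a bounded operator $A$ if the spectrum of $A$ is contained in $X$ and $\|f(A)\|\le K\sup_{z\in X}|f(z)|$ for all rational functions $f$ bounded in $X$. *)

theory Defs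
  imports "HOL-Analysis.Analysis" "HOL-Computational_Algebra.Polynomial"
begin

text \<open>
  Complex Hilbert spaces. The norm, the metric and the topology are those of
  \<open>real_normed_vector\<close> and are tied to the inner product by \<open>cinner_self\<close>, which
  also makes the inner product positive definite. The inner product is linear in its
  first argument.
\<close>

class complex_inner = real_normed_vector +
  fixes scaleC :: "complex \<Rightarrow> 'a \<Rightarrow> 'a"  (infixr "*\<^sub>C" 75)
    and cinner :: "'a \<Rightarrow> 'a \<Rightarrow> complex"
  assumes scaleC_add_right: "c *\<^sub>C (x + y) = c *\<^sub>C x + c *\<^sub>C y"
    and scaleC_add_left: "(c + d) *\<^sub>C x = c *\<^sub>C x + d *\<^sub>C x"
    and scaleC_scaleC: "c *\<^sub>C d *\<^sub>C x = (c * d) *\<^sub>C x"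
    and scaleC_of_real: "complex_of_real r *\<^sub>C x = r *\<^sub>R x"
    and cinner_commute: "cinner x y = cnj (cinner y x)"
    and cinner_add_left: "cinner (x + y) z = cinner x z + cinner y z"
    and cinner_scaleC_left: "cinner (c *\<^sub>C x) y = c * cinner x y"
    and cinner_self: "cinner x x = complex_of_real ((norm x)\<^sup>2)"

class complex_hilbert_space = complex_inner + complete_space

instantiation complex :: complex_hilbert_space
begin

definition scaleC_complex :: "complex \<Rightarrow> complex \<Rightarrow> complex"
  where "scaleC_complex c x = c * x"

definition cinner_complex :: "complex \<Rightarrow> complex \<Rightarrow> complex"
  where "cinner_complex x y = x * cnj y"

instance
  by standard
    (simp_all add: scaleC_complex_def cinner_complex_def algebra_simps scaleR_conv_of_real
      complex_norm_square[symmetric])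

end

definition bounded_clinear :: "('a::complex_inner \<Rightarrow> 'a) \<Rightarrow> bool"
  where "bounded_clinear T \<longleftrightarrow> bounded_linear T \<and> (\<forall>c x. T (c *\<^sub>C x) = c *\<^sub>C T x)"

definition op_invertible :: "('a::complex_inner \<Rightarrow> 'a) \<Rightarrow> bool"
  where "op_invertible T \<longleftrightarrow> (\<exists>S. bounded_clinear S \<and> S \<circ> T = id \<and> T \<circ> S = id)"

definition spectrum :: "('a::complex_inner \<Rightarrow> 'a) \<Rightarrow> complex set"
  where "spectrum A = {\<mu>. \<not> op_invertible (\<lambda>x. A x - \<mu> *\<^sub>C x)}"

definition poly_op :: "complex poly \<Rightarrow> ('a::complex_inner \<Rightarrow> 'a) \<Rightarrow> 'a \<Rightarrow> 'a"
  where "poly_op p A = (\<lambda>x. \<Sum>i\<le>degree p. coeff p i *\<^sub>C (A ^^ i) x)"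

text \<open>
  The operator \<open>f(A) = p(A) q(A)\<^sup>-\<^sup>1\<close> for the rational function \<open>f = p / q\<close>. It is meaningful
  when \<open>q \<noteq> 0\<close> has no zero in the spectrum of \<open>A\<close>, so that \<open>q(A)\<close> is invertible.
\<close>

definition rat_op :: "complex poly \<Rightarrow> complex poly \<Rightarrow> ('a::complex_inner \<Rightarrow> 'a) \<Rightarrow> 'a \<Rightarrow> 'a"
  where "rat_op p q A = poly_op p A \<circ> inv (poly_op q A)"

text \<open>
  A rational function bounded in \<open>X\<close> has no poles in \<open>X\<close>, so it is a quotient \<open>p / q\<close> whose
  denominator does not vanish on \<open>X\<close>; this condition also excludes Isabelle's \<open>z / 0 = 0\<close>.
  The supremum is meant for non-empty \<open>X\<close>.
\<close>

definition spectral_set :: "real \<Rightarrow> complex set \<Rightarrow> ('a::complex_inner \<Rightarrow> 'a) \<Rightarrow> bool"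
  where "spectral_set K X A \<longleftrightarrow>
    closed X \<and> spectrum A \<subseteq> X \<and>
    (\<forall>p q. q \<noteq> 0 \<longrightarrow> (\<forall>z\<in>X. poly q z \<noteq> 0) \<longrightarrow> bounded ((\<lambda>z. poly p z / poly q z) ` X) \<longrightarrow>
      onorm (rat_op p q A) \<le> K * (SUP z\<in>X. cmod (poly p z / poly q z)))"

end

theory Submission
  imports Defs "HOL-Complex_Analysis.Complex_Analysis"
    "HOL-Computational_Algebra.Fundamental_Theorem_Algebra"
begin

text \<open>
  The hypotheses are one condition for each of two discs of the Riemann sphere. The bound
  \<open>\<parallel>A - \<omega>1\<parallel> \<le> R1\<close> makes the operator valued Poisson kernel of the outer disc positive, and
  \<open>\<parallel>(A - \<omega>2)\<^sup>-\<^sup>1\<parallel> \<le> R2\<close> does the same for the exterior of the inner disc. Each kernel has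
  total mass \<open>I\<close> over its circle. Let \<open>f\<close> be rational with \<open>\<bar>f\<bar> \<le> 1\<close> on the crescent, and
  integrate \<open>f\<close> against the outer kernel along the part of the outer circle that bounds the
  crescent, and against the inner kernel along the part of the inner circle that does. By
  positivity each of the two integrals has norm at most \<open>1\<close>. A Poisson kernel is a Cauchy
  kernel plus an adjoint Cauchy kernel minus a constant, so the sum of the two integrals is
  \<open>f(A) + g(A)\<^sup>*\<close>: the Cauchy kernels reproduce \<open>f(A)\<close>, and \<open>g\<close> is the Cauchy integral of the
  conjugate of \<open>f\<close> plus a constant. Hence \<open>\<parallel>f(A) + g(A)\<^sup>*\<parallel> \<le> 2\<close> (\<open>norm_calculus_plus_conjugate\<close>).

  Moreover \<open>\<bar>g\<bar> \<le> 1\<close> on the crescent (\<open>norm_conj_function_le\<close>). For \<open>z\<close> near one of the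
  circles, reflection in that circle turns the conjugated Cauchy integral over it into a Cauchy
  integral at a point outside the crescent, and Cauchy's theorem moves that integral to the other
  circle. What is left is the Poisson integral of \<open>f\<close> over the other arc, which is at most \<open>1\<close>,
  up to an error that vanishes at the boundary. The corners are finitely many points, which a
  bounded holomorphic function does not see in the maximum principle.

  The bounds \<open>\<parallel>f(A) + g(A)\<^sup>*\<parallel> \<le> 2\<close> and \<open>\<bar>g\<bar> \<le> 1\<close> are the input of the argument of Crouzeix and
  Palencia (\<open>extremal_inequality\<close>, \<open>crouzeix_palencia_bound\<close>). If \<open>K\<close> is the best constant, then
  \<open>(f g f)(A)\<close> has norm at most \<open>K\<close>, and comparing \<open>f(A)\<^sup>*f(A)f(A)\<^sup>*f(A)\<close> with
  \<open>f(A)\<^sup>*(f g f)(A)\<close> gives \<open>K\<^sup>3 \<le> 2K\<^sup>2 + K\<close>, that is \<open>K \<le> 1 + \<surd>2\<close>.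

  Two points need room around the crescent. The spectrum of \<open>A\<close> may touch the boundary, and \<open>g\<close>
  is not rational when the boundary consists of proper arcs. The argument therefore runs over all
  slightly enlarged crescents at once: on a smaller enlargement \<open>g\<close> is a uniform limit of Riemann
  sums, which are rational with poles on the boundary of a larger one (\<open>rational_partner\<close>). The
  geometry enters only through two contour integrals (locale \<open>crescent_contour\<close>), computed
  separately for a ring, for a disc and for two crossing circles. A complex number is an operator
  on the Hilbert space of complex numbers, so each fact about the kernels serves both for \<open>A\<close> and
  for the points of the crescent.
\<close>

section \<open>Complex inner product spaces\<close>

lemma scaleC_one [simp]: "1 *\<^sub>C x = (x :: 'a :: complex_inner)"
  using scaleC_of_real[of 1 x] by simp

lemma scaleC_zero_left [simp]: "0 *\<^sub>C x = (0 :: 'a :: complex_inner)"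
  using scaleC_of_real[of 0 x] by simp

lemma scaleC_zero_right [simp]: "c *\<^sub>C (0 :: 'a :: complex_inner) = 0"
  using scaleC_add_right[of c "0::'a" 0] by simp

lemma scaleC_minus_left: "(- c) *\<^sub>C x = - (c *\<^sub>C (x :: 'a :: complex_inner))"
  using scaleC_add_left[of "-c" c x] by (simp add: eq_neg_iff_add_eq_0)

lemma scaleC_minus_right: "c *\<^sub>C (- x) = - (c *\<^sub>C (x :: 'a :: complex_inner))"
  using scaleC_add_right[of c "-x" x] by (simp add: eq_neg_iff_add_eq_0)

lemma scaleC_diff_left: "(c - d) *\<^sub>C x = c *\<^sub>C x - d *\<^sub>C (x :: 'a :: complex_inner)"
  using scaleC_add_left[of c "-d" x] by (simp add: scaleC_minus_left)

lemma scaleC_diff_right: "c *\<^sub>C (x - y) = c *\<^sub>C x - c *\<^sub>C (y :: 'a :: complex_inner)"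
  using scaleC_add_right[of c x "-y"] by (simp add: scaleC_minus_right)

lemma cinner_zero_left [simp]: "cinner (0 :: 'a :: complex_inner) y = 0"
  using cinner_scaleC_left[of 0 "0::'a" y] by simp

lemma cinner_add_right: "cinner x (y + z) = cinner x y + cinner x (z :: 'a :: complex_inner)"
  by (metis cinner_commute cinner_add_left complex_cnj_add)

lemma cinner_scaleC_right: "cinner x (c *\<^sub>C y) = cnj c * cinner x (y :: 'a :: complex_inner)"
  by (metis cinner_commute cinner_scaleC_left complex_cnj_mult)

lemma cinner_minus_left: "cinner (- x) y = - cinner x (y :: 'a :: complex_inner)"
  using cinner_scaleC_left[of "-1" x y] by (simp add: scaleC_minus_left)

lemma cinner_minus_right: "cinner x (- y) = - cinner x (y :: 'a :: complex_inner)"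
  using cinner_scaleC_right[of x "-1" y] by (simp add: scaleC_minus_left)

lemma cinner_diff_left: "cinner (x - y) z = cinner x z - cinner y (z :: 'a :: complex_inner)"
  using cinner_add_left[of x "-y" z] by (simp add: cinner_minus_left)

lemma cinner_diff_right: "cinner x (y - z) = cinner x y - cinner x (z :: 'a :: complex_inner)"
  using cinner_add_right[of x y "-z"] by (simp add: cinner_minus_right)

lemmas cinner_simps = cinner_add_left cinner_add_right cinner_diff_left cinner_diff_right
  cinner_scaleC_left cinner_scaleC_right cinner_minus_left cinner_minus_right

lemma norm_scaleC: "norm (c *\<^sub>C x) = cmod c * norm (x :: 'a :: complex_inner)"
proof -
  have "complex_of_real ((norm (c *\<^sub>C x))^2) = complex_of_real ((cmod c * norm x)^2)"
    by (simp only: cinner_self[symmetric, where 'a = 'a] cinner_simps power_mult_distrib of_real_mult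
        complex_norm_square) (simp add: mult.commute)
  then have "(norm (c *\<^sub>C x))^2 = (cmod c * norm x)^2"
    using of_real_eq_iff by blast
  then show ?thesis by (simp add: power2_eq_iff_nonneg)
qed

text \<open>
  Expand the form at \<open>\<surd>t x + s y / \<surd>t\<close>, where the phase \<open>s\<close> makes both cross terms equal to
  \<open>-\<bar>B x y\<bar>\<close>. The parameter is kept because this version can be integrated term by term.
\<close>

lemma hermitian_form_amgm:
  fixes B :: "'a :: complex_inner \<Rightarrow> 'a \<Rightarrow> complex"
  assumes add: "\<And>x y z. B (x + y) z = B x z + B y z"
    and scale: "\<And>c x y. B (c *\<^sub>C x) y = c * B x y"
    and herm: "\<And>x y. B x y = cnj (B y x)"
    and psd: "\<And>x. Re (B x x) \<ge> 0"
    and t: "t > 0"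
  shows "cmod (B x y) \<le> (t * Re (B x x) + Re (B y y) / t) / 2"
proof (cases "B x y = 0")
  case True
  then show ?thesis using psd[of x] psd[of y] t by simp
next
  case False
  define s where "s = sgn (B x y)"
  have s: "s * cnj s = 1" "cnj s * B x y = of_real (cmod (B x y))"
    using False by (simp_all add: s_def sgn_div_norm complex_norm_square[symmetric]
        scaleR_conv_of_real power2_eq_square field_simps)
  have scale': "B a (c *\<^sub>C b) = cnj c * B a b" for a b c
    by (metis herm scale complex_cnj_mult complex_cnj_cnj)
  have add': "B a (b + c) = B a b + B a c" for a b c
    by (metis herm add complex_cnj_add)
  define q where "q = sqrt t"
  have q: "q > 0" "q * q = t" using t by (simp_all add: q_def)
  define u where "u = of_real q *\<^sub>C x"
  define v where "v = (- s / of_real q) *\<^sub>C y"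
  have uu: "B u u = of_real t * B x x"
    by (simp add: u_def scale scale' q flip: of_real_mult mult.assoc)
  have vv: "B v v = B y y / of_real t"
  proof -
    have "B v v = (s * cnj s) * B y y / of_real (q * q)"
      by (simp add: v_def scale scale')
    then show ?thesis using s q by simp
  qed
  have uv: "B u v = - of_real (cmod (B x y))"
    using s(2) q by (simp add: u_def v_def scale scale')
  have vu: "B v u = - of_real (cmod (B x y))"
    using uv herm[of v u] by simp
  have "Re (B (u + v) (u + v)) = t * Re (B x x) + Re (B y y) / t - 2 * cmod (B x y)"
    by (simp add: add add' uu vv uv vu)
  with psd[of "u + v"] show ?thesis by simp
qed

text \<open>
  The choice \<open>t = b / a\<close> gives the claim; the shift by \<open>d\<close> avoids division by zero.
\<close>

lemma le_mult_if_le_amgm: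
  fixes m a b :: real
  assumes le: "\<And>t. t > 0 \<Longrightarrow> m \<le> (t * a^2 + b^2 / t) / 2" and a: "a \<ge> 0" and b: "b \<ge> 0"
  shows "m \<le> a * b"
proof (rule field_le_epsilon)
  fix e :: real assume e: "e > 0"
  define d where "d = e / (a + b + 1 + e)"
  have d: "d > 0" "d < 1" using e a b by (simp_all add: d_def field_simps add_pos_pos add_nonneg_pos)
  define t where "t = (b + d) / (a + d)"
  have t: "t > 0" using d a b by (simp add: t_def)
  have "m \<le> (t * a^2 + b^2 / t) / 2" by (rule le[OF t])
  also have "\<dots> \<le> (t * (a + d)^2 + (b + d)^2 / t) / 2"
  proof -
    have "a^2 \<le> (a + d)^2" "b^2 \<le> (b + d)^2" using a b d by (auto intro!: power_mono)
    then have "t * a^2 \<le> t * (a + d)^2" "b^2 / t \<le> (b + d)^2 / t"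
      using t by (auto intro!: mult_left_mono divide_right_mono)
    then show ?thesis by (rule divide_right_mono[OF add_mono]) simp
  qed
  also have "\<dots> = (a + d) * (b + d)"
  proof -
    have "a + d \<noteq> 0" "b + d \<noteq> 0" using a b d by auto
    then have "t * (a + d)^2 = (a + d) * (b + d)" "(b + d)^2 / t = (a + d) * (b + d)"
      by (simp_all add: t_def power2_eq_square)
    then show ?thesis by simp
  qed
  also have "\<dots> = a * b + d * (a + b + d)" by (simp add: algebra_simps)
  also have "d * (a + b + d) \<le> d * (a + b + 1 + e)" using d e by (intro mult_left_mono) auto
  also have "d * (a + b + 1 + e) = e" using a b e by (simp add: d_def)
  finally show "m \<le> a * b + e" by simp
qed

lemma hermitian_form_Cauchy_Schwarz:
  fixes B :: "'a :: complex_inner \<Rightarrow> 'a \<Rightarrow> complex"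
  assumes add: "\<And>x y z. B (x + y) z = B x z + B y z"
    and scale: "\<And>c x y. B (c *\<^sub>C x) y = c * B x y"
    and herm: "\<And>x y. B x y = cnj (B y x)"
    and psd: "\<And>x. Re (B x x) \<ge> 0"
    and a: "Re (B x x) \<le> a^2" "a \<ge> 0" and b: "Re (B y y) \<le> b^2" "b \<ge> 0"
  shows "cmod (B x y) \<le> a * b"
proof (rule le_mult_if_le_amgm)
  fix t :: real assume t: "t > 0"
  have "cmod (B x y) \<le> (t * Re (B x x) + Re (B y y) / t) / 2"
    by (rule hermitian_form_amgm[OF add scale herm psd t])
  also have "\<dots> \<le> (t * a^2 + b^2 / t) / 2"
    by (rule divide_right_mono[OF add_mono[OF mult_left_mono divide_right_mono]]) (use a b t in auto)
  finally show "cmod (B x y) \<le> (t * a^2 + b^2 / t) / 2" .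
qed (use a b in auto)

lemma norm_cinner_le: "cmod (cinner x y) \<le> norm x * norm (y :: 'a :: complex_inner)"
  by (rule hermitian_form_Cauchy_Schwarz)
    (auto simp: cinner_simps cinner_self simp flip: cinner_commute)

lemma norm_le_by_duality:
  fixes v :: "'a :: complex_inner"
  assumes "\<And>y. cmod (cinner v y) \<le> b * norm y" "b \<ge> 0"
  shows "norm v \<le> b"
proof (cases "v = 0")
  case False
  have "norm v * norm v \<le> b * norm v"
    using assms(1)[of v] by (simp add: cinner_self power2_eq_square norm_mult)
  then show ?thesis using False by simp
qed (use assms in simp)

section \<open>Bounded operators\<close>

lemma bounded_clinearD:
  assumes "bounded_clinear T"
  shows "T (x + y) = T x + T y" "T (x - y) = T x - T y" "T 0 = 0" "T (- x) = - T x"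
    "T (c *\<^sub>C x) = c *\<^sub>C T x" "bounded_linear T"
  using assms unfolding bounded_clinear_def
  by (auto simp: linear_simps bounded_linear.linear intro: linear_0)

lemma bounded_clinearI:
  assumes "\<And>x y. T (x + y) = T x + T y" "\<And>c x. T (c *\<^sub>C x) = c *\<^sub>C T x"
    "\<And>x. norm (T x) \<le> norm x * K"
  shows "bounded_clinear T"
  unfolding bounded_clinear_def
proof (intro conjI allI assms(2))
  have "T (r *\<^sub>R x) = r *\<^sub>R T x" for r x
    using assms(2)[of "of_real r" x] by (simp add: scaleC_of_real)
  then show "bounded_linear T"
    by (intro bounded_linear_intro[where K = K] assms)
qed

lemma bounded_clinear_scale: "bounded_clinear (\<lambda>x. c *\<^sub>C x)"
  by (rule bounded_clinearI[where K = "cmod c"])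
    (auto simp: scaleC_add_right scaleC_scaleC norm_scaleC mult.commute)

lemma bounded_clinear_add:
  assumes "bounded_clinear S" "bounded_clinear T"
  shows "bounded_clinear (\<lambda>x. S x + T x)"
  using assms unfolding bounded_clinear_def by (auto simp: scaleC_add_right bounded_linear_add)

lemma bounded_clinear_diff:
  assumes "bounded_clinear S" "bounded_clinear T"
  shows "bounded_clinear (\<lambda>x. S x - T x)"
  using assms unfolding bounded_clinear_def by (auto simp: scaleC_diff_right bounded_linear_sub)

lemma bounded_clinear_compose:
  assumes "bounded_clinear S" "bounded_clinear T"
  shows "bounded_clinear (\<lambda>x. S (T x))"
  using assms unfolding bounded_clinear_def by (auto intro: bounded_linear_compose)

lemma bounded_clinear_shift:
  "bounded_clinear A \<Longrightarrow> bounded_clinear (\<lambda>x. A x - \<mu> *\<^sub>C x)"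
  by (intro bounded_clinear_diff bounded_clinear_scale)

lemma op_invertible_bij: "op_invertible T \<Longrightarrow> bij T"
  unfolding op_invertible_def by (metis bij_betw_def o_bij)

lemma op_invertible_inv:
  assumes "op_invertible T"
  shows "bounded_clinear (inv T)" "inv T (T x) = x" "T (inv T x) = x"
proof -
  obtain S where S: "bounded_clinear S" "S \<circ> T = id" "T \<circ> S = id"
    using assms unfolding op_invertible_def by blast
  have "inv T = S" using S(2,3) by (metis inv_unique_comp)
  with S show "bounded_clinear (inv T)" by simp
  show "inv T (T x) = x" "T (inv T x) = x"
    using S(2,3) \<open>inv T = S\<close> by (simp_all add: fun_eq_iff)
qed

lemma op_invertibleI:
  assumes "bounded_clinear T" "surj T" "\<And>x. m * norm x \<le> norm (T x)" "m > 0"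
  shows "op_invertible T"
proof -
  note T = bounded_clinearD[OF assms(1)]
  have inj: "inj T"
  proof (rule injI)
    fix x y assume "T x = T y"
    then have "m * norm (x - y) \<le> 0" using assms(3)[of "x - y"] by (simp add: T)
    then show "x = y" using assms(4) by (simp add: mult_le_0_iff)
  qed
  have TI: "T (inv T x) = x" for x using assms(2) by (simp add: surj_f_inv_f)
  have IT: "inv T (T x) = x" for x using inj by simp
  have "bounded_clinear (inv T)"
  proof (rule bounded_clinearI[where K = "1 / m"])
    show "inv T (x + y) = inv T x + inv T y" for x y by (metis IT TI T(1))
    show "inv T (c *\<^sub>C x) = c *\<^sub>C inv T x" for c x by (metis IT TI T(5))
    show "norm (inv T x) \<le> norm x * (1 / m)" for x
      using assms(3)[of "inv T x"] assms(4) by (simp add: TI field_simps)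
  qed
  then show ?thesis unfolding op_invertible_def
    using TI IT by (intro exI[of _ "inv T"]) (auto simp: fun_eq_iff)
qed

text \<open>
  The equation \<open>T u - E u = y\<close> is the fixed point equation \<open>u = T\<^sup>-\<^sup>1 (y + E u)\<close> of a
  contraction when \<open>E\<close> is smaller than the lower bound of \<open>T\<close>.
\<close>

lemma op_invertible_perturb:
  fixes T E :: "'a :: complex_hilbert_space \<Rightarrow> 'a"
  assumes T: "op_invertible T" "bounded_clinear T" "\<And>x. c * norm x \<le> norm (T x)"
    and E: "bounded_clinear E" "\<And>x. norm (E x) \<le> e * norm x" and "0 \<le> e" "e < c"
  shows "op_invertible (\<lambda>x. T x - E x)"
proof (rule op_invertibleI[where m = "c - e"])
  note inv = op_invertible_inv[OF T(1)]
  note l = bounded_clinearD[OF inv(1)] bounded_clinearD[OF E(1)]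
  show "surj (\<lambda>x. T x - E x)"
    unfolding surj_def
  proof
    fix y
    have c: "c > 0" using assms by simp
    have "norm (inv T x) \<le> norm x / c" for x
      using T(3)[of "inv T x"] c by (simp add: inv field_simps)
    then have "norm (inv T (E x)) \<le> e * norm x / c" for x
      using E(2)[of x] c by (meson divide_right_mono less_imp_le order_trans)
    then have lip: "dist (inv T (y + E u)) (inv T (y + E v)) \<le> (e / c) * dist u v" for u v
      by (metis (no_types, lifting) dist_norm l(2) l(8) add_diff_cancel_left times_divide_eq_left)
    have "\<exists>!u. inv T (y + E u) = u"
      by (rule banach_fix_type[of "e / c"]) (use lip assms in auto)
    then obtain u where "inv T (y + E u) = u" by blast
    then have "T u - E u = y" by (metis add_diff_cancel_right' inv(3))
    then show "\<exists>u. y = T u - E u" by blast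
  qed
  show "(c - e) * norm x \<le> norm (T x - E x)" for x
    using T(3)[of x] E(2)[of x] norm_triangle_ineq2[of "T x" "E x"] by (simp add: left_diff_distrib)
qed (use assms bounded_clinear_diff in auto)

section \<open>The extremal argument\<close>

lemma onorm_approximated:
  assumes F: "bounded_linear F" and N: "0 < onorm F" and d: "d > 0"
  obtains x where "norm x = 1" "onorm F - d < norm (F x)"
proof -
  have "\<exists>x. norm (F x) > (onorm F - min d (onorm F) / 2) * norm x"
  proof (rule ccontr)
    assume "\<not> ?thesis"
    then have "onorm F \<le> onorm F - min d (onorm F) / 2"
      by (intro onorm_bound) (use N d in \<open>auto simp: not_less min_def\<close>)
    then show False using N d by (auto simp: min_def split: if_splits)
  qed
  then obtain x where x: "norm (F x) > (onorm F - min d (onorm F) / 2) * norm x" by blast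
  have nz: "x \<noteq> 0" using x F by (auto simp: linear_simps)
  have "norm (F (x /\<^sub>R norm x)) = norm (F x) / norm x"
    using F by (simp add: linear_simps divide_inverse mult.commute)
  moreover have "norm (F x) / norm x > onorm F - min d (onorm F) / 2"
    using x nz by (simp add: field_simps)
  moreover have "onorm F - d \<le> onorm F - min d (onorm F) / 2" using N d by (simp add: min_def)
  ultimately show thesis
    using nz by (intro that[of "x /\<^sub>R norm x"]) auto
qed

text \<open>
  Suppose \<open>F\<close> attains its norm \<open>N\<close> at the unit vector \<open>x\<close>, so that \<open>F\<^sup>*F x = N\<^sup>2 x\<close>. The hypothesis on
  \<open>F + G\<^sup>*\<close> at the vectors \<open>x\<close> and \<open>F x\<close> gives \<open>N\<^sup>2 \<le> s N + \<bar>\<langle>x, G F x\<rangle>\<bar>\<close>, and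
  \<open>N\<^sup>2 \<langle>x, G F x\<rangle> = \<langle>F x, F G F x\<rangle>\<close> is at most \<open>N K\<close>. The proof runs this argument along vectors that
  almost attain the norm, and uses sesquilinear forms in place of adjoints.
\<close>

lemma extremal_inequality:
  fixes F G :: "'a :: complex_inner \<Rightarrow> 'a"
  assumes F: "bounded_clinear F" and G: "bounded_clinear G"
    and sum: "\<And>u v. cmod (cinner (F u) v + cinner u (G v)) \<le> s * norm u * norm v"
    and FGF: "\<And>x. norm (F (G (F x))) \<le> K * norm x" and "K \<ge> 0"
  shows "onorm F ^ 3 \<le> s * onorm F ^ 2 + K"
proof (cases "onorm F = 0")
  case True
  then show ?thesis using \<open>K \<ge> 0\<close> by simp
next
  case False
  define N where "N = onorm F"
  define g where "g = onorm G"
  note lF = bounded_clinearD[OF F] and lG = bounded_clinearD[OF G]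
  have N: "N > 0" using False onorm_pos_le[OF lF(6)] by (simp add: N_def)
  have g: "g \<ge> 0" using onorm_pos_le[OF lG(6)] by (simp add: g_def)
  have FN: "norm (F x) \<le> N * norm x" for x using onorm[OF lF(6)] by (simp add: N_def)
  have Gg: "norm (G x) \<le> g * norm x" for x using onorm[OF lG(6)] by (simp add: g_def)
  \<comment> \<open>At a unit vector where \<open>F\<close> attains its norm the form \<open>Q\<close> below vanishes against every
      vector, which says \<open>F\<^sup>*F x = N^2 x\<close>; Cauchy-Schwarz for \<open>Q\<close> makes this quantitative.\<close>
  define Q where "Q = (\<lambda>x y. of_real (N^2) * cinner x y - cinner (F x) (F y))"
  have Qpsd: "Re (Q x x) = N^2 * (norm x)^2 - (norm (F x))^2" for x
    by (simp add: Q_def cinner_self flip: of_real_power of_real_mult)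
  have Qnn: "Re (Q x x) \<ge> 0" for x
    using power_mono[OF FN[of x] norm_ge_zero, of 2] by (simp add: Qpsd power_mult_distrib)
  have key: "N^2 * (norm (F x))^2 \<le>
      s * N^2 * norm (F x) + sqrt (N^2 - (norm (F x))^2) * (N * (g * N)) + norm (F x) * K"
    if x: "norm x = 1" for x
  proof -
    define n where "n = norm (F x)"
    define z where "z = G (F x)"
    have n: "0 \<le> n" "n \<le> N" using FN[of x] x by (simp_all add: n_def)
    have "norm z \<le> g * n" using Gg[of "F x"] by (simp add: z_def n_def)
    also have "\<dots> \<le> g * N" using n g by (intro mult_left_mono) auto
    finally have z: "norm z \<le> g * N" .
    have "cmod (Q x z) \<le> sqrt (N^2 - n^2) * (N * norm z)"
    proof (rule hermitian_form_Cauchy_Schwarz[OF _ _ _ Qnn])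
      show "Q (x + y) z = Q x z + Q y z" for x y z
        by (simp add: Q_def lF cinner_simps algebra_simps)
      show "Q (c *\<^sub>C x) y = c * Q x y" for c x y
        by (simp add: Q_def lF cinner_simps algebra_simps)
      show "Q x y = cnj (Q y x)" for x y
        by (simp add: Q_def flip: cinner_commute)
      have "n^2 \<le> N^2" using n by (intro power_mono) auto
      then show "Re (Q x x) \<le> (sqrt (N^2 - n^2))^2" "0 \<le> sqrt (N^2 - n^2)"
        by (simp_all add: Qpsd x n_def)
      show "Re (Q z z) \<le> (N * norm z)^2" by (simp add: Qpsd power_mult_distrib)
    qed (use N in simp)
    also have "\<dots> \<le> sqrt (N^2 - n^2) * (N * (g * N))"
      using z N n by (intro mult_left_mono) (auto simp: power_mono)
    finally have Qxz: "cmod (Q x z) \<le> sqrt (N^2 - n^2) * (N * (g * N))" .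
    have Fz: "cmod (cinner (F x) (F z)) \<le> n * K"
    proof -
      have "cmod (cinner (F x) (F z)) \<le> n * norm (F z)"
        using norm_cinner_le[of "F x" "F z"] by (simp add: n_def)
      also have "\<dots> \<le> n * K" using FGF[of x] x n by (intro mult_left_mono) (auto simp: z_def)
      finally show ?thesis .
    qed
    have "N^2 * cmod (cinner x z) = cmod (Q x z + cinner (F x) (F z))"
      by (simp add: Q_def norm_mult norm_power)
    also have "\<dots> \<le> cmod (Q x z) + cmod (cinner (F x) (F z))" by (rule norm_triangle_ineq)
    finally have xz: "N^2 * cmod (cinner x z) \<le> sqrt (N^2 - n^2) * (N * (g * N)) + n * K"
      using Qxz Fz by linarith
    have "n^2 = cmod (cinner (F x) (F x))" by (simp add: cinner_self n_def norm_power)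
    also have "\<dots> = cmod ((cinner (F x) (F x) + cinner x z) - cinner x z)" by simp
    also have "\<dots> \<le> s * n + cmod (cinner x z)"
      using sum[of x "F x"] norm_triangle_ineq4[of "cinner (F x) (F x) + cinner x z" "cinner x z"]
      by (simp add: x z_def n_def)
    finally have "N^2 * n^2 \<le> N^2 * (s * n + cmod (cinner x z))" by (intro mult_left_mono) auto
    with xz show ?thesis unfolding n_def[symmetric] by (simp add: algebra_simps)
  qed
  have "\<exists>x. norm x = 1 \<and> N - inverse (real (Suc k)) < norm (F x)" for k
    using onorm_approximated[OF lF(6), of "inverse (real (Suc k))"] N unfolding N_def
    by (metis inverse_positive_iff_positive of_nat_0_less_iff zero_less_Suc)
  then obtain x where x: "\<And>k. norm (x k) = 1" "\<And>k. N - inverse (real (Suc k)) < norm (F (x k))"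
    by metis
  have up: "norm (F (x k)) \<le> N" for k using FN[of "x k"] x(1)[of k] by simp
  have lim: "(\<lambda>k. norm (F (x k))) \<longlonglongrightarrow> N"
  proof (rule tendsto_sandwich[OF _ _ _ tendsto_const])
    show "(\<lambda>k. N - inverse (real (Suc k))) \<longlonglongrightarrow> N"
      using tendsto_diff[OF tendsto_const LIMSEQ_inverse_real_of_nat, of N] by simp
  qed (use x(2) up in \<open>auto intro!: always_eventually less_imp_le\<close>)
  have l: "(\<lambda>k. N^2 * (norm (F (x k)))^2) \<longlonglongrightarrow> N^2 * N^2"
    by (rule tendsto_mult[OF tendsto_const tendsto_power[OF lim]])
  have r: "(\<lambda>k. s * N^2 * norm (F (x k)) + sqrt (N^2 - (norm (F (x k)))^2) * (N * (g * N))
      + norm (F (x k)) * K) \<longlonglongrightarrow> s * N^2 * N + sqrt (N^2 - N^2) * (N * (g * N)) + N * K"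
    by (rule tendsto_add[OF tendsto_add[OF tendsto_mult[OF tendsto_const lim]
          tendsto_mult[OF tendsto_real_sqrt[OF tendsto_diff[OF tendsto_const tendsto_power[OF lim]]]
            tendsto_const]] tendsto_mult[OF lim tendsto_const]])
  have "N^2 * N^2 \<le> s * N^2 * N + sqrt (N^2 - N^2) * (N * (g * N)) + N * K"
    by (rule LIMSEQ_le[OF l r]) (use key x(1) in blast)
  then have "N * N ^ 3 \<le> N * (s * N^2 + K)"
    by (simp add: algebra_simps power2_eq_square power3_eq_cube)
  then show ?thesis using N by (simp add: N_def[symmetric])
qed

text \<open>
  The supremum \<open>K\<close> of the norms satisfies \<open>K\<^sup>3 \<le> 2K\<^sup>2 + K\<close> by \<open>extremal_inequality\<close>. That inequality says
  nothing about an infinite \<open>K\<close>, which is why some bound \<open>M\<close> has to be known beforehand.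
\<close>

theorem crouzeix_palencia_bound:
  fixes \<F> :: "('a :: complex_inner \<Rightarrow> 'a) set"
  assumes lin: "\<And>F. F \<in> \<F> \<Longrightarrow> bounded_clinear F"
    and bounded: "\<And>F. F \<in> \<F> \<Longrightarrow> onorm F \<le> M"
    and partner: "\<And>F \<eta>. F \<in> \<F> \<Longrightarrow> \<eta> > 0 \<Longrightarrow> \<exists>G. bounded_clinear G \<and>
        (\<forall>u v. cmod (cinner (F u) v + cinner u (G v)) \<le> (2 + \<eta>) * norm u * norm v) \<and>
        (\<lambda>x. of_real (1 / (1 + \<eta>)) *\<^sub>C F (G (F x))) \<in> \<F>"
    and F: "F \<in> \<F>"
  shows "onorm F \<le> 1 + sqrt 2"
proof -
  define K where "K = (SUP F\<in>\<F>. onorm F)"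
  have bdd: "bdd_above (onorm ` \<F>)" using bounded by (auto intro!: bdd_aboveI)
  have upper: "onorm F \<le> K" if "F \<in> \<F>" for F
    unfolding K_def using bdd that by (intro cSUP_upper)
  have pos: "onorm F \<ge> 0" if "F \<in> \<F>" for F
    using lin[OF that] by (intro onorm_pos_le) (simp add: bounded_clinear_def)
  have K: "K \<ge> 0" using pos[OF F] upper[OF F] by simp
  have cubic: "onorm F ^ 3 \<le> 2 * onorm F ^ 2 + K" if FF: "F \<in> \<F>" for F
  proof -
    have pre: "onorm F ^ 3 \<le> (2 + \<eta>) * onorm F ^ 2 + (1 + \<eta>) * K" if \<eta>: "\<eta> > 0" for \<eta>
    proof -
      obtain G where G: "bounded_clinear G"
        "\<And>u v. cmod (cinner (F u) v + cinner u (G v)) \<le> (2 + \<eta>) * norm u * norm v"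
        "(\<lambda>x. of_real (1 / (1 + \<eta>)) *\<^sub>C F (G (F x))) \<in> \<F>"
        using partner[OF FF \<eta>] by blast
      have "norm (F (G (F x))) \<le> (1 + \<eta>) * K * norm x" for x
      proof -
        have "norm (of_real (1 / (1 + \<eta>)) *\<^sub>C F (G (F x))) \<le>
            onorm (\<lambda>x. of_real (1 / (1 + \<eta>)) *\<^sub>C F (G (F x))) * norm x"
          using lin[OF G(3)] unfolding bounded_clinear_def by (intro onorm) auto
        also have "\<dots> \<le> K * norm x" by (intro mult_right_mono upper G) auto
        finally have "norm (F (G (F x))) / (1 + \<eta>) \<le> K * norm x"
          using \<eta> by (simp add: norm_scaleC del: of_real_divide of_real_add)
        then show ?thesis using \<eta> by (simp add: pos_divide_le_eq mult_ac)
      qed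
      then show ?thesis
        by (intro extremal_inequality[OF lin[OF FF] G(1) G(2)]) (use K \<eta> in auto)
    qed
    define t where "t = onorm F ^ 2 + K"
    have t: "t \<ge> 0" using K by (simp add: t_def)
    show ?thesis
    proof (rule field_le_epsilon)
      fix e :: real assume e: "e > 0"
      define \<eta> where "\<eta> = e / (t + 1)"
      have \<eta>: "\<eta> > 0" "\<eta> * t \<le> e" using e t by (simp_all add: \<eta>_def field_simps)
      have "onorm F ^ 3 \<le> 2 * onorm F ^ 2 + K + \<eta> * t"
        using pre[OF \<eta>(1)] by (simp add: t_def algebra_simps)
      also have "\<dots> \<le> 2 * onorm F ^ 2 + K + e" using \<eta>(2) by (rule add_left_mono)
      finally show "onorm F ^ 3 \<le> 2 * onorm F ^ 2 + K + e" .
    qed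
  qed
  have "K \<in> closure (onorm ` \<F>)" unfolding K_def
    using bdd F by (intro closure_contains_Sup) auto
  also have "\<dots> \<subseteq> {t. t ^ 3 \<le> 2 * t^2 + K}"
    by (rule closure_minimal) (use cubic in \<open>auto intro!: closed_Collect_le continuous_intros\<close>)
  finally have K3: "K ^ 3 \<le> 2 * K^2 + K" by simp
  have "K \<le> 1 + sqrt 2"
  proof (cases "K = 0")
    case False
    with K K3 have "K * K^2 \<le> K * (2 * K + 1)" by (simp add: power2_eq_square power3_eq_cube algebra_simps)
    then have "K^2 \<le> 2 * K + 1" using False K by (simp only: mult_le_cancel_left_pos order_le_less) auto
    then have "(K - 1)^2 \<le> 2" by (simp add: power2_eq_square algebra_simps)
    then have "K - 1 \<le> sqrt 2" by (rule real_le_rsqrt)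
    then show ?thesis by simp
  qed (simp add: add_nonneg_nonneg)
  with upper[OF F] show ?thesis by simp
qed

section \<open>Operators constrained to a disc minus a disc\<close>

text \<open>
  The signed excess of \<open>z\<close> over the two circles: its zero sublevel set is the closed disc
  about \<open>c1\<close> with the open disc about \<open>c2\<close> removed, and its \<open>\<delta>\<close>-sublevel set is the same kind
  of set with both radii moved outwards by \<open>\<delta>\<close>.
\<close>

definition excess :: "complex \<Rightarrow> real \<Rightarrow> complex \<Rightarrow> real \<Rightarrow> complex \<Rightarrow> real" where
  "excess c1 R c2 r z = max (cmod (z - c1) - R) (r - cmod (z - c2))"

lemma continuous_on_excess [continuous_intros]: "continuous_on S (excess c1 R c2 r)"
  unfolding excess_def by (intro continuous_intros)

definition crescent :: "complex \<Rightarrow> real \<Rightarrow> complex \<Rightarrow> real \<Rightarrow> complex set" where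
  "crescent c1 R c2 r = {z. cmod (z - c1) \<le> R \<and> r \<le> cmod (z - c2)}"

lemma crescent_excess: "crescent c1 (R + d) c2 (r - d) = {z. excess c1 R c2 r z \<le> d}"
  by (auto simp: crescent_def excess_def)

lemma compact_crescent: "compact (crescent c1 R c2 r)"
proof -
  have "crescent c1 R c2 r = cball c1 R \<inter> - ball c2 r"
    by (auto simp: crescent_def dist_norm norm_minus_commute)
  then show ?thesis by (simp add: compact_Int_closed closed_Compl)
qed

text \<open>
  The constraint on the second disc is a lower bound for \<open>A - c2\<close> and not an upper bound for the
  inverse, since this is the form in which the Poisson kernel consumes it.
\<close>

definition crescent_op :: "complex \<Rightarrow> real \<Rightarrow> complex \<Rightarrow> real \<Rightarrow> ('a::complex_inner \<Rightarrow> 'a) \<Rightarrow> bool" where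
  "crescent_op c1 R c2 r A \<longleftrightarrow> bounded_clinear A \<and> op_invertible (\<lambda>x. A x - c2 *\<^sub>C x) \<and>
     (\<forall>x. norm (A x - c1 *\<^sub>C x) \<le> R * norm x) \<and> (\<forall>x. r * norm x \<le> norm (A x - c2 *\<^sub>C x))"

text \<open>
  Points of the crescent are the operators of this kind on the complex numbers.
\<close>

lemma crescent_op_mult:
  assumes "z \<in> crescent c1 R c2 r" "r > 0"
  shows "crescent_op c1 R c2 r (\<lambda>w :: complex. z * w)"
proof -
  have eq: "z * w - c *\<^sub>C w = (z - c) * w" for c w :: complex
    by (simp add: scaleC_complex_def algebra_simps)
  have nz: "z \<noteq> c2" using assms by (auto simp: crescent_def)
  have lin: "bounded_clinear (\<lambda>w :: complex. u * w)" for u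
    using bounded_clinear_scale[of u, where 'a = complex] by (simp add: scaleC_complex_def)
  have "op_invertible (\<lambda>w. (z - c2) * w)"
    unfolding op_invertible_def using nz
    by (intro exI[of _ "\<lambda>w. inverse (z - c2) * w"] conjI lin) (auto simp: fun_eq_iff)
  then show ?thesis
    using assms lin unfolding crescent_op_def eq
    by (auto simp: crescent_def norm_mult intro!: mult_right_mono)
qed

definition resolvent :: "('a::complex_inner \<Rightarrow> 'a) \<Rightarrow> complex \<Rightarrow> 'a \<Rightarrow> 'a" where
  "resolvent A \<mu> = inv (\<lambda>x. A x - \<mu> *\<^sub>C x)"

lemma resolvent_mult: "z \<noteq> \<mu> \<Longrightarrow> resolvent (\<lambda>w :: complex. z * w) \<mu> = (\<lambda>w. w / (z - \<mu>))"
  unfolding resolvent_def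
  by (rule inv_unique_comp) (auto simp: fun_eq_iff scaleC_complex_def simp flip: left_diff_distrib)

lemma crescent_op_resolvent:
  fixes A :: "'a :: complex_hilbert_space \<Rightarrow> 'a"
  assumes A: "crescent_op c1 R c2 r A" and R: "R \<ge> 0" and \<mu>: "excess c1 R c2 r \<mu> > 0"
  shows "op_invertible (\<lambda>x. A x - \<mu> *\<^sub>C x)"
    and "excess c1 R c2 r \<mu> * norm x \<le> norm (A x - \<mu> *\<^sub>C x)"
proof -
  have lin: "bounded_clinear A" and inv: "op_invertible (\<lambda>x. A x - c2 *\<^sub>C x)"
    and up: "\<And>x. norm (A x - c1 *\<^sub>C x) \<le> R * norm x"
    and lo: "\<And>x. r * norm x \<le> norm (A x - c2 *\<^sub>C x)"
    using A by (auto simp: crescent_op_def)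
  have lin': "bounded_clinear (\<lambda>x. c *\<^sub>C x - A x)" "bounded_clinear (\<lambda>x. c *\<^sub>C x)" for c
    using lin by (auto intro: bounded_clinear_diff bounded_clinear_scale)
  have scale_inv: "op_invertible (\<lambda>x :: 'a. c *\<^sub>C x)" if "c \<noteq> 0" for c
    unfolding op_invertible_def using that
    by (intro exI[of _ "\<lambda>x. inverse c *\<^sub>C x"]) (auto simp: lin' fun_eq_iff scaleC_scaleC)
  have outer: "op_invertible (\<lambda>x. A x - \<mu> *\<^sub>C x)" if "cmod (\<mu> - c1) > R"
  proof -
    have "op_invertible (\<lambda>x. (c1 - \<mu>) *\<^sub>C x - (c1 *\<^sub>C x - A x))"
    proof (rule op_invertible_perturb[where c = "cmod (\<mu> - c1)" and e = R])
      show "op_invertible (\<lambda>x :: 'a. (c1 - \<mu>) *\<^sub>C x)" using that R by (intro scale_inv) auto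
      show "norm (c1 *\<^sub>C x - A x) \<le> R * norm x" for x using up[of x] by (simp add: norm_minus_commute)
    qed (use that R in \<open>auto simp: lin' norm_scaleC norm_minus_commute\<close>)
    then show ?thesis by (simp add: scaleC_diff_left)
  qed
  have inner: "op_invertible (\<lambda>x. A x - \<mu> *\<^sub>C x)" if "cmod (\<mu> - c2) < r"
  proof -
    have "op_invertible (\<lambda>x. (A x - c2 *\<^sub>C x) - (\<mu> - c2) *\<^sub>C x)"
      by (rule op_invertible_perturb[where c = r and e = "cmod (\<mu> - c2)"])
        (use that inv lo lin in \<open>auto simp: lin' norm_scaleC intro!: bounded_clinear_shift\<close>)
    then show ?thesis by (simp add: scaleC_diff_left)
  qed
  show "op_invertible (\<lambda>x. A x - \<mu> *\<^sub>C x)"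
    using \<mu> outer inner by (auto simp: excess_def max_def split: if_splits)
  have "norm ((\<mu> - c1) *\<^sub>C x) - norm (A x - c1 *\<^sub>C x) \<le> norm (A x - \<mu> *\<^sub>C x)"
    using norm_triangle_ineq3[of "(\<mu> - c1) *\<^sub>C x" "A x - c1 *\<^sub>C x"]
    by (simp add: scaleC_diff_left norm_minus_commute)
  then have 1: "(cmod (\<mu> - c1) - R) * norm x \<le> norm (A x - \<mu> *\<^sub>C x)"
    using up[of x] by (simp add: norm_scaleC left_diff_distrib)
  have "norm (A x - c2 *\<^sub>C x) - norm ((\<mu> - c2) *\<^sub>C x) \<le> norm (A x - \<mu> *\<^sub>C x)"
    using norm_triangle_ineq2[of "A x - c2 *\<^sub>C x" "(\<mu> - c2) *\<^sub>C x"]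
    by (simp add: scaleC_diff_left)
  then have 2: "(r - cmod (\<mu> - c2)) * norm x \<le> norm (A x - \<mu> *\<^sub>C x)"
    using lo[of x] by (simp add: norm_scaleC left_diff_distrib)
  show "excess c1 R c2 r \<mu> * norm x \<le> norm (A x - \<mu> *\<^sub>C x)"
    using 1 2 by (simp add: excess_def max_def)
qed

text \<open>
  The rational functions without poles in \<open>X\<close>, each paired with its value at \<open>A\<close>. A relation needs no
  choice of a representation of \<open>f\<close>, and claims about \<open>f(A)\<close> become inductions.
\<close>

inductive rat_calculus ::
  "complex set \<Rightarrow> ('a::complex_inner \<Rightarrow> 'a) \<Rightarrow> (complex \<Rightarrow> complex) \<Rightarrow> ('a \<Rightarrow> 'a) \<Rightarrow> bool" for X A
where
  const: "rat_calculus X A (\<lambda>z. c) (\<lambda>x. c *\<^sub>C x)"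
| ident: "rat_calculus X A (\<lambda>z. z) A"
| pole: "a \<notin> X \<Longrightarrow> rat_calculus X A (\<lambda>z. 1 / (z - a)) (resolvent A a)"
| add: "rat_calculus X A f F \<Longrightarrow> rat_calculus X A g G \<Longrightarrow>
    rat_calculus X A (\<lambda>z. f z + g z) (\<lambda>x. F x + G x)"
| mult: "rat_calculus X A f F \<Longrightarrow> rat_calculus X A g G \<Longrightarrow>
    rat_calculus X A (\<lambda>z. f z * g z) (\<lambda>x. F (G x))"

lemma rat_calculus_mono:
  assumes "rat_calculus Y A f F" "X \<subseteq> Y"
  shows "rat_calculus X A f F"
  using assms by induction (auto intro: rat_calculus.intros)

lemma rat_calculus_analytic:
  assumes "rat_calculus X A f F"
  shows "f analytic_on X"
  using assms by induction (auto intro!: analytic_intros)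

lemma rat_calculus_bounded_clinear:
  assumes "rat_calculus X A f F" "bounded_clinear A" "spectrum A \<subseteq> X"
  shows "bounded_clinear F"
  using assms
proof induction
  case (pole a)
  then have "op_invertible (\<lambda>x. A x - a *\<^sub>C x)" by (auto simp: spectrum_def)
  then show ?case unfolding resolvent_def by (rule op_invertible_inv)
qed (auto intro: bounded_clinear_scale bounded_clinear_add bounded_clinear_compose)

lemma rat_calculus_scale:
  "rat_calculus X A f F \<Longrightarrow> rat_calculus X A (\<lambda>z. c * f z) (\<lambda>x. c *\<^sub>C F x)"
  by (rule mult[OF const])

lemma poly_op_pCons:
  fixes A :: "'a :: complex_inner \<Rightarrow> 'a"
  assumes A: "bounded_clinear A"
  shows "poly_op (pCons c p) A = (\<lambda>x. c *\<^sub>C x + A (poly_op p A x))"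
proof
  fix x
  note l = bounded_clinearD[OF A]
  have ext: "poly_op p A x = (\<Sum>i\<le>n. coeff p i *\<^sub>C (A ^^ i) x)" if "degree p \<le> n" for p n
    unfolding poly_op_def
    by (rule sum.mono_neutral_left) (use that in \<open>auto simp: coeff_eq_0\<close>)
  have "poly_op (pCons c p) A x = (\<Sum>i\<le>Suc (degree p). coeff (pCons c p) i *\<^sub>C (A ^^ i) x)"
    by (rule ext) (rule degree_pCons_le)
  also have "\<dots> = c *\<^sub>C x + (\<Sum>i\<le>degree p. coeff p i *\<^sub>C A ((A ^^ i) x))"
    by (subst sum.atMost_Suc_shift) simp
  also have "(\<Sum>i\<le>degree p. coeff p i *\<^sub>C A ((A ^^ i) x)) = A (poly_op p A x)"
    using l by (simp add: poly_op_def linear_sum bounded_linear.linear)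
  finally show "poly_op (pCons c p) A x = c *\<^sub>C x + A (poly_op p A x)" .
qed

lemma rat_calculus_poly:
  assumes A: "bounded_clinear A"
  shows "rat_calculus X A (poly p) (poly_op p A)"
proof (induction p)
  case 0
  have "poly_op 0 A = (\<lambda>x. 0 *\<^sub>C x)" by (simp add: poly_op_def)
  then show ?case using const[of X A 0] by (simp add: fun_eq_iff)
next
  case (pCons c p)
  have "poly (pCons c p) = (\<lambda>z. c + z * poly p z)" by (simp add: fun_eq_iff)
  then show ?case
    unfolding poly_op_pCons[OF A] using add[OF const mult[OF ident pCons(2)], of c] by simp
qed

lemma poly_op_linear_factor:
  assumes A: "bounded_clinear A"
  shows "poly_op ([:- a, 1:] * p) A = (\<lambda>x. A (poly_op p A x) - a *\<^sub>C poly_op p A x)"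
proof -
  have add: "poly_op (p + q) A x = poly_op p A x + poly_op q A x" for p q x
  proof (induction p arbitrary: q)
    case 0
    show ?case by (simp add: poly_op_def)
  next
    case (pCons c p)
    obtain d q' where "q = pCons d q'" by (cases q) auto
    then show ?case
      by (simp add: poly_op_pCons[OF A] pCons bounded_clinearD[OF A] scaleC_add_left)
  qed
  have smult: "poly_op (smult c p) A x = c *\<^sub>C poly_op p A x" for c x
    by (induction p) (simp_all add: poly_op_pCons[OF A] bounded_clinearD[OF A] scaleC_add_right
        scaleC_scaleC poly_op_def[of 0])
  show ?thesis
  proof
    fix x
    have "[:- a, 1:] * p = smult (- a) p + pCons 0 p" by simp
    then have "poly_op ([:- a, 1:] * p) A x = poly_op (smult (- a) p + pCons 0 p) A x" by (rule arg_cong)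
    then show "poly_op ([:- a, 1:] * p) A x = A (poly_op p A x) - a *\<^sub>C poly_op p A x"
      unfolding add smult by (simp add: poly_op_pCons[OF A] scaleC_minus_left)
  qed
qed

text \<open>
  Split off the linear factors of \<open>q\<close>; each one is invertible at \<open>A\<close> because its root lies outside the
  spectrum.
\<close>

lemma rat_calculus_inverse_poly:
  assumes A: "bounded_clinear A" "spectrum A \<subseteq> X" and "q \<noteq> 0" "\<forall>z\<in>X. poly q z \<noteq> 0"
  shows "bij (poly_op q A) \<and> rat_calculus X A (\<lambda>z. 1 / poly q z) (inv (poly_op q A))"
  using assms(3,4)
proof (induction "degree q" arbitrary: q)
  case 0
  then obtain c where c: "q = [:c:]" "c \<noteq> 0" by (metis degree_eq_zeroE pCons_0_0)
  have "poly_op q A = (\<lambda>x. c *\<^sub>C x)" using c by (simp add: poly_op_def)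
  moreover have "(\<lambda>x. inverse c *\<^sub>C x) \<circ> (\<lambda>x. c *\<^sub>C x) = id"
      "(\<lambda>x. c *\<^sub>C x) \<circ> (\<lambda>x. inverse c *\<^sub>C x) = (id :: 'a \<Rightarrow> 'a)"
    using c by (auto simp: fun_eq_iff scaleC_scaleC)
  ultimately show ?case using const[of X A "inverse c"] c
    by (auto simp: inv_unique_comp divide_inverse intro: o_bij)
next
  case (Suc n)
  then have "\<not> constant (poly q)" by (simp add: constant_degree)
  then obtain a where a: "poly q a = 0" using fundamental_theorem_of_algebra by blast
  then obtain p where p: "q = [:- a, 1:] * p" by (auto simp: poly_eq_0_iff_dvd elim: dvdE)
  have "p \<noteq> 0" using p Suc by auto
  then have "degree q = degree [:- a, 1:] + degree p" unfolding p by (intro degree_mult_eq) auto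
  then have dp: "n = degree p" using Suc(2) by simp
  have "\<forall>z\<in>X. poly p z \<noteq> 0" using Suc(4) p by auto
  from Suc(1)[OF dp \<open>p \<noteq> 0\<close> this]
  have IH: "bij (poly_op p A)" "rat_calculus X A (\<lambda>z. 1 / poly p z) (inv (poly_op p A))"
    by auto
  have aX: "a \<notin> X" using a Suc(4) by auto
  then have inv: "op_invertible (\<lambda>x. A x - a *\<^sub>C x)" using A(2) by (auto simp: spectrum_def)
  have eq: "poly_op q A = (\<lambda>x. A x - a *\<^sub>C x) \<circ> poly_op p A"
    unfolding p poly_op_linear_factor[OF A(1)] by (simp add: o_def)
  have "inv (poly_op q A) = inv (poly_op p A) \<circ> resolvent A a"
    unfolding eq resolvent_def by (rule o_inv_distrib) (use IH inv op_invertible_bij in auto)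
  then have "rat_calculus X A (\<lambda>z. 1 / poly p z * (1 / (z - a))) (inv (poly_op q A))"
    using mult[OF IH(2) pole[OF aX]] by (simp add: o_def)
  moreover have "(\<lambda>z. 1 / poly p z * (1 / (z - a))) = (\<lambda>z. 1 / poly q z)"
    by (simp add: p fun_eq_iff algebra_simps)
  moreover have "bij (poly_op q A)"
    unfolding eq by (intro bij_comp IH op_invertible_bij inv)
  ultimately show ?case by simp
qed

lemma rat_calculus_rat_op:
  assumes "bounded_clinear A" "spectrum A \<subseteq> X" "q \<noteq> 0" "\<forall>z\<in>X. poly q z \<noteq> 0"
  shows "rat_calculus X A (\<lambda>z. poly p z / poly q z) (rat_op p q A)"
  using mult[OF rat_calculus_poly rat_calculus_inverse_poly[THEN conjunct2]] assms
  by (fastforce simp: rat_op_def o_def)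

section \<open>Integrals over circular arcs\<close>

definition arc_points :: "complex \<Rightarrow> real \<Rightarrow> real \<Rightarrow> real \<Rightarrow> complex set" where
  "arc_points c \<rho> a b = (\<lambda>t. c + of_real \<rho> * cis t) ` {a..b}"

text \<open>
  The factor is chosen such that the mean of \<open>h z * (z - c)\<close> is the contour integral of \<open>h\<close> over the arc
  divided by \<open>2\<pi>\<i>\<close>, and such that the mean over a full circle is an average. Empty arcs, with
  \<open>b < a\<close>, have mean zero.
\<close>

definition arc_mean :: "complex \<Rightarrow> real \<Rightarrow> real \<Rightarrow> real \<Rightarrow> (complex \<Rightarrow> complex) \<Rightarrow> complex" where
  "arc_mean c \<rho> a b h = integral {a..b} (\<lambda>t. h (c + of_real \<rho> * cis t)) / of_real (2 * pi)"

abbreviation "circle_points c \<rho> a \<equiv> arc_points c \<rho> a (a + 2 * pi)"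
abbreviation "circle_mean c \<rho> a \<equiv> arc_mean c \<rho> a (a + 2 * pi)"

lemma continuous_on_circle: "continuous_on S (\<lambda>t. c + of_real \<rho> * cis t)"
  by (intro continuous_intros)

lemma arc_points_I: "a \<le> t \<Longrightarrow> t \<le> b \<Longrightarrow> c + of_real \<rho> * cis t \<in> arc_points c \<rho> a b"
  by (auto simp: arc_points_def)

lemma compact_arc_points: "compact (arc_points c \<rho> a b)"
  unfolding arc_points_def by (intro compact_continuous_image continuous_on_circle compact_Icc)

lemma arc_points_norm: "z \<in> arc_points c \<rho> a b \<Longrightarrow> \<rho> \<ge> 0 \<Longrightarrow> cmod (z - c) = \<rho>"
  by (auto simp: arc_points_def norm_mult)

lemma arc_points_mono: "a' \<le> a \<Longrightarrow> b \<le> b' \<Longrightarrow> arc_points c \<rho> a b \<subseteq> arc_points c \<rho> a' b'"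
  by (auto simp: arc_points_def)

lemma continuous_on_arc:
  "continuous_on (arc_points c \<rho> a b) h \<Longrightarrow> continuous_on {a..b} (\<lambda>t. h (c + of_real \<rho> * cis t))"
  by (rule continuous_on_compose2[OF _ continuous_on_circle]) (auto simp: arc_points_def)

lemma arc_integrable:
  fixes h :: "complex \<Rightarrow> 'b :: banach"
  shows "continuous_on (arc_points c \<rho> a b) h \<Longrightarrow> (\<lambda>t. h (c + of_real \<rho> * cis t)) integrable_on {a..b}"
  by (rule integrable_continuous_real[OF continuous_on_arc])

lemma arc_mean_cong:
  "(\<And>z. z \<in> arc_points c \<rho> a b \<Longrightarrow> f z = g z) \<Longrightarrow> arc_mean c \<rho> a b f = arc_mean c \<rho> a b g"
  unfolding arc_mean_def by (intro arg_cong2[where f = "(/)"] integral_cong) (auto intro: arc_points_I)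

lemma arc_mean_add:
  "continuous_on (arc_points c \<rho> a b) f \<Longrightarrow> continuous_on (arc_points c \<rho> a b) g \<Longrightarrow>
    arc_mean c \<rho> a b (\<lambda>z. f z + g z) = arc_mean c \<rho> a b f + arc_mean c \<rho> a b g"
  by (simp add: arc_mean_def integral_add arc_integrable add_divide_distrib)

lemma arc_mean_diff:
  "continuous_on (arc_points c \<rho> a b) f \<Longrightarrow> continuous_on (arc_points c \<rho> a b) g \<Longrightarrow>
    arc_mean c \<rho> a b (\<lambda>z. f z - g z) = arc_mean c \<rho> a b f - arc_mean c \<rho> a b g"
  by (simp add: arc_mean_def integral_diff arc_integrable diff_divide_distrib)

lemma arc_mean_mult: "arc_mean c \<rho> a b (\<lambda>z. k * f z) = k * arc_mean c \<rho> a b f"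
  by (simp add: arc_mean_def)

lemma arc_mean_uminus: "arc_mean c \<rho> a b (\<lambda>z. - f z) = - arc_mean c \<rho> a b f"
  by (simp add: arc_mean_def)

lemma arc_mean_cnj: "arc_mean c \<rho> a b (\<lambda>z. cnj (f z)) = cnj (arc_mean c \<rho> a b f)"
  by (simp add: arc_mean_def integral_cnj)

lemma arc_mean_combine:
  assumes "a \<le> m" "m \<le> b" "continuous_on (arc_points c \<rho> a b) h"
  shows "arc_mean c \<rho> a m h + arc_mean c \<rho> m b h = arc_mean c \<rho> a b h"
  using Henstock_Kurzweil_Integration.integral_combine[OF assms(1,2) arc_integrable[OF assms(3)]]
  by (simp add: arc_mean_def add_divide_distrib[symmetric])

lemma arc_mean_const_full: "circle_mean c \<rho> a (\<lambda>z. k) = k"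
  by (simp add: arc_mean_def scaleR_conv_of_real)

lemma norm_arc_mean_le_Re:
  assumes "continuous_on (arc_points c \<rho> a b) f" "continuous_on (arc_points c \<rho> a b) g"
    and "\<And>z. z \<in> arc_points c \<rho> a b \<Longrightarrow> cmod (f z) \<le> Re (g z)"
  shows "cmod (arc_mean c \<rho> a b f) \<le> Re (arc_mean c \<rho> a b g)"
proof -
  have "cmod (integral {a..b} (\<lambda>t. f (c + of_real \<rho> * cis t))) \<le>
      integral {a..b} (\<lambda>t. Re (g (c + of_real \<rho> * cis t)))"
    using assms by (intro integral_norm_bound_integral arc_integrable continuous_intros)
      (auto intro: arc_points_I)
  also have "\<dots> = Re (integral {a..b} (\<lambda>t. g (c + of_real \<rho> * cis t)))"
    using integral_linear[OF arc_integrable[OF assms(2)] bounded_linear_Re] by (simp add: o_def)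
  finally show ?thesis
    by (simp add: arc_mean_def norm_divide divide_right_mono flip: of_real_mult)
qed

lemma norm_arc_mean_le:
  assumes "continuous_on (arc_points c \<rho> a b) f" "b \<le> a + 2 * pi" "B \<ge> 0"
    and "\<And>z. z \<in> arc_points c \<rho> a b \<Longrightarrow> cmod (f z) \<le> B"
  shows "cmod (arc_mean c \<rho> a b f) \<le> B"
proof -
  have "cmod (arc_mean c \<rho> a b f) \<le> Re (arc_mean c \<rho> a b (\<lambda>z. of_real B))"
    by (rule norm_arc_mean_le_Re) (use assms in auto)
  also have "\<dots> = B * (measure lborel {a..b} / (2 * pi))"
    by (simp add: arc_mean_def scaleR_conv_of_real flip: of_real_mult)
  also have "\<dots> \<le> B * 1"
    using assms(2,3) by (intro mult_left_mono) (auto simp: content_real_if)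
  finally show ?thesis by simp
qed

lemma Re_arc_mean_mono_set:
  assumes "continuous_on (circle_points c \<rho> a) f" "b \<le> a + 2 * pi"
    and "\<And>z. z \<in> circle_points c \<rho> a \<Longrightarrow> 0 \<le> Re (f z)"
  shows "Re (arc_mean c \<rho> a b f) \<le> Re (circle_mean c \<rho> a f)"
proof -
  have sub: "arc_points c \<rho> a b \<subseteq> circle_points c \<rho> a" using assms(2) by (intro arc_points_mono) auto
  have c: "continuous_on (arc_points c \<rho> a b) f" by (rule continuous_on_subset[OF assms(1) sub])
  have "integral {a..b} (\<lambda>t. Re (f (c + of_real \<rho> * cis t))) \<le>
      integral {a..a + 2 * pi} (\<lambda>t. Re (f (c + of_real \<rho> * cis t)))"
  proof (rule integral_subset_le)
    show "\<forall>t\<in>{a..a + 2 * pi}. 0 \<le> Re (f (c + of_real \<rho> * cis t))"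
      by (intro ballI assms(3) arc_points_I) auto
  qed (use assms c in \<open>auto intro!: arc_integrable continuous_intros\<close>)
  then show ?thesis
    using integral_linear[OF arc_integrable[OF c] bounded_linear_Re]
      integral_linear[OF arc_integrable[OF assms(1)] bounded_linear_Re]
    by (simp add: o_def arc_mean_def divide_right_mono flip: of_real_mult)
qed

lemma arc_mean_contour_integral:
  assumes "a < b"
  shows "contour_integral (part_circlepath c \<rho> a b) h
    = 2 * of_real pi * \<i> * arc_mean c \<rho> a b (\<lambda>z. h z * (z - c))"
proof -
  have "contour_integral (part_circlepath c \<rho> a b) h =
      integral {a..b} (\<lambda>t. \<i> * (h (c + of_real \<rho> * cis t) * (of_real \<rho> * cis t)))"
    unfolding contour_integral_part_circlepath_eq[OF assms] by (simp add: mult_ac)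
  then show ?thesis by (simp add: arc_mean_def)
qed

lemma path_image_arc:
  assumes "a \<le> b"
  shows "path_image (part_circlepath c \<rho> a b) = arc_points c \<rho> a b"
  using assms by (simp add: path_image_part_circlepath' arc_points_def closed_segment_eq_real_ivl)

lemma cis_add_2pi: "cis (a + 2 * pi) = cis a"
  by (simp add: cis.ctr)

text \<open>
  The straight-line homotopy between the two parametrized circles passes through circles nested between
  them, so it stays in the closed ring.
\<close>

lemma eccentric_circles_arc_mean:
  assumes \<rho>: "0 < \<rho>2" "cmod (c1 - c2) + \<rho>2 \<le> \<rho>1"
    and h: "h analytic_on crescent c1 \<rho>1 c2 \<rho>2"
  shows "circle_mean c1 \<rho>1 a (\<lambda>z. h z * (z - c1)) =
    circle_mean c2 \<rho>2 a (\<lambda>z. h z * (z - c2))"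
proof -
  obtain U where U: "open U" "crescent c1 \<rho>1 c2 \<rho>2 \<subseteq> U" "h holomorphic_on U"
    using h by (auto simp: analytic_on_holomorphic)
  define g1 where "g1 = part_circlepath c1 \<rho>1 a (a + 2 * pi)"
  define g2 where "g2 = part_circlepath c2 \<rho>2 a (a + 2 * pi)"
  have seg: "closed_segment (g1 t) (g2 t) \<subseteq> U" for t
  proof
    fix z assume "z \<in> closed_segment (g1 t) (g2 t)"
    then obtain u where u: "0 \<le> u" "u \<le> 1" "z = (1 - u) *\<^sub>R g1 t + u *\<^sub>R g2 t"
      by (auto simp: in_segment)
    define e where "e = exp (\<i> * of_real (linepath a (a + 2 * pi) t))"
    define w where "w = of_real ((1 - u) * \<rho>1 + u * \<rho>2) * e"
    have e: "cmod e = 1"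
      by (simp add: e_def)
    have g: "g1 t = c1 + of_real \<rho>1 * e" "g2 t = c2 + of_real \<rho>2 * e"
      by (simp_all add: g1_def g2_def part_circlepath_def e_def)
    have rad: "0 \<le> (1 - u) * \<rho>1 + u * \<rho>2" using u \<rho> norm_ge_zero[of "c1 - c2"]
      by (intro add_nonneg_nonneg mult_nonneg_nonneg) linarith+
    then have w: "cmod w = (1 - u) * \<rho>1 + u * \<rho>2" by (simp add: w_def norm_mult e del: of_real_add of_real_mult of_real_diff)
    have z: "z = c1 + of_real u * (c2 - c1) + w" "z = c2 + of_real (1 - u) * (c1 - c2) + w"
      by (simp_all add: u(3) g w_def scaleR_conv_of_real algebra_simps)
    have "cmod (z - c1) \<le> u * cmod (c1 - c2) + ((1 - u) * \<rho>1 + u * \<rho>2)"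
      unfolding z(1) using norm_triangle_ineq[of "of_real u * (c2 - c1)" w] w u(1)
      by (simp add: norm_mult norm_minus_commute)
    also have "\<dots> = u * (cmod (c1 - c2) + \<rho>2) + (1 - u) * \<rho>1" by (simp add: algebra_simps)
    also have "\<dots> \<le> u * \<rho>1 + (1 - u) * \<rho>1" using \<rho> u by (intro add_right_mono mult_left_mono) auto
    finally have 1: "cmod (z - c1) \<le> \<rho>1" by (simp add: algebra_simps)
    have "\<rho>2 = (1 - u) * \<rho>2 + u * \<rho>2" by (simp add: algebra_simps)
    also have "\<dots> \<le> (1 - u) * (\<rho>1 - cmod (c1 - c2)) + u * \<rho>2"
      using \<rho> u by (intro add_right_mono mult_left_mono) auto
    also have "\<dots> = cmod w - cmod (of_real (1 - u) * (c1 - c2))"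
      unfolding w norm_mult norm_of_real using u by (simp add: algebra_simps)
    also have "\<dots> \<le> cmod (z - c2)"
      unfolding z(2) using norm_triangle_ineq2[of w "- (of_real (1 - u) * (c1 - c2))"]
      by (simp add: add.commute)
    finally show "z \<in> U" using 1 U(2) by (auto simp: crescent_def)
  qed
  have loop: "exp (\<i> * (of_real a + 2 * of_real pi)) = exp (\<i> * of_real a)"
    using cis_add_2pi[of a] by (simp add: cis_conv_exp)
  have "homotopic_loops U g1 g2"
    by (rule homotopic_loops_linear) (use seg loop in \<open>auto simp: g1_def g2_def\<close>)
  then have "contour_integral g1 h = contour_integral g2 h"
    by (rule Cauchy_theorem_homotopic_loops) (use U in \<open>auto simp: g1_def g2_def\<close>)
  then show ?thesis unfolding g1_def g2_def by (simp add: arc_mean_contour_integral)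
qed

section \<open>The boundary of a crescent\<close>

text \<open>
  The integral over the boundary of the crescent, divided by \<open>2\<pi>\<i>\<close>; the inner circle is traversed
  clockwise, hence the minus sign.
\<close>

definition crescent_mean ::
  "complex \<Rightarrow> real \<Rightarrow> real \<Rightarrow> real \<Rightarrow> complex \<Rightarrow> real \<Rightarrow> real \<Rightarrow> real \<Rightarrow> (complex \<Rightarrow> complex) \<Rightarrow> complex"
where
  "crescent_mean c1 \<rho>1 a1 b1 c2 \<rho>2 a2 b2 h =
    arc_mean c1 \<rho>1 a1 b1 (\<lambda>z. h z * (z - c1)) - arc_mean c2 \<rho>2 a2 b2 (\<lambda>z. h z * (z - c2))"

text \<open>
  All that is used about the boundary. Cauchy's theorem holds for functions that are analytic on the
  crescent; for functions that are analytic outside it, resolvents in particular, the outer circle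
  alone gives the same integral.
\<close>

locale crescent_contour =
  fixes c1 :: complex and \<rho>1 a1 b1 :: real and c2 :: complex and \<rho>2 a2 b2 :: real
  assumes radii: "\<rho>1 > 0" "\<rho>2 > 0"
    and full: "b1 \<le> a1 + 2 * pi" "b2 \<le> a2 + 2 * pi"
    and arcs: "arc_points c1 \<rho>1 a1 b1 \<subseteq> crescent c1 \<rho>1 c2 \<rho>2"
      "arc_points c2 \<rho>2 a2 b2 \<subseteq> crescent c1 \<rho>1 c2 \<rho>2"
    and cauchy: "h analytic_on crescent c1 \<rho>1 c2 \<rho>2 \<Longrightarrow> crescent_mean c1 \<rho>1 a1 b1 c2 \<rho>2 a2 b2 h = 0"
    and exterior: "\<exists>a. \<forall>h. h analytic_on {z. \<rho>1 \<le> cmod (z - c1) \<or> cmod (z - c2) \<le> \<rho>2} \<longrightarrow>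
      crescent_mean c1 \<rho>1 a1 b1 c2 \<rho>2 a2 b2 h = circle_mean c1 \<rho>1 a (\<lambda>z. h z * (z - c1))"

lemma circle_mean_eq_0:
  assumes "h analytic_on cball c \<rho>" "\<rho> > 0"
  shows "circle_mean c \<rho> a (\<lambda>z. h z * (z - c)) = 0"
proof -
  have hol: "h holomorphic_on cball c \<rho>" using assms by (simp add: analytic_imp_holomorphic)
  have loop: "exp (\<i> * (of_real a + 2 * of_real pi)) = exp (\<i> * of_real a)"
    using cis_add_2pi[of a] by (simp add: cis_conv_exp)
  have "path_image (part_circlepath c \<rho> a (a + 2 * pi)) \<subseteq> cball c \<rho>"
    using path_image_part_circlepath_subset'[of \<rho> c a "a + 2 * pi"] assms(2) sphere_cball by force
  then have "(h has_contour_integral 0) (part_circlepath c \<rho> a (a + 2 * pi))"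
    using loop by (intro Cauchy_theorem_convex_simple[OF hol]) auto
  then have "contour_integral (part_circlepath c \<rho> a (a + 2 * pi)) h = 0"
    by (rule contour_integral_unique)
  then show ?thesis by (simp add: arc_mean_contour_integral)
qed

lemma crescent_contour_ring:
  assumes "\<rho>2 > 0" "cmod (c1 - c2) + \<rho>2 \<le> \<rho>1"
  shows "crescent_contour c1 \<rho>1 0 (2 * pi) c2 \<rho>2 0 (2 * pi)"
proof
  let ?I = "crescent_mean c1 \<rho>1 0 (2 * pi) c2 \<rho>2 0 (2 * pi)"
    and ?Y = "{z. \<rho>1 \<le> cmod (z - c1) \<or> cmod (z - c2) \<le> \<rho>2}"
  show "\<rho>1 > 0" using assms norm_ge_zero[of "c1 - c2"] by linarith
  show "arc_points c1 \<rho>1 0 (2 * pi) \<subseteq> crescent c1 \<rho>1 c2 \<rho>2"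
  proof
    fix z assume "z \<in> arc_points c1 \<rho>1 0 (2 * pi)"
    then have "cmod (z - c1) = \<rho>1" using \<open>\<rho>1 > 0\<close> by (simp add: arc_points_norm)
    then show "z \<in> crescent c1 \<rho>1 c2 \<rho>2"
      using assms norm_triangle_ineq2[of "z - c2" "c1 - c2"] norm_triangle_ineq[of "z - c2" "c2 - c1"]
      by (simp add: crescent_def norm_minus_commute)
  qed
  show "arc_points c2 \<rho>2 0 (2 * pi) \<subseteq> crescent c1 \<rho>1 c2 \<rho>2"
  proof
    fix z assume "z \<in> arc_points c2 \<rho>2 0 (2 * pi)"
    then have "cmod (z - c2) = \<rho>2" using assms by (simp add: arc_points_norm)
    then show "z \<in> crescent c1 \<rho>1 c2 \<rho>2"
      using assms norm_triangle_ineq[of "z - c2" "c2 - c1"]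
      by (simp add: crescent_def norm_minus_commute)
  qed
  show "?I h = 0"
    if "h analytic_on crescent c1 \<rho>1 c2 \<rho>2" for h
    using eccentric_circles_arc_mean[OF assms that, of 0] by (simp add: crescent_mean_def)
  show "\<exists>a. \<forall>h. h analytic_on ?Y \<longrightarrow>
      ?I h =
      circle_mean c1 \<rho>1 a (\<lambda>z. h z * (z - c1))"
  proof (intro exI[of _ 0] allI impI)
    fix h assume "h analytic_on ?Y"
    then have "h analytic_on cball c2 \<rho>2"
      by (rule analytic_on_subset) (auto simp: dist_norm norm_minus_commute)
    from circle_mean_eq_0[OF this assms(1), of 0]
    show "?I h =
      arc_mean c1 \<rho>1 0 (0 + 2 * pi) (\<lambda>z. h z * (z - c1))" by (simp add: crescent_mean_def)
  qed
qed (use assms in auto)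

text \<open>
  If the inner disc misses the outer one, then the crescent is a disc. The parameter interval from \<open>1\<close>
  to \<open>0\<close> makes the second arc empty.
\<close>

lemma crescent_contour_disc:
  assumes "\<rho>1 > 0" "\<rho>2 > 0" "\<rho>1 + \<rho>2 \<le> cmod (c1 - c2)"
  shows "crescent_contour c1 \<rho>1 0 (2 * pi) c2 \<rho>2 1 0"
proof
  let ?I = "crescent_mean c1 \<rho>1 0 (2 * pi) c2 \<rho>2 1 0"
    and ?Y = "{z. \<rho>1 \<le> cmod (z - c1) \<or> cmod (z - c2) \<le> \<rho>2}"
  have sub: "cball c1 \<rho>1 \<subseteq> crescent c1 \<rho>1 c2 \<rho>2"
  proof
    fix z assume "z \<in> cball c1 \<rho>1"
    then show "z \<in> crescent c1 \<rho>1 c2 \<rho>2"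
      using assms norm_triangle_ineq[of "c1 - z" "z - c2"]
      by (simp add: crescent_def norm_minus_commute dist_norm)
  qed
  show "arc_points c1 \<rho>1 0 (2 * pi) \<subseteq> crescent c1 \<rho>1 c2 \<rho>2"
    using assms(1) by (intro order_trans[OF _ sub])
      (auto simp: dist_norm norm_minus_commute arc_points_norm)
  show "?I h = 0"
    if "h analytic_on crescent c1 \<rho>1 c2 \<rho>2" for h
    using circle_mean_eq_0[OF analytic_on_subset[OF that sub] assms(1), of 0]
    by (simp add: crescent_mean_def arc_mean_def[of c2])
  show "\<exists>a. \<forall>h. h analytic_on ?Y \<longrightarrow>
      ?I h =
      circle_mean c1 \<rho>1 a (\<lambda>z. h z * (z - c1))"
    by (intro exI[of _ 0]) (simp add: crescent_mean_def arc_mean_def[of c2])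
qed (use assms in \<open>auto simp: arc_points_def\<close>)

lemma cos_le_cos_outside:
  assumes "0 \<le> \<alpha>" "\<alpha> \<le> s" "s \<le> 2 * pi - \<alpha>"
  shows "cos s \<le> cos \<alpha>"
proof (cases "s \<le> pi")
  case False
  have "cos (2 * pi - s) \<le> cos \<alpha>" using False assms by (intro cos_monotone_0_pi_le) auto
  then show ?thesis by simp
qed (use assms in \<open>auto intro: cos_monotone_0_pi_le\<close>)

lemma law_of_cosines:
  "(cmod (of_real x * cis s + of_real y * cis t))^2 = x^2 + y^2 + 2 * x * y * cos (s - t)"
  using sin_cos_squared_add[of s] sin_cos_squared_add[of t] unfolding cmod_power2 cos_diff
  by (simp del: sin_cos_squared_add) algebra

text \<open>
  Let \<open>\<tau>\<close> be the direction from \<open>c1\<close> to \<open>c2\<close>. By the law of cosines the circles meet at the angles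
  \<open>\<tau> \<plusminus> \<alpha>\<close> on the first circle and \<open>\<tau> \<plusminus> \<beta>\<close> on the second, and the boundary consists of the arcs
  away from \<open>\<tau>\<close>. Points outside the crescent have winding number zero: those beyond the outer circle by
  convexity, and those in the inner disc because that disc is connected and reaches beyond the outer
  circle. For functions analytic outside the crescent, the second arc is closed up by the remaining
  arc of the first circle to a loop in the inner disc.
\<close>

lemma crescent_contour_crossing:
  assumes \<rho>: "\<rho>1 > 0" "\<rho>2 > 0" and d: "\<rho>1 < cmod (c1 - c2) + \<rho>2" "\<rho>2 < cmod (c1 - c2) + \<rho>1"
    "cmod (c1 - c2) < \<rho>1 + \<rho>2"
  shows "\<exists>a1 b1 a2 b2. crescent_contour c1 \<rho>1 a1 b1 c2 \<rho>2 a2 b2"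
proof -
  define d where "d = cmod (c1 - c2)"
  define \<tau> where "\<tau> = Arg (c2 - c1)"
  have c2: "c2 = c1 + of_real d * cis \<tau>"
    using rcis_cmod_Arg[of "c2 - c1"] by (simp add: d_def \<tau>_def rcis_def norm_minus_commute)
  have dd: "\<rho>1 < d + \<rho>2" "\<rho>2 < d + \<rho>1" "d < \<rho>1 + \<rho>2" using d by (simp_all add: d_def)
  have d0: "d > 0" using dd by linarith
  define k where "k = (\<rho>1^2 + d^2 - \<rho>2^2) / (2 * \<rho>1 * d)"
  define l where "l = (\<rho>1^2 - \<rho>2^2 - d^2) / (2 * \<rho>2 * d)"
  have "(\<rho>1 - d)^2 < \<rho>2^2" "(\<rho>2 - d)^2 < \<rho>1^2" "\<rho>2^2 < (\<rho>1 + d)^2" "\<rho>1^2 < (\<rho>2 + d)^2"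
    using dd \<rho> d0 by (auto intro!: power2_strict_mono simp: abs_if)
  then have kl: "- 1 < k" "k < 1" "- 1 < l" "l < 1"
    using \<rho> d0 by (simp_all add: k_def l_def field_simps power2_eq_square)
  define \<alpha> where "\<alpha> = arccos k"
  define \<beta> where "\<beta> = arccos l"
  have \<alpha>: "0 < \<alpha>" "\<alpha> < pi" "cos \<alpha> = k" using kl by (auto simp: \<alpha>_def arccos_lt_bounded)
  have \<beta>: "0 < \<beta>" "\<beta> < pi" "cos \<beta> = l" using kl by (auto simp: \<beta>_def arccos_lt_bounded)
  have cosines: "\<rho>1 * cos \<alpha> = d + \<rho>2 * cos \<beta>"
    using \<rho> d0 by (simp add: \<alpha> \<beta> k_def l_def field_simps power2_eq_square)
  \<comment> \<open>Both sides are the distance of an intersection point from the line of centres.\<close>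
  have sines: "\<rho>1 * sin \<alpha> = \<rho>2 * sin \<beta>"
  proof -
    have k: "\<rho>1 * k * (2 * d) = \<rho>1^2 + d^2 - \<rho>2^2" using \<rho> d0 by (simp add: k_def)
    have "(\<rho>2 * sin \<beta>)^2 = \<rho>2^2 - (\<rho>2 * cos \<beta>)^2"
      by (simp add: power_mult_distrib sin_squared_eq algebra_simps)
    also have "\<rho>2 * cos \<beta> = \<rho>1 * k - d" using cosines \<alpha> by simp
    also have "\<rho>2^2 - (\<rho>1 * k - d)^2 = \<rho>1^2 - (\<rho>1 * k)^2"
      using k by (simp add: power2_eq_square algebra_simps)
    also have "\<dots> = (\<rho>1 * sin \<alpha>)^2"
      using \<alpha> by (simp add: power_mult_distrib sin_squared_eq algebra_simps)
    finally show ?thesis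
      using \<rho> \<alpha> \<beta> sin_ge_zero[of \<alpha>] sin_ge_zero[of \<beta>] by (simp add: power2_eq_iff_nonneg)
  qed
  have cos_sub: "\<rho>1 * cis (s) = d + \<rho>2 * cis (s')" if "s = \<alpha> \<and> s' = \<beta> \<or> s = - \<alpha> \<and> s' = - \<beta>" for s s'
    using that cosines sines by (auto simp: complex_eq_iff)
  have meet: "c1 + of_real \<rho>1 * cis (\<tau> + s) = c2 + of_real \<rho>2 * cis (\<tau> + s')"
    if "s = \<alpha> \<and> s' = \<beta> \<or> s = - \<alpha> \<and> s' = - \<beta>" for s s'
    using arg_cong[OF cos_sub[OF that], of "\<lambda>w. cis \<tau> * w"]
    by (simp add: c2 cis_mult[symmetric] algebra_simps)
  have kd: "2 * \<rho>1 * d * k = \<rho>1^2 + d^2 - \<rho>2^2" and ld: "2 * \<rho>2 * d * l = \<rho>1^2 - \<rho>2^2 - d^2"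
    using \<rho> d0 by (simp_all add: k_def l_def)
  have dist2: "(cmod (c1 + of_real \<rho>1 * cis t - c2))^2 = \<rho>2^2 + 2 * \<rho>1 * d * (k - cos (t - \<tau>))" for t
    using law_of_cosines[of \<rho>1 t "- d" \<tau>] kd by (simp add: c2 algebra_simps)
  have dist1: "(cmod (c2 + of_real \<rho>2 * cis t - c1))^2 = \<rho>1^2 + 2 * \<rho>2 * d * (cos (t - \<tau>) - l)" for t
    using law_of_cosines[of \<rho>2 t d \<tau>] ld by (simp add: c2 algebra_simps)
  define a1 where "a1 = \<tau> + \<alpha>"
  define b1 where "b1 = \<tau> + 2 * pi - \<alpha>"
  define a2 where "a2 = \<tau> + \<beta>"
  define b2 where "b2 = \<tau> + 2 * pi - \<beta>"
  have ab: "a1 < b1" "a2 < b2" using \<alpha> \<beta> by (simp_all add: a1_def b1_def a2_def b2_def)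
  have arc1: "arc_points c1 \<rho>1 a1 b1 \<subseteq> crescent c1 \<rho>1 c2 \<rho>2"
  proof
    fix z assume "z \<in> arc_points c1 \<rho>1 a1 b1"
    then obtain t where t: "t \<in> {a1..b1}" "z = c1 + of_real \<rho>1 * cis t" by (auto simp: arc_points_def)
    have "cos (t - \<tau>) \<le> k"
      using t \<alpha> cos_le_cos_outside[of \<alpha> "t - \<tau>"] by (simp add: a1_def b1_def)
    then have "\<rho>2^2 \<le> (cmod (z - c2))^2" unfolding t(2) dist2 using \<rho> d0 by simp
    then have "\<rho>2 \<le> cmod (z - c2)" by (rule power2_le_imp_le) simp
    then show "z \<in> crescent c1 \<rho>1 c2 \<rho>2" using t \<rho> by (simp add: crescent_def norm_mult)
  qed
  have arc2: "arc_points c2 \<rho>2 a2 b2 \<subseteq> crescent c1 \<rho>1 c2 \<rho>2"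
  proof
    fix z assume "z \<in> arc_points c2 \<rho>2 a2 b2"
    then obtain t where t: "t \<in> {a2..b2}" "z = c2 + of_real \<rho>2 * cis t" by (auto simp: arc_points_def)
    have "cos (t - \<tau>) \<le> l"
      using t \<beta> cos_le_cos_outside[of \<beta> "t - \<tau>"] by (simp add: a2_def b2_def)
    then have "2 * \<rho>2 * d * (cos (t - \<tau>) - l) \<le> 0" using \<rho> d0 by (simp add: mult_le_0_iff)
    then have "(cmod (z - c1))^2 \<le> \<rho>1^2" unfolding t(2) dist1 by simp
    then have "cmod (z - c1) \<le> \<rho>1" by (rule power2_le_imp_le) (use \<rho> in simp)
    then show "z \<in> crescent c1 \<rho>1 c2 \<rho>2" using t \<rho> by (simp add: crescent_def norm_mult)
  qed
  have comp: "arc_points c1 \<rho>1 (\<tau> - \<alpha>) a1 \<subseteq> cball c2 \<rho>2"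
  proof
    fix z assume "z \<in> arc_points c1 \<rho>1 (\<tau> - \<alpha>) a1"
    then obtain t where t: "t \<in> {\<tau> - \<alpha>..a1}" "z = c1 + of_real \<rho>1 * cis t" by (auto simp: arc_points_def)
    have "cos \<alpha> \<le> cos \<bar>t - \<tau>\<bar>"
      using t \<alpha> by (intro cos_monotone_0_pi_le) (auto simp: a1_def)
    then have "2 * \<rho>1 * d * (k - cos (t - \<tau>)) \<le> 0" using \<alpha> \<rho> d0 by (simp add: mult_le_0_iff)
    then have "(cmod (z - c2))^2 \<le> \<rho>2^2" unfolding t(2) dist2 by simp
    then have "cmod (z - c2) \<le> \<rho>2" by (rule power2_le_imp_le) (use \<rho> in simp)
    then show "z \<in> cball c2 \<rho>2" by (simp add: dist_norm norm_minus_commute)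
  qed
  define p1 where "p1 = part_circlepath c1 \<rho>1 a1 b1"
  define p2 where "p2 = part_circlepath c2 \<rho>2 a2 b2"
  define p0 where "p0 = part_circlepath c1 \<rho>1 (\<tau> - \<alpha>) a1"
  have cise: "exp (\<i> * of_real t) = cis t" for t by (simp add: cis_conv_exp)
  have per: "cis (\<tau> + 2 * pi - s) = cis (\<tau> - s)" for s
    using cis_add_2pi[of "\<tau> - s"] by (simp add: algebra_simps)
  have ends: "pathstart p1 = pathstart p2" "pathfinish p1 = pathfinish p2"
      "pathstart p0 = pathfinish p1" "pathfinish p0 = pathstart p1"
    using meet[of \<alpha> \<beta>] meet[of "- \<alpha>" "- \<beta>"]
    by (simp_all add: p1_def p2_def p0_def cise per a1_def a2_def b1_def b2_def
        del: of_real_add of_real_diff)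
  have im: "path_image p1 = arc_points c1 \<rho>1 a1 b1" "path_image p2 = arc_points c2 \<rho>2 a2 b2"
      "path_image p0 = arc_points c1 \<rho>1 (\<tau> - \<alpha>) a1"
    using ab \<alpha> by (simp_all add: p1_def p2_def p0_def path_image_arc a1_def)
  have valid: "valid_path p1" "valid_path p2" "valid_path p0"
    by (simp_all add: p1_def p2_def p0_def)
  define \<gamma> where "\<gamma> = p1 +++ reversepath p2"
  have \<gamma>: "valid_path \<gamma>" "pathfinish \<gamma> = pathstart \<gamma>" "path_image \<gamma> \<subseteq> crescent c1 \<rho>1 c2 \<rho>2"
    using valid ends im arc1 arc2
    by (auto simp: \<gamma>_def valid_path_join valid_path_imp_reverse path_image_join)
  have integrable: "h contour_integrable_on part_circlepath c \<rho> a b"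
    if "h analytic_on S" "path_image (part_circlepath c \<rho> a b) \<subseteq> S" for h c \<rho> a b S
    using that by (intro contour_integrable_continuous_part_circlepath)
      (meson analytic_imp_holomorphic continuous_on_subset holomorphic_on_imp_continuous_on)
  have wind: "winding_number \<gamma> w = 0" if w: "w \<notin> crescent c1 \<rho>1 c2 \<rho>2" for w
  proof -
    have path: "path \<gamma>" using \<gamma> valid_path_imp_path by blast
    have sub: "path_image \<gamma> \<subseteq> cball c1 \<rho>1"
      using \<gamma>(3) by (auto simp: crescent_def dist_norm norm_minus_commute)
    have out: "winding_number \<gamma> v = 0" if "cmod (v - c1) > \<rho>1" for v
      by (rule winding_number_zero_outside[OF path convex_cball[of c1 \<rho>1] \<gamma>(2) _ sub])
        (use that in \<open>auto simp: dist_norm norm_minus_commute\<close>)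
    show ?thesis
    proof (cases "cmod (w - c1) > \<rho>1")
      case False
      then have wc: "w \<in> ball c2 \<rho>2" using w by (auto simp: crescent_def dist_norm norm_minus_commute)
      \<comment> \<open>The disc about \<open>c2\<close> misses the path and reaches beyond the circle about \<open>c1\<close>.\<close>
      define s where "s = (max 0 (\<rho>1 - d) + \<rho>2) / 2"
      have s: "0 \<le> s" "s < \<rho>2" "\<rho>1 < d + s" using dd \<rho> by (auto simp: s_def max_def field_simps)
      define v where "v = c2 + of_real s * cis \<tau>"
      have "v - c1 = of_real (d + s) * cis \<tau>" by (simp add: v_def c2 algebra_simps)
      then have v1: "cmod (v - c1) > \<rho>1" using s d0 by (simp add: norm_mult del: of_real_add)
      have v2: "v \<in> ball c2 \<rho>2" using s by (simp add: v_def dist_norm norm_mult)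
      have "ball c2 \<rho>2 \<inter> path_image \<gamma> = {}"
        using \<gamma>(3) by (fastforce simp: crescent_def dist_norm norm_minus_commute)
      then have "winding_number \<gamma> w = winding_number \<gamma> v"
        by (intro winding_number_eq[OF path \<gamma>(2) wc v2 connected_ball])
      then show ?thesis using out[OF v1] by simp
    qed (use out in auto)
  qed
  let ?I = "crescent_mean c1 \<rho>1 a1 b1 c2 \<rho>2 a2 b2"
    and ?Y = "{z. \<rho>1 \<le> cmod (z - c1) \<or> cmod (z - c2) \<le> \<rho>2}"
  have "crescent_contour c1 \<rho>1 a1 b1 c2 \<rho>2 a2 b2"
  proof
    show "?I h = 0" if h: "h analytic_on crescent c1 \<rho>1 c2 \<rho>2" for h
    proof -
      obtain U where U: "open U" "crescent c1 \<rho>1 c2 \<rho>2 \<subseteq> U" "h holomorphic_on U"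
        using h by (auto simp: analytic_on_holomorphic)
      have "(h has_contour_integral 0) \<gamma>"
        by (rule Cauchy_theorem_global[OF U(1,3) \<gamma>(1,2)]) (use U \<gamma>(3) wind in auto)
      moreover have "contour_integral \<gamma> h = contour_integral p1 h + contour_integral (reversepath p2) h"
        unfolding \<gamma>_def using valid ends integrable[OF h] im arc1 arc2
        by (intro contour_integral_join contour_integrable_reversepath)
          (auto simp: valid_path_imp_reverse p1_def p2_def)
      moreover have "contour_integral (reversepath p2) h = - contour_integral p2 h"
        using valid by (rule_tac contour_integral_reversepath)
      ultimately have "contour_integral p1 h - contour_integral p2 h = 0"
        using contour_integral_unique by fastforce
      then show ?thesis
        by (simp add: p1_def p2_def arc_mean_contour_integral ab crescent_mean_def)
    qed
    have "?I h =
        arc_mean c1 \<rho>1 (\<tau> - \<alpha>) (\<tau> - \<alpha> + 2 * pi) (\<lambda>z. h z * (z - c1))"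
      if h: "h analytic_on ?Y" for h
    proof -
      have hb: "h analytic_on cball c2 \<rho>2"
        using h by (rule analytic_on_subset) (auto simp: dist_norm norm_minus_commute)
      have p2b: "path_image p2 \<subseteq> cball c2 \<rho>2"
        unfolding im using \<rho> by (auto simp: dist_norm norm_minus_commute arc_points_norm)
      have "(h has_contour_integral 0) (p0 +++ p2)"
        using hb p2b comp im valid ends
        by (intro Cauchy_theorem_convex_simple[OF analytic_imp_holomorphic[OF hb] convex_cball])
          (auto simp: path_image_join valid_path_join)
      moreover have "contour_integral (p0 +++ p2) h = contour_integral p0 h + contour_integral p2 h"
        using valid ends integrable[OF hb] im comp p2b
        by (intro contour_integral_join) (auto simp: p0_def p2_def)
      ultimately have "contour_integral p0 h + contour_integral p2 h = 0"
        using contour_integral_unique by fastforce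
      then have sum0: "arc_mean c1 \<rho>1 (\<tau> - \<alpha>) a1 (\<lambda>z. h z * (z - c1)) +
          arc_mean c2 \<rho>2 a2 b2 (\<lambda>z. h z * (z - c2)) = 0"
        using \<alpha> by (simp add: p0_def p2_def arc_mean_contour_integral ab a1_def flip: distrib_left)
      have b1: "b1 = \<tau> - \<alpha> + 2 * pi" by (simp add: b1_def)
      have "continuous_on (arc_points c1 \<rho>1 (\<tau> - \<alpha>) b1) (\<lambda>z. h z * (z - c1))"
        by (intro continuous_intros holomorphic_on_imp_continuous_on analytic_imp_holomorphic
              analytic_on_subset[OF h]) (use \<rho> in \<open>auto simp: arc_points_norm\<close>)
      then have "arc_mean c1 \<rho>1 (\<tau> - \<alpha>) a1 (\<lambda>z. h z * (z - c1)) + arc_mean c1 \<rho>1 a1 b1 (\<lambda>z. h z * (z - c1))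
          = arc_mean c1 \<rho>1 (\<tau> - \<alpha>) b1 (\<lambda>z. h z * (z - c1))"
        using \<alpha> ab by (intro arc_mean_combine) (auto simp: a1_def)
      with sum0 show ?thesis unfolding crescent_mean_def b1 by (simp add: algebra_simps add_eq_0_iff)
    qed
    then show "\<exists>a. \<forall>h. h analytic_on ?Y \<longrightarrow>
        ?I h =
        circle_mean c1 \<rho>1 a (\<lambda>z. h z * (z - c1))" by blast
  qed (use \<rho> \<alpha> \<beta> arc1 arc2 in \<open>auto simp: a1_def b1_def a2_def b2_def\<close>)
  then show ?thesis by blast
qed

lemma crescent_contour_exists:
  assumes "\<rho>1 > 0" "\<rho>2 > 0" "\<rho>2 < cmod (c1 - c2) + \<rho>1"
  shows "\<exists>a1 b1 a2 b2. crescent_contour c1 \<rho>1 a1 b1 c2 \<rho>2 a2 b2"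
proof -
  consider "cmod (c1 - c2) + \<rho>2 \<le> \<rho>1" | "\<rho>1 + \<rho>2 \<le> cmod (c1 - c2)"
    | "\<rho>1 < cmod (c1 - c2) + \<rho>2" "cmod (c1 - c2) < \<rho>1 + \<rho>2" by linarith
  then show ?thesis
  proof cases
    case 1
    then show ?thesis using crescent_contour_ring assms by blast
  next
    case 2
    then show ?thesis using crescent_contour_disc assms by blast
  next
    case 3
    then show ?thesis using crescent_contour_crossing assms by blast
  qed
qed

section \<open>The resolvent form and the operator Poisson kernel\<close>

text \<open>
  The minus sign makes this the matrix element of \<open>(s - A)\<^sup>-\<^sup>1\<close>, the operator version of \<open>1 / (s - z)\<close>.
\<close>

definition res_form :: "('a::complex_inner \<Rightarrow> 'a) \<Rightarrow> 'a \<Rightarrow> 'a \<Rightarrow> complex \<Rightarrow> complex" where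
  "res_form A x y s = - cinner (resolvent A s x) y"

lemma res_form_mult: "z \<noteq> s \<Longrightarrow> res_form (\<lambda>w :: complex. z * w) 1 1 s = 1 / (s - z)"
  by (simp add: res_form_def resolvent_mult cinner_complex_def minus_divide_right)

locale crescent_operator =
  fixes A :: "'a :: complex_hilbert_space \<Rightarrow> 'a" and c1 :: complex and R :: real and c2 :: complex and r :: real
  assumes op: "crescent_op c1 R c2 r A" and R: "R \<ge> 0"
begin

abbreviation ex :: "complex \<Rightarrow> real" where "ex \<equiv> excess c1 R c2 r"

lemma lin: "bounded_clinear A"
  using op by (simp add: crescent_op_def)

lemma resolvent_facts:
  assumes "ex s > 0"
  shows "bounded_clinear (resolvent A s)" "resolvent A s (A x - s *\<^sub>C x) = x"
    "A (resolvent A s x) - s *\<^sub>C resolvent A s x = x"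
    "norm (resolvent A s x) \<le> norm x / ex s"
proof -
  note inv = crescent_op_resolvent(1)[OF op R assms]
  note f = op_invertible_inv[OF inv]
  show "bounded_clinear (resolvent A s)" "resolvent A s (A x - s *\<^sub>C x) = x"
    and eq: "A (resolvent A s x) - s *\<^sub>C resolvent A s x = x"
    unfolding resolvent_def by (rule f)+
  show "norm (resolvent A s x) \<le> norm x / ex s"
    using crescent_op_resolvent(2)[OF op R assms, of "resolvent A s x"] assms
    by (simp add: eq field_simps)
qed

lemma resolvent_identity:
  assumes "ex s > 0" "ex t > 0"
  shows "resolvent A s x - resolvent A t x = (s - t) *\<^sub>C resolvent A s (resolvent A t x)"
proof -
  define w where "w = resolvent A t x"
  note l = bounded_clinearD[OF resolvent_facts(1)[OF assms(1)]]
  have "x = (A w - s *\<^sub>C w) + (s - t) *\<^sub>C w"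
    using resolvent_facts(3)[OF assms(2), of x] by (simp add: w_def scaleC_diff_left)
  then have "resolvent A s x = w + (s - t) *\<^sub>C resolvent A s w"
    using resolvent_facts(2)[OF assms(1), of w] by (metis l(1,5))
  then show ?thesis by (simp add: w_def)
qed

lemma norm_res_form:
  assumes "ex s > 0"
  shows "cmod (res_form A x y s) \<le> norm x * norm y / ex s"
proof -
  have "cmod (res_form A x y s) \<le> norm (resolvent A s x) * norm y"
    by (simp add: res_form_def norm_cinner_le)
  also have "\<dots> \<le> norm x / ex s * norm y"
    by (intro mult_right_mono resolvent_facts assms) auto
  finally show ?thesis by simp
qed

lemma res_form_linear:
  assumes "ex s > 0"
  shows "res_form A (x + x') y s = res_form A x y s + res_form A x' y s"
    "res_form A (c *\<^sub>C x) y s = c * res_form A x y s"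
  using bounded_clinearD[OF resolvent_facts(1)[OF assms]]
  by (simp_all add: res_form_def cinner_simps)

lemma res_form_diff:
  assumes "ex s > 0" "ex t > 0"
  shows "res_form A x y s - res_form A x y t =
    (s - t) * res_form A (resolvent A t x) y s"
  using arg_cong[OF resolvent_identity[OF assms, of x], of "\<lambda>u. - cinner u y"]
  by (simp add: res_form_def cinner_simps)

lemma res_form_Lipschitz:
  assumes "ex s > 0" "ex t > 0"
  shows "cmod (res_form A x y s - res_form A x y t) \<le>
    cmod (s - t) * (norm x * norm y / (ex s * ex t))"
proof -
  have "cmod (res_form A (resolvent A t x) y s) \<le> norm (resolvent A t x) * norm y / ex s"
    by (rule norm_res_form[OF assms(1)])
  also have "\<dots> \<le> (norm x / ex t) * norm y / ex s"
    using assms by (intro divide_right_mono mult_right_mono resolvent_facts) auto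
  finally show ?thesis
    unfolding res_form_diff[OF assms] norm_mult by (intro mult_left_mono) (auto simp: mult.commute)
qed

lemma continuous_res_form: "continuous_on {s. ex s > 0} (res_form A x y)"
  unfolding continuous_on_def
proof
  fix t assume "t \<in> {s. ex s > 0}"
  then have t: "ex t > 0" by simp
  have lim: "((\<lambda>s. cmod (s - t) * (norm x * norm y / (ex s * ex t))) \<longlongrightarrow>
      cmod (t - t) * (norm x * norm y / (ex t * ex t))) (at t within {s. ex s > 0})"
    using continuous_on_excess[of UNIV c1 R c2 r] t
    by (intro tendsto_intros) (auto simp: continuous_on_def intro: tendsto_within_subset)
  have "((\<lambda>s. res_form A x y s - res_form A x y t) \<longlongrightarrow> 0) (at t within {s. ex s > 0})"
    by (rule Lim_null_comparison[OF _ lim[simplified]])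
      (use res_form_Lipschitz t in \<open>auto simp: eventually_at_filter\<close>)
  then show "(res_form A x y \<longlongrightarrow> res_form A x y t) (at t within {s. ex s > 0})"
    by (rule LIM_zero_cancel)
qed

lemma open_excess: "open {s. ex s > 0}"
  using open_Collect_less[OF continuous_on_const continuous_on_excess, of 0 c1 R c2 r] by simp

lemma holomorphic_res_form: "res_form A x y holomorphic_on {s. ex s > 0}"
  unfolding holomorphic_on_open[OF open_excess]
proof
  fix t assume t: "t \<in> {s. ex s > 0}"
  let ?w = "resolvent A t x"
  have "(res_form A ?w y \<longlongrightarrow> res_form A ?w y t) (at t)"
    using continuous_res_form[of ?w y] t open_excess
    by (simp add: continuous_on_eq_continuous_at isCont_def)
  moreover have "\<forall>\<^sub>F s in at t. res_form A ?w y s =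
      (res_form A x y s - res_form A x y t) / (s - t)"
  proof -
    have "\<forall>\<^sub>F s in at t. s \<in> {s. ex s > 0}"
      using t open_excess by (intro eventually_at_in_open') auto
    moreover have "\<forall>\<^sub>F s in at t. s \<noteq> t" by (simp add: eventually_at_filter)
    ultimately show ?thesis
      by eventually_elim (use t in \<open>simp add: res_form_diff\<close>)
  qed
  ultimately have "((\<lambda>s. (res_form A x y s - res_form A x y t) / (s - t)) \<longlongrightarrow>
      res_form A ?w y t) (at t)"
    by (rule Lim_transform_eventually)
  then show "\<exists>f'. (res_form A x y has_field_derivative f') (at t)"
    unfolding has_field_derivative_iff by blast
qed

lemma analytic_res_form:
  "S \<subseteq> {s. ex s > 0} \<Longrightarrow> res_form A x y analytic_on S"
  using holomorphic_res_form open_excess analytic_on_holomorphic by blast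

text \<open>
  The mean does not depend on the radius, and for large radii \<open>(s - c1) (s - A)\<^sup>-\<^sup>1\<close> tends to the identity.
\<close>

lemma outer_circle_mean_res_form:
  assumes \<rho>: "\<rho> > R"
  shows "circle_mean c1 \<rho> a (\<lambda>s. res_form A x y s * (s - c1)) = cinner x y"
    (is "?M \<rho> = _")
proof -
  define C where "C = R * norm x * norm y"
  have C: "C \<ge> 0" using R by (simp add: C_def)
  have near: "cmod (?M \<rho> - cinner x y) \<le> C / (\<rho>' - R)" if \<rho>': "\<rho>' \<ge> \<rho>" for \<rho>'
  proof -
    have pos: "ex s \<ge> \<rho>' - R" if "s \<in> circle_points c1 \<rho>' a" for s
      using that \<rho>' \<rho> R by (simp add: excess_def arc_points_norm)
    have pos': "ex s > 0" if "s \<in> circle_points c1 \<rho>' a" for s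
      using pos[OF that] \<rho>' \<rho> by simp
    have cont: "continuous_on (circle_points c1 \<rho>' a) (\<lambda>s. res_form A x y s * (s - c1))"
      by (intro continuous_intros continuous_on_subset[OF continuous_res_form]) (use pos' in auto)
    have "?M \<rho>' = ?M \<rho>"
    proof (rule eccentric_circles_arc_mean)
      show "res_form A x y analytic_on crescent c1 \<rho>' c1 \<rho>"
        using \<rho> by (intro analytic_res_form) (auto simp: crescent_def excess_def)
    qed (use \<rho> \<rho>' R in auto)
    then have "?M \<rho> - cinner x y =
        circle_mean c1 \<rho>' a (\<lambda>s. res_form A x y s * (s - c1) - cinner x y)"
      by (subst arc_mean_diff[OF cont continuous_on_const]) (simp add: arc_mean_const_full)
    also have "cmod \<dots> \<le> C / (\<rho>' - R)"
    proof (rule norm_arc_mean_le)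
      show "cmod (res_form A x y s * (s - c1) - cinner x y) \<le> C / (\<rho>' - R)"
        if s: "s \<in> circle_points c1 \<rho>' a" for s
      proof -
        define u where "u = - resolvent A s x"
        have "x = (s - c1) *\<^sub>C u - (A u - c1 *\<^sub>C u)"
          using resolvent_facts(3)[OF pos'[OF s], of x] bounded_clinearD[OF lin]
          by (simp add: u_def scaleC_diff_left scaleC_minus_right)
        then have "cinner x y = (s - c1) * cinner u y - cinner (A u - c1 *\<^sub>C u) y"
          by (metis cinner_diff_left cinner_scaleC_left)
        then have "cmod (res_form A x y s * (s - c1) - cinner x y) = cmod (cinner (A u - c1 *\<^sub>C u) y)"
          by (simp add: res_form_def u_def cinner_minus_left)
        also have "\<dots> \<le> R * norm u * norm y"
          using op by (intro order_trans[OF norm_cinner_le] mult_right_mono) (auto simp: crescent_op_def)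
        also have "\<dots> \<le> R * (norm x / (\<rho>' - R)) * norm y"
        proof -
          have "norm u \<le> norm x / ex s" using resolvent_facts(4)[OF pos'[OF s]] by (simp add: u_def)
          also have "\<dots> \<le> norm x / (\<rho>' - R)"
            using pos[OF s] \<rho> \<rho>' by (intro divide_left_mono mult_pos_pos) auto
          finally show ?thesis using R by (intro mult_right_mono mult_left_mono) auto
        qed
        finally show ?thesis by (simp add: C_def)
      qed
    qed (use cont C \<rho> \<rho>' in \<open>auto intro!: continuous_intros\<close>)
    finally show ?thesis .
  qed
  have "cmod (?M \<rho> - cinner x y) \<le> 0"
  proof (rule field_le_epsilon)
    fix e :: real assume e: "e > 0"
    have "cmod (?M \<rho> - cinner x y) \<le> C / (\<rho> + C / e - R)" using C e by (intro near) auto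
    also have "\<dots> \<le> e"
    proof -
      have "C = (C / e) * e" using e by simp
      also have "\<dots> \<le> (\<rho> + C / e - R) * e" using \<rho> e by (intro mult_right_mono) auto
      finally have "C \<le> e * (\<rho> + C / e - R)" by (simp only: mult.commute)
      moreover have "C / e \<ge> 0" using C e by simp
      then have "\<rho> + C / e - R > 0" using \<rho> by linarith
      ultimately show ?thesis by (simp only: pos_divide_le_eq)
    qed
    finally show "cmod (?M \<rho> - cinner x y) \<le> 0 + e" by simp
  qed
  then show ?thesis by simp
qed

lemma inner_circle_mean_res_form:
  assumes "0 < \<rho>" "\<rho> < r"
  shows "circle_mean c2 \<rho> a (\<lambda>s. res_form A x y s * (s - c2)) = 0"
  by (rule circle_mean_eq_0)
    (use assms in \<open>auto intro!: analytic_res_form simp: excess_def dist_norm norm_minus_commute\<close>)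

text \<open>
  For a number \<open>z\<close> in place of \<open>A\<close> this is \<open>2 Re ((s - c) / (s - z)) - 1\<close>, the Poisson kernel of the disc
  about \<open>c\<close> whose boundary contains \<open>s\<close>.
\<close>

definition poisson :: "complex \<Rightarrow> 'a \<Rightarrow> 'a \<Rightarrow> complex \<Rightarrow> complex" where
  "poisson c x y s = res_form A x y s * (s - c) + cnj (res_form A y x s * (s - c)) - cinner x y"

text \<open>
  The counterpart of the numerator \<open>\<rho>\<^sup>2 - \<bar>z - c\<bar>\<^sup>2\<close> of the Poisson kernel. It is positive if \<open>A - c\<close> is
  bounded by the radius and negative if \<open>A - c\<close> is bounded below by it.
\<close>

lemma poisson_eq:
  assumes "ex s > 0"
  defines "u \<equiv> \<lambda>x. - resolvent A s x"
  shows "poisson c x y s = of_real ((cmod (s - c))^2) * cinner (u x) (u y)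
      - cinner (A (u x) - c *\<^sub>C u x) (A (u y) - c *\<^sub>C u y)"
proof -
  define d where "d = s - c"
  define B where "B = (\<lambda>v. A v - c *\<^sub>C v)"
  have x: "x = d *\<^sub>C u x - B (u x)" for x
    using resolvent_facts(3)[OF assms(1), of x] bounded_clinearD[OF lin]
    by (simp add: u_def d_def B_def scaleC_diff_left scaleC_minus_right)
  have r: "res_form A x y s = cinner (u x) y" for x y
    by (simp add: res_form_def u_def cinner_minus_left)
  have 1: "cinner (u x) y = cnj d * cinner (u x) (u y) - cinner (u x) (B (u y))"
    by (subst x[of y]) (simp add: cinner_simps)
  have "cnj (cinner (u y) x) = cinner x (u y)" by (rule cinner_commute[symmetric])
  also have "\<dots> = d * cinner (u x) (u y) - cinner (B (u x)) (u y)"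
    by (subst x[of x]) (simp add: cinner_simps)
  finally have 2: "cnj (cinner (u y) x) = d * cinner (u x) (u y) - cinner (B (u x)) (u y)" .
  have 3: "cinner x y = d * cnj d * cinner (u x) (u y) - d * cinner (u x) (B (u y))
      - cnj d * cinner (B (u x)) (u y) + cinner (B (u x)) (B (u y))"
    by (subst x[of x], subst x[of y]) (simp add: cinner_simps algebra_simps)
  have "poisson c x y s = cinner (u x) y * d + cnj (cinner (u y) x) * cnj d - cinner x y"
    by (simp add: poisson_def r d_def)
  also have "\<dots> = d * cnj d * cinner (u x) (u y) - cinner (B (u x)) (B (u y))"
    unfolding 1 2 3 by (simp add: algebra_simps)
  finally show ?thesis by (simp only: B_def d_def complex_norm_square)
qed

lemma poisson_hermitian_form:
  assumes "ex s > 0"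
  shows "poisson c (x + x') y s = poisson c x y s + poisson c x' y s"
    and "poisson c (k *\<^sub>C x) y s = k * poisson c x y s"
    and "poisson c x y s = cnj (poisson c y x s)"
    and "Re (poisson c x x s) = (cmod (s - c))^2 * (norm (resolvent A s x))^2
      - (norm (A (resolvent A s x) - c *\<^sub>C resolvent A s x))^2"
proof -
  note l = bounded_clinearD[OF lin] bounded_clinearD[OF resolvent_facts(1)[OF assms]]
  show "poisson c (x + x') y s = poisson c x y s + poisson c x' y s"
    unfolding poisson_eq[OF assms] by (simp add: l cinner_simps scaleC_add_right algebra_simps)
  show "poisson c (k *\<^sub>C x) y s = k * poisson c x y s"
    unfolding poisson_eq[OF assms]
    by (simp add: l cinner_simps scaleC_scaleC mult.commute[of c k] scaleC_diff_right[symmetric]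
        flip: scaleC_scaleC) (simp add: algebra_simps scaleC_scaleC cinner_simps)
  show "poisson c x y s = cnj (poisson c y x s)"
    unfolding poisson_eq[OF assms] by (simp flip: cinner_commute)
  have "- A u + c *\<^sub>C u = - (A u - c *\<^sub>C u)" for u by simp
  then show "Re (poisson c x x s) = (cmod (s - c))^2 * (norm (resolvent A s x))^2
      - (norm (A (resolvent A s x) - c *\<^sub>C resolvent A s x))^2"
    unfolding poisson_eq[OF assms]
    by (simp add: l scaleC_minus_right cinner_self norm_minus_commute flip: of_real_power of_real_mult)
qed

text \<open>
  A positive kernel of total mass one, integrated against \<open>f\<close> over any part of the circle, gives a
  form of norm at most one. The sign \<open>k\<close> covers the exterior of a disc.
\<close>

lemma arc_mean_poisson_le:
  fixes f :: "complex \<Rightarrow> complex" and k :: real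
  assumes b: "b \<le> a + 2 * pi"
    and pos: "\<And>s. s \<in> circle_points c \<rho> a \<Longrightarrow> ex s > 0"
    and psd: "\<And>s x. s \<in> circle_points c \<rho> a \<Longrightarrow> 0 \<le> k * Re (poisson c x x s)"
    and total: "\<And>x. circle_mean c \<rho> a (\<lambda>s. k * poisson c x x s) = of_real ((norm x)^2)"
    and f: "continuous_on (arc_points c \<rho> a b) f"
      "\<And>s. s \<in> arc_points c \<rho> a b \<Longrightarrow> cmod (f s) \<le> 1"
  shows "cmod (arc_mean c \<rho> a b (\<lambda>s. f s * (k * poisson c x y s))) \<le> norm x * norm y"
proof (rule le_mult_if_le_amgm)
  fix t :: real assume t: "t > 0"
  have sub: "arc_points c \<rho> a b \<subseteq> circle_points c \<rho> a" using b by (intro arc_points_mono) auto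
  have cont: "continuous_on (circle_points c \<rho> a) (poisson c x y)" for x y
    unfolding poisson_def[abs_def]
    by (intro continuous_intros continuous_on_subset[OF continuous_res_form]) (use pos in auto)
  note cont' = continuous_on_subset[OF cont sub]
  define g where "g = (\<lambda>s. of_real (t / 2) * (of_real k * poisson c x x s)
    + of_real (1 / (2 * t)) * (of_real k * poisson c y y s))"
  have Reg: "Re (g s) = (t * (k * Re (poisson c x x s)) + k * Re (poisson c y y s) / t) / 2" for s
    using t unfolding g_def plus_complex.simps by (simp only: Re_complex_of_real Im_complex_of_real times_complex.simps)
      (simp add: field_simps)
  have contg: "continuous_on (circle_points c \<rho> a) g"
    unfolding g_def by (intro continuous_intros cont)
  have "cmod (arc_mean c \<rho> a b (\<lambda>s. f s * (k * poisson c x y s))) \<le> Re (arc_mean c \<rho> a b g)"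
  proof (rule norm_arc_mean_le_Re)
    fix s assume k: "s \<in> arc_points c \<rho> a b"
    then have k': "s \<in> circle_points c \<rho> a" using sub by blast
    note P = poisson_hermitian_form[OF pos[OF k']]
    have "cmod (f s * (k * poisson c x y s)) \<le> 1 * cmod (k * poisson c x y s)"
      unfolding norm_mult by (intro mult_right_mono f k) auto
    also have "\<dots> \<le> (t * Re (k * poisson c x x s) + Re (k * poisson c y y s) / t) / 2"
      unfolding mult_1
    proof (rule hermitian_form_amgm[where B = "\<lambda>x y. k * poisson c x y s", OF _ _ _ _ t])
      show "of_real k * poisson c x y s = cnj (of_real k * poisson c y x s)" for x y
        using P(3)[of c x y] by simp
    qed (use psd[OF k'] in \<open>auto simp: P(1,2) algebra_simps\<close>)
    also have "\<dots> = Re (g s)" by (simp add: Reg)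
    finally show "cmod (f s * (k * poisson c x y s)) \<le> Re (g s)" .
  qed (intro continuous_intros f cont' continuous_on_subset[OF contg sub])+
  also have "\<dots> \<le> Re (circle_mean c \<rho> a g)"
    by (rule Re_arc_mean_mono_set[OF contg b]) (use psd t in \<open>auto simp: Reg intro!: add_nonneg_nonneg\<close>)
  also have "circle_mean c \<rho> a g =
      of_real (t / 2) * of_real ((norm x)^2) + of_real (1 / (2 * t)) * of_real ((norm y)^2)"
  proof -
    have "of_real k * circle_mean c \<rho> a (poisson c x x) = of_real ((norm x)^2)" for x
      using total[of x] by (simp only: arc_mean_mult)
    moreover have "circle_mean c \<rho> a g =
        of_real (t / 2) * (of_real k * circle_mean c \<rho> a (poisson c x x))
        + of_real (1 / (2 * t)) * (of_real k * circle_mean c \<rho> a (poisson c y y))"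
      unfolding g_def by (subst arc_mean_add) (intro continuous_intros cont | simp only: arc_mean_mult)+
    ultimately show ?thesis by (simp only:)
  qed
  also have "Re \<dots> = (t * (norm x)^2 + (norm y)^2 / t) / 2"
    using t by (simp add: field_simps flip: of_real_mult of_real_add of_real_power)
  finally show "cmod (arc_mean c \<rho> a b (\<lambda>s. f s * (k * poisson c x y s))) \<le>
    (t * (norm x)^2 + (norm y)^2 / t) / 2" .
qed auto

lemma mean_poisson:
  assumes f: "continuous_on (arc_points c \<rho> a b) f"
    and pos: "\<And>s. s \<in> arc_points c \<rho> a b \<Longrightarrow> ex s > 0"
  shows "arc_mean c \<rho> a b (\<lambda>s. f s * poisson c x y s) =
    arc_mean c \<rho> a b (\<lambda>s. f s * res_form A x y s * (s - c))
    + cnj (arc_mean c \<rho> a b (\<lambda>s. cnj (f s) * res_form A y x s * (s - c)))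
    - arc_mean c \<rho> a b f * cinner x y"
proof -
  have rc: "continuous_on (arc_points c \<rho> a b) (res_form A x y)" for x y
    by (rule continuous_on_subset[OF continuous_res_form]) (use pos in blast)
  have eq: "(\<lambda>s. f s * poisson c x y s) = (\<lambda>s. f s * res_form A x y s * (s - c)
      + cnj (cnj (f s) * res_form A y x s * (s - c)) - cinner x y * f s)"
    by (simp add: poisson_def fun_eq_iff algebra_simps)
  have 1: "continuous_on (arc_points c \<rho> a b) (\<lambda>s. f s * res_form A x y s * (s - c))"
    and 2: "continuous_on (arc_points c \<rho> a b) (\<lambda>s. cnj (cnj (f s) * res_form A y x s * (s - c)))"
    and 3: "continuous_on (arc_points c \<rho> a b) (\<lambda>s. cinner x y * f s)"
    by (intro continuous_intros f rc)+
  show ?thesis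
    unfolding eq arc_mean_diff[OF continuous_on_add[OF 1 2] 3] arc_mean_add[OF 1 2] arc_mean_cnj arc_mean_mult
    by (simp only: mult.commute)
qed

lemma outer_arc_poisson_le:
  assumes "\<rho> > R" "b \<le> a + 2 * pi" "continuous_on (arc_points c1 \<rho> a b) f"
    and "\<And>s. s \<in> arc_points c1 \<rho> a b \<Longrightarrow> cmod (f s) \<le> 1"
  shows "cmod (arc_mean c1 \<rho> a b (\<lambda>s. f s * poisson c1 x y s)) \<le> norm x * norm y"
proof -
  have n: "cmod (s - c1) = \<rho>" if "s \<in> circle_points c1 \<rho> a" for s
    using that assms(1) R by (simp add: arc_points_norm)
  have pos: "ex s > 0" if "s \<in> circle_points c1 \<rho> a" for s
    using n[OF that] assms(1) by (simp add: excess_def)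
  have "cmod (arc_mean c1 \<rho> a b (\<lambda>s. f s * (of_real 1 * poisson c1 x y s))) \<le> norm x * norm y"
  proof (rule arc_mean_poisson_le)
    show "0 \<le> 1 * Re (poisson c1 x x s)" if s: "s \<in> circle_points c1 \<rho> a" for s x
    proof -
      let ?u = "resolvent A s x"
      have "norm (A ?u - c1 *\<^sub>C ?u) \<le> R * norm ?u" using op by (simp add: crescent_op_def)
      also have "\<dots> \<le> \<rho> * norm ?u" using assms(1) by (intro mult_right_mono) auto
      finally have "(norm (A ?u - c1 *\<^sub>C ?u))^2 \<le> (\<rho> * norm ?u)^2" by (intro power_mono) auto
      then show ?thesis
        using poisson_hermitian_form(4)[OF pos[OF s], of c1 x] n[OF s] by (simp add: power_mult_distrib)
    qed
    show "circle_mean c1 \<rho> a (\<lambda>s. of_real 1 * poisson c1 x x s) = of_real ((norm x)^2)" for x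
      using mean_poisson[of c1 \<rho> a "a + 2 * pi" "\<lambda>_. 1" x x] pos
      by (simp add: outer_circle_mean_res_form[OF assms(1)] arc_mean_const_full cinner_self)
  qed (use assms pos in auto)
  then show ?thesis by simp
qed

lemma inner_arc_poisson_le:
  assumes "0 < \<rho>" "\<rho> < r" "b \<le> a + 2 * pi" "continuous_on (arc_points c2 \<rho> a b) f"
    and "\<And>s. s \<in> arc_points c2 \<rho> a b \<Longrightarrow> cmod (f s) \<le> 1"
  shows "cmod (arc_mean c2 \<rho> a b (\<lambda>s. f s * poisson c2 x y s)) \<le> norm x * norm y"
proof -
  have n: "cmod (s - c2) = \<rho>" if "s \<in> circle_points c2 \<rho> a" for s
    using that assms(1) by (simp add: arc_points_norm)
  have pos: "ex s > 0" if "s \<in> circle_points c2 \<rho> a" for s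
    using n[OF that] assms(2) by (simp add: excess_def)
  have "cmod (arc_mean c2 \<rho> a b (\<lambda>s. f s * (of_real (-1) * poisson c2 x y s))) \<le> norm x * norm y"
  proof (rule arc_mean_poisson_le)
    show "0 \<le> - 1 * Re (poisson c2 x x s)" if s: "s \<in> circle_points c2 \<rho> a" for s x
    proof -
      let ?u = "resolvent A s x"
      have "\<rho> * norm ?u \<le> r * norm ?u" using assms(2) by (intro mult_right_mono) auto
      also have "\<dots> \<le> norm (A ?u - c2 *\<^sub>C ?u)" using op by (simp add: crescent_op_def)
      finally have "(\<rho> * norm ?u)^2 \<le> (norm (A ?u - c2 *\<^sub>C ?u))^2" using assms(1) by (intro power_mono) auto
      then show ?thesis
        using poisson_hermitian_form(4)[OF pos[OF s], of c2 x] n[OF s] by (simp add: power_mult_distrib)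
    qed
    show "circle_mean c2 \<rho> a (\<lambda>s. of_real (- 1) * poisson c2 x x s) = of_real ((norm x)^2)" for x
      using mean_poisson[of c2 \<rho> a "a + 2 * pi" "\<lambda>_. 1" x x] pos
      by (simp add: inner_circle_mean_res_form[OF assms(1,2)] arc_mean_const_full cinner_self
          arc_mean_uminus)
  qed (use assms pos in auto)
  then show ?thesis by (simp add: arc_mean_uminus)
qed

end

section \<open>Cauchy's formula for the rational calculus\<close>

context crescent_contour
begin

abbreviation X :: "complex set" where "X \<equiv> crescent c1 \<rho>1 c2 \<rho>2"
abbreviation \<Gamma>1 :: "complex set" where "\<Gamma>1 \<equiv> arc_points c1 \<rho>1 a1 b1"
abbreviation \<Gamma>2 :: "complex set" where "\<Gamma>2 \<equiv> arc_points c2 \<rho>2 a2 b2"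
abbreviation \<Gamma> :: "complex set" where "\<Gamma> \<equiv> \<Gamma>1 \<union> \<Gamma>2"
abbreviation mean1 :: "(complex \<Rightarrow> complex) \<Rightarrow> complex" where "mean1 \<equiv> arc_mean c1 \<rho>1 a1 b1"
abbreviation mean2 :: "(complex \<Rightarrow> complex) \<Rightarrow> complex" where "mean2 \<equiv> arc_mean c2 \<rho>2 a2 b2"
abbreviation I :: "(complex \<Rightarrow> complex) \<Rightarrow> complex" where "I \<equiv> crescent_mean c1 \<rho>1 a1 b1 c2 \<rho>2 a2 b2"

lemma I_add:
  assumes "continuous_on \<Gamma> f" "continuous_on \<Gamma> g"
  shows "I (\<lambda>s. f s + g s) = I f + I g"
proof -
  have c: "continuous_on \<Gamma>1 f" "continuous_on \<Gamma>1 g" "continuous_on \<Gamma>2 f" "continuous_on \<Gamma>2 g"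
    using assms by (auto intro: continuous_on_subset)
  show ?thesis unfolding crescent_mean_def distrib_right
    by (subst arc_mean_add; (intro continuous_intros c)?)+ simp
qed

lemma I_mult: "I (\<lambda>s. k * f s) = k * I f"
  by (simp only: crescent_mean_def mult.assoc arc_mean_mult right_diff_distrib[of k "mean1 _"])

lemma I_cong: "(\<And>s. s \<in> \<Gamma> \<Longrightarrow> f s = g s) \<Longrightarrow> I f = I g"
  unfolding crescent_mean_def by (intro arg_cong2[where f = "(-)"] arc_mean_cong) auto

lemma analytic_continuous: "f analytic_on X \<Longrightarrow> continuous_on \<Gamma> f"
  using arcs analytic_imp_holomorphic holomorphic_on_imp_continuous_on continuous_on_subset
  by (metis Un_least)

end

locale crescent_calculus = crescent_contour c1 \<rho>1 a1 b1 c2 \<rho>2 a2 b2 + crescent_operator A c1 R c2 r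
  for A :: "'a :: complex_hilbert_space \<Rightarrow> 'a" and c1 \<rho>1 a1 b1 c2 \<rho>2 a2 b2 R r +
  assumes inside: "R < \<rho>1" "\<rho>2 < r"
begin

lemma excess_on_arcs: "s \<in> \<Gamma> \<Longrightarrow> min (\<rho>1 - R) (r - \<rho>2) \<le> ex s"
  using radii by (auto simp: excess_def arc_points_norm)

lemma excess_pos: "s \<in> \<Gamma> \<Longrightarrow> ex s > 0"
  using excess_on_arcs[of s] inside by simp

lemma res_form_continuous: "continuous_on \<Gamma> (res_form A x y)"
  by (rule continuous_on_subset[OF continuous_res_form]) (use excess_pos in blast)

lemma I_res_form: "I (res_form A x y) = cinner x y"
proof -
  have "res_form A x y analytic_on {z. \<rho>1 \<le> cmod (z - c1) \<or> cmod (z - c2) \<le> \<rho>2}"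
    by (rule analytic_res_form) (use inside in \<open>auto simp: excess_def\<close>)
  moreover obtain a where "\<And>h. h analytic_on {z. \<rho>1 \<le> cmod (z - c1) \<or> cmod (z - c2) \<le> \<rho>2} \<Longrightarrow>
      I h = circle_mean c1 \<rho>1 a (\<lambda>z. h z * (z - c1))"
    using exterior by blast
  ultimately show ?thesis by (simp only: outer_circle_mean_res_form[OF inside(1)])
qed

text \<open>
  Induction on the way \<open>f\<close> is built. For \<open>f = z\<close> and \<open>f = 1 / (z - a)\<close>, replacing \<open>f s\<close> by its value at
  \<open>A\<close> changes the integrand by a function of \<open>s\<close> that is analytic on the crescent and integrates to
  zero. The factor \<open>h\<close> is what carries the induction through products.
\<close>

lemma rat_calculus_shift:
  assumes "rat_calculus X A f F" "h analytic_on X"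
  shows "I (\<lambda>s. h s * f s * res_form A x y s) = I (\<lambda>s. h s * res_form A (F x) y s)"
  using assms
proof (induction arbitrary: h x y)
  case (const c)
  show ?case by (rule I_cong) (simp add: res_form_linear excess_pos)
next
  case (add f F g G)
  have c: "continuous_on \<Gamma> f" "continuous_on \<Gamma> g" "continuous_on \<Gamma> h"
    using add by (auto intro: analytic_continuous rat_calculus_analytic)
  have "I (\<lambda>s. h s * (f s + g s) * res_form A x y s) =
      I (\<lambda>s. h s * f s * res_form A x y s + h s * g s * res_form A x y s)"
    by (simp add: algebra_simps)
  also have "\<dots> = I (\<lambda>s. h s * res_form A (F x) y s) + I (\<lambda>s. h s * res_form A (G x) y s)"
    using add by (subst I_add) (auto intro!: continuous_intros c res_form_continuous)
  also have "\<dots> = I (\<lambda>s. h s * res_form A (F x) y s + h s * res_form A (G x) y s)"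
    by (subst I_add) (auto intro!: continuous_intros c res_form_continuous)
  also have "\<dots> = I (\<lambda>s. h s * res_form A (F x + G x) y s)"
    by (rule I_cong) (simp add: res_form_linear excess_pos distrib_left)
  finally show ?case .
next
  case (mult f F g G)
  have fa: "(\<lambda>s. h s * f s) analytic_on X"
    by (intro analytic_intros mult.prems rat_calculus_analytic[OF mult.hyps(1)])
  have "I (\<lambda>s. h s * (f s * g s) * res_form A x y s) =
      I (\<lambda>s. h s * f s * g s * res_form A x y s)" by (simp add: mult.assoc)
  also have "\<dots> = I (\<lambda>s. h s * f s * res_form A (G x) y s)" by (rule mult.IH(2)[OF fa])
  also have "\<dots> = I (\<lambda>s. h s * res_form A (F (G x)) y s)" by (rule mult.IH(1)[OF mult.prems])
  finally show ?case .
next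
  case ident
  have hc: "continuous_on \<Gamma> h" by (rule analytic_continuous[OF ident])
  have "h s * s * res_form A x y s = h s * res_form A (A x) y s + cinner x y * h s"
    if "s \<in> \<Gamma>" for s
  proof -
    have "res_form A (A x - s *\<^sub>C x) y s = - cinner x y"
      using resolvent_facts(2)[OF excess_pos[OF that]] by (simp add: res_form_def)
    then have "res_form A (A x) y s + (- s) * res_form A x y s = - cinner x y"
      using res_form_linear[OF excess_pos[OF that]] by (metis scaleC_minus_left diff_conv_add_uminus)
    then have "s * res_form A x y s = res_form A (A x) y s + cinner x y"
      by (simp add: algebra_simps)
    then have "h s * (s * res_form A x y s) = h s * (res_form A (A x) y s + cinner x y)"
      by simp
    then show ?thesis by (simp add: algebra_simps)
  qed
  then have "I (\<lambda>s. h s * s * res_form A x y s) =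
      I (\<lambda>s. h s * res_form A (A x) y s + cinner x y * h s)" by (rule I_cong)
  also have "\<dots> = I (\<lambda>s. h s * res_form A (A x) y s) + cinner x y * I h"
    by (subst I_add) (auto intro!: continuous_intros hc res_form_continuous simp: I_mult)
  finally show ?case using cauchy[OF ident] by simp
next
  case (pole a)
  have hc: "continuous_on \<Gamma> h" by (rule analytic_continuous[OF pole(2)])
  have ha: "(\<lambda>s. h s / (s - a)) analytic_on X"
    using pole by (auto intro!: analytic_intros)
  have hac: "continuous_on \<Gamma> (\<lambda>s. h s / (s - a))" by (rule analytic_continuous[OF ha])
  have a: "ex a > 0" using pole(1) inside by (auto simp: excess_def crescent_def)
  define w where "w = resolvent A a x"
  have "h s * (1 / (s - a)) * res_form A x y s =
      h s * res_form A w y s + (- cinner w y) * (h s / (s - a))"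
    if s: "s \<in> \<Gamma>" for s
  proof -
    have "s \<noteq> a" using s arcs pole(1) by auto
    have "x = (A w - s *\<^sub>C w) + (s - a) *\<^sub>C w"
      using resolvent_facts(3)[OF a, of x] by (simp add: w_def scaleC_diff_left)
    then have "res_form A x y s = res_form A (A w - s *\<^sub>C w) y s + (s - a) * res_form A w y s"
      using res_form_linear[OF excess_pos[OF s]] by metis
    also have "res_form A (A w - s *\<^sub>C w) y s = - cinner w y"
      using resolvent_facts(2)[OF excess_pos[OF s]] by (simp add: res_form_def)
    finally have eq: "res_form A x y s = - cinner w y + (s - a) * res_form A w y s" .
    show ?thesis unfolding eq using \<open>s \<noteq> a\<close> by (simp add: field_simps)
  qed
  then have "I (\<lambda>s. h s * (1 / (s - a)) * res_form A x y s) =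
      I (\<lambda>s. h s * res_form A w y s + (- cinner w y) * (h s / (s - a)))" by (rule I_cong)
  also have "\<dots> = I (\<lambda>s. h s * res_form A w y s) + (- cinner w y) * I (\<lambda>s. h s / (s - a))"
    by (subst I_add[OF continuous_on_mult[OF hc res_form_continuous]
          continuous_on_mult[OF continuous_on_const hac]]) (simp only: I_mult)
  finally show ?case using cauchy[OF ha] by (simp add: w_def)
qed

lemma Cauchy_formula:
  assumes "rat_calculus X A f F"
  shows "I (\<lambda>s. f s * res_form A x y s) = cinner (F x) y"
  using rat_calculus_shift[OF assms analytic_on_const[of 1], of x y]
  by (simp add: I_res_form)

text \<open>
  A crude bound; it serves to know that the best constant is finite.
\<close>

lemma norm_Cauchy_formula:
  assumes f: "rat_calculus X A f F" and le: "\<And>z. z \<in> X \<Longrightarrow> cmod (f z) \<le> 1"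
  shows "norm (F x) \<le> (\<rho>1 + \<rho>2) / min (\<rho>1 - R) (r - \<rho>2) * norm x"
proof -
  define e where "e = min (\<rho>1 - R) (r - \<rho>2)"
  have e: "e > 0" using inside by (simp add: e_def)
  have c: "continuous_on \<Gamma> (\<lambda>s. f s * res_form A x y s)" for x y
    by (intro continuous_intros res_form_continuous analytic_continuous rat_calculus_analytic[OF f])
  have pt: "cmod (f s * res_form A x y s) \<le> norm x * norm y / e" if "s \<in> \<Gamma>" for s x y
  proof -
    have "cmod (f s * res_form A x y s) \<le> 1 * (norm x * norm y / ex s)"
      unfolding norm_mult using that arcs
      by (intro mult_mono le norm_res_form excess_pos) auto
    also have "\<dots> \<le> norm x * norm y / e"
      using excess_on_arcs[OF that] e unfolding e_def[symmetric] mult_1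
      by (intro divide_left_mono mult_nonneg_nonneg mult_pos_pos) auto
    finally show ?thesis .
  qed
  have bound: "cmod (cinner (F x) y) \<le> (\<rho>1 + \<rho>2) / e * norm x * norm y" for y
  proof -
    have "cmod (mean1 (\<lambda>s. f s * res_form A x y s * (s - c1))) \<le> norm x * norm y / e * \<rho>1"
    proof (rule norm_arc_mean_le)
      show "cmod (f s * res_form A x y s * (s - c1)) \<le> norm x * norm y / e * \<rho>1" if "s \<in> \<Gamma>1" for s
        unfolding norm_mult[of _ "s - c1"] using that radii pt[of s x y] e
        by (intro mult_mono) (auto simp: arc_points_norm)
    qed (use full radii e in \<open>auto intro!: continuous_intros continuous_on_subset[OF c]\<close>)
    moreover have "cmod (mean2 (\<lambda>s. f s * res_form A x y s * (s - c2))) \<le> norm x * norm y / e * \<rho>2"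
    proof (rule norm_arc_mean_le)
      show "cmod (f s * res_form A x y s * (s - c2)) \<le> norm x * norm y / e * \<rho>2" if "s \<in> \<Gamma>2" for s
        unfolding norm_mult[of _ "s - c2"] using that radii pt[of s x y] e
        by (intro mult_mono) (auto simp: arc_points_norm)
    qed (use full radii e in \<open>auto intro!: continuous_intros continuous_on_subset[OF c]\<close>)
    ultimately have "cmod (I (\<lambda>s. f s * res_form A x y s)) \<le>
        norm x * norm y / e * \<rho>1 + norm x * norm y / e * \<rho>2"
      unfolding crescent_mean_def by (meson add_mono norm_triangle_ineq4 order_trans)
    then show ?thesis unfolding Cauchy_formula[OF f] by (simp add: algebra_simps add_divide_distrib)
  qed
  have "0 \<le> (\<rho>1 + \<rho>2) / e * norm x" using radii e by simp
  with bound show ?thesis unfolding e_def[symmetric] by (rule norm_le_by_duality)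
qed

text \<open>
  The form of \<open>g(A)\<close>, where \<open>g\<close> is the Cauchy integral of the conjugate of \<open>f\<close> minus a constant. The
  constant collects the terms \<open>-1\<close> of the two Poisson kernels.
\<close>

definition conj_form :: "(complex \<Rightarrow> complex) \<Rightarrow> 'a \<Rightarrow> 'a \<Rightarrow> complex" where
  "conj_form f x y =
    I (\<lambda>s. cnj (f s) * res_form A x y s) - cnj (mean1 f - mean2 f) * cinner x y"

text \<open>
  The left-hand side is the sum of the Poisson integrals of \<open>f\<close> over the two arcs, each of which
  is at most \<open>norm x * norm y\<close> by positivity.
\<close>

theorem norm_calculus_plus_conjugate:
  assumes f: "rat_calculus X A f F" and le: "\<And>z. z \<in> X \<Longrightarrow> cmod (f z) \<le> 1"
  shows "cmod (cinner (F x) y + cnj (conj_form f y x)) \<le> 2 * norm x * norm y"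
proof -
  have c: "continuous_on \<Gamma> f"
    by (intro analytic_continuous rat_calculus_analytic[OF f])
  have c12: "continuous_on \<Gamma>1 f" "continuous_on \<Gamma>2 f" using c by (auto intro: continuous_on_subset)
  have "cmod (mean1 (\<lambda>s. f s * poisson c1 x y s)) \<le> norm x * norm y"
    using inside full arcs le c12 by (intro outer_arc_poisson_le) auto
  moreover have "cmod (mean2 (\<lambda>s. f s * poisson c2 x y s)) \<le> norm x * norm y"
    using inside radii full arcs le c12 by (intro inner_arc_poisson_le) auto
  moreover have "cinner (F x) y + cnj (conj_form f y x) =
      mean1 (\<lambda>s. f s * poisson c1 x y s) - mean2 (\<lambda>s. f s * poisson c2 x y s)"
    unfolding Cauchy_formula[OF f, symmetric] conj_form_def
    by (simp add: mean_poisson c12 excess_pos crescent_mean_def cinner_commute[of y x] algebra_simps)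
  ultimately show ?thesis
    using norm_triangle_ineq4[of "mean1 (\<lambda>s. f s * poisson c1 x y s)" "mean2 (\<lambda>s. f s * poisson c2 x y s)"]
    by simp
qed

end

section \<open>The conjugate function is bounded\<close>

text \<open>
  With \<open>u = z - c1\<close>, eliminating the conjugate of \<open>u\<close> from the two equations leaves a quadratic
  equation for \<open>u\<close>.
\<close>

lemma finite_circle_inter_circle:
  assumes "c1 \<noteq> c2 \<or> \<rho>1 \<noteq> \<rho>2"
  shows "finite {z. cmod (z - c1) = \<rho>1 \<and> cmod (z - c2) = \<rho>2}"
proof (cases "c1 = c2")
  case True
  then have none: "{z. cmod (z - c1) = \<rho>1 \<and> cmod (z - c2) = \<rho>2} = {}" using assms by auto
  show ?thesis unfolding none by simp
next
  case False
  define e where "e = c2 - c1"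
  define p where "p = [:- (e * of_real (\<rho>1^2)), of_real (\<rho>1^2) + e * cnj e - of_real (\<rho>2^2), - cnj e:]"
  have p: "p \<noteq> 0" using False by (simp add: p_def e_def)
  have "{z. cmod (z - c1) = \<rho>1 \<and> cmod (z - c2) = \<rho>2} \<subseteq> (\<lambda>u. u + c1) ` {u. poly p u = 0}"
  proof clarify
    fix z assume 1: "\<rho>1 = cmod (z - c1)" and 2: "\<rho>2 = cmod (z - c2)"
    define u where "u = z - c1"
    have "of_real (\<rho>1^2) = u * cnj u" by (simp only: 1 u_def complex_norm_square)
    moreover have "of_real (\<rho>2^2) = (u - e) * cnj (u - e)"
      unfolding 2 complex_norm_square by (simp add: u_def e_def)
    ultimately have "poly p u = 0" unfolding p_def by (simp only:) (simp add: algebra_simps)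
    then show "z \<in> (\<lambda>u. u + c1) ` {u. poly p u = 0}" by (auto simp: u_def intro: image_eqI[of _ _ "z - c1"])
  qed
  then show ?thesis using finite_imageI[OF poly_roots_finite[OF p]] finite_subset by blast
qed

text \<open>
  A high power of \<open>g\<close> times a polynomial that vanishes on \<open>E\<close> obeys the bound at every boundary point;
  taking roots removes the polynomial.
\<close>

lemma maximum_modulus_finite_exceptions:
  fixes g :: "complex \<Rightarrow> complex"
  assumes W: "open W" "bounded W" and g: "g holomorphic_on W"
    and M: "\<And>z. z \<in> W \<Longrightarrow> cmod (g z) \<le> M"
    and E: "finite E" "E \<inter> W = {}" and B: "B \<ge> 0"
    and frontier: "\<And>z0 e. z0 \<in> frontier W \<Longrightarrow> z0 \<notin> E \<Longrightarrow> e > 0 \<Longrightarrow>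
        \<forall>\<^sub>F z in at z0 within W. cmod (g z) \<le> B + e"
    and w: "w \<in> W"
  shows "cmod (g w) \<le> B"
proof (rule field_le_epsilon)
  fix e :: real assume e: "e > 0"
  have Be: "B + e > 0" using B e by simp
  show "cmod (g w) \<le> B + e"
  proof (rule ccontr)
    assume "\<not> ?thesis"
    then have big: "1 < cmod (g w) / (B + e)" using Be by simp
    obtain D where D: "D > 0" "\<And>z. z \<in> W \<union> E \<Longrightarrow> cmod z \<le> D"
      using bounded_Un[of W E] W(2) finite_imp_bounded[OF E(1)] by (auto simp: bounded_pos)
    define b where "b = (\<lambda>z. \<Prod>p\<in>E. (z - p) / of_real (2 * D))"
    have b1: "cmod ((z - p) / of_real (2 * D)) \<le> 1" if "z \<in> W" "p \<in> E" for z p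
    proof -
      have "cmod z \<le> D" "cmod p \<le> D" using that D(2) by auto
      then have "cmod (z - p) \<le> 2 * D" using norm_triangle_ineq4[of z p] by linarith
      then show ?thesis using D(1) by (simp add: norm_divide)
    qed
    have b_le: "cmod (b z) \<le> cmod (z - p) / (2 * D)" if "z \<in> W" "p \<in> E" for z p
    proof -
      have bz: "b z = (z - p) / of_real (2 * D) * (\<Prod>q\<in>E - {p}. (z - q) / of_real (2 * D))"
        unfolding b_def by (rule prod.remove) (use E that in auto)
      have "cmod (\<Prod>q\<in>E - {p}. (z - q) / of_real (2 * D)) \<le> 1"
        unfolding prod_norm[symmetric] using b1[OF that(1)] by (intro prod_le_1) auto
      then have "cmod (b z) \<le> cmod ((z - p) / of_real (2 * D)) * 1"
        unfolding bz norm_mult[of "(z - p) / _"] by (rule mult_left_mono) simp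
      then show ?thesis using D by (simp add: norm_divide)
    qed
    have b_le1: "cmod (b z) \<le> 1" if "z \<in> W" for z
      unfolding b_def prod_norm[symmetric] using b1[OF that] by (intro prod_le_1) auto
    have bw: "cmod (b w) > 0" using E w D by (auto simp: b_def)
    obtain n where n: "1 / cmod (b w) < (cmod (g w) / (B + e)) ^ n"
      using real_arch_pow[OF big] by blast
    define h where "h = (\<lambda>z. (g z / of_real (B + e)) ^ n * b z)"
    have hw: "1 < cmod (h w)"
      using n bw Be by (simp add: h_def norm_mult norm_power norm_divide field_simps del: of_real_add)
    have hol: "h holomorphic_on W"
      unfolding h_def b_def using Be D by (intro holomorphic_intros g) auto
    define V where "V = {z \<in> W. 1 < cmod (h z)}"
    have contW: "continuous_on W h" using hol by (rule holomorphic_on_imp_continuous_on)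
    have openV: "open V"
    proof -
      have "open (W \<inter> (\<lambda>z. cmod (h z)) -` {1<..})"
        using W(1) contW by (intro continuous_open_preimage continuous_intros) auto
      then show ?thesis by (simp add: V_def vimage_def Int_def)
    qed
    have clV: "closure V \<subseteq> W"
    proof (rule ccontr)
      assume "\<not> ?thesis"
      then obtain z0 where z0: "z0 \<in> closure V" "z0 \<notin> W" by blast
      have "z0 \<in> closure W" using z0(1) closure_mono[of V W] by (auto simp: V_def)
      then have fr: "z0 \<in> frontier W" using z0(2) W(1) by (simp add: frontier_def interior_open)
      have "\<forall>\<^sub>F z in at z0 within W. cmod (h z) \<le> 1"
      proof (cases "z0 \<in> E")
        case False
        have "\<forall>\<^sub>F z in at z0 within W. z \<in> W" by (simp add: eventually_at_filter)
        with frontier[OF fr False e] show ?thesis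
        proof eventually_elim
          case (elim z)
          have "cmod (g z / of_real (B + e)) \<le> 1" using elim(1) Be by (simp add: norm_divide del: of_real_add)
          then have "cmod (g z / of_real (B + e)) ^ n \<le> 1" by (intro power_le_one) auto
          then show ?case
            unfolding h_def norm_mult norm_power using b_le1[OF elim(2)] by (intro mult_le_one) auto
        qed
      next
        case True
        define C where "C = (M / (B + e)) ^ n"
        have "((\<lambda>z. C * (cmod (z - z0) / (2 * D))) \<longlongrightarrow> C * (cmod (z0 - z0) / (2 * D))) (at z0 within W)"
          by (intro tendsto_intros) (use D in auto)
        then have "\<forall>\<^sub>F z in at z0 within W. C * (cmod (z - z0) / (2 * D)) < 1"
          by (rule order_tendstoD) simp
        moreover have "\<forall>\<^sub>F z in at z0 within W. z \<in> W" by (simp add: eventually_at_filter)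
        ultimately show ?thesis
        proof eventually_elim
          case (elim z)
          have "cmod (g z / of_real (B + e)) \<le> M / (B + e)"
            using M[OF elim(2)] Be by (simp add: norm_divide divide_right_mono del: of_real_add)
          then have "cmod (g z / of_real (B + e)) ^ n \<le> C" unfolding C_def by (intro power_mono) auto
          then have "cmod (h z) \<le> C * (cmod (z - z0) / (2 * D))"
            unfolding h_def norm_mult norm_power using b_le[OF elim(2) True]
            by (intro mult_mono) (auto intro: order_trans[rotated])
          then show ?case using elim(1) by simp
        qed
      qed
      then obtain U where U: "open U" "z0 \<in> U" "\<And>z. z \<in> U \<Longrightarrow> z \<noteq> z0 \<Longrightarrow> z \<in> W \<Longrightarrow> cmod (h z) \<le> 1"
        by (auto simp: eventually_at_topological)
      obtain z where "z \<in> U" "z \<in> V" using z0(1) U(1,2) unfolding closure_iff_nhds_not_empty by blast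
      then show False using U(3)[of z] z0(2) by (auto simp: V_def)
    qed
    have "cmod (h w) \<le> 1"
    proof (rule maximum_modulus_frontier[of h V])
      show "h holomorphic_on interior V"
        using hol by (rule holomorphic_on_subset) (use interior_subset in \<open>force simp: V_def\<close>)
      show "continuous_on (closure V) h" using contW clV by (rule continuous_on_subset)
      show "bounded V" using W(2) by (rule bounded_subset) (auto simp: V_def)
      show "cmod (h z) \<le> 1" if "z \<in> frontier V" for z
        using that clV openV by (auto simp: frontier_def interior_open V_def not_less)
      show "w \<in> V" using w hw by (simp add: V_def)
    qed
    with hw show False by simp
  qed
qed

lemma Cauchy_transform_holomorphic:
  assumes h: "continuous_on (arc_points c \<rho> a b) h"
  shows "(\<lambda>z. arc_mean c \<rho> a b (\<lambda>s. h s / (s - z))) holomorphic_on - arc_points c \<rho> a b"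
proof -
  let ?\<Gamma> = "arc_points c \<rho> a b" and ?p = "\<lambda>t. c + of_real \<rho> * cis t"
  have op: "open (- ?\<Gamma>)" using compact_arc_points by (simp add: open_Compl compact_imp_closed)
  have "(\<lambda>z. arc_mean c \<rho> a b (\<lambda>s. h s / (s - z))) field_differentiable at z0" if z0: "z0 \<in> - ?\<Gamma>" for z0
  proof -
    obtain e where e: "e > 0" "ball z0 e \<subseteq> - ?\<Gamma>" using op z0 openE by blast
    have nz: "?p t - z \<noteq> 0" if "z \<in> ball z0 e" "t \<in> cbox a b" for z t
      using that e(2) arc_points_I[of a t b c \<rho>] by auto
    have ht: "continuous_on (cbox a b) (\<lambda>t. h (?p t))" using continuous_on_arc[OF h] by simp
    have "(\<lambda>z. integral (cbox a b) (\<lambda>t. h (?p t) / (?p t - z))) holomorphic_on ball z0 e"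
    proof (rule leibniz_rule_holomorphic[where fx = "\<lambda>z t. h (?p t) / (?p t - z)^2"])
      show "((\<lambda>z. h (?p t) / (?p t - z)) has_field_derivative h (?p t) / (?p t - z)^2) (at z within ball z0 e)"
        if "z \<in> ball z0 e" "t \<in> cbox a b" for z t
        using nz[OF that] by (auto intro!: derivative_eq_intros simp: power2_eq_square)
      show "(\<lambda>t. h (?p t) / (?p t - z)) integrable_on cbox a b" if "z \<in> ball z0 e" for z
        using nz[OF that] by (intro integrable_continuous continuous_intros ht) auto
      show "continuous_on (ball z0 e \<times> cbox a b) (\<lambda>(z, t). h (?p t) / (?p t - z)^2)"
        unfolding case_prod_beta
        by (intro continuous_intros continuous_on_compose2[OF ht]) (use nz in auto)
    qed simp
    then have "(\<lambda>z. integral (cbox a b) (\<lambda>t. h (?p t) / (?p t - z)) / of_real (2 * pi)) holomorphic_on ball z0 e"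
      by (intro holomorphic_intros) auto
    then show ?thesis
      unfolding arc_mean_def using e(1) holomorphic_on_imp_differentiable_at[of _ "ball z0 e" z0] by simp
  qed
  then show ?thesis by (auto simp: holomorphic_on_def intro: field_differentiable_at_within)
qed

definition circle_reflection :: "complex \<Rightarrow> real \<Rightarrow> complex \<Rightarrow> complex" where
  "circle_reflection c \<rho> z = c + of_real (\<rho>^2) / cnj (z - c)"

text \<open>
  On the circle, \<open>cnj ((s - c) / (s - z)) - 1 = - (s - c) / (s - z')\<close> for the mirror image \<open>z'\<close> of \<open>z\<close>.
\<close>

lemma arc_mean_reflection:
  fixes f :: "complex \<Rightarrow> complex" and z :: complex
  assumes f: "continuous_on (arc_points c \<rho> a b) f" and \<rho>: "\<rho> > 0" and z: "z \<noteq> c" "cmod (z - c) \<noteq> \<rho>"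
  shows "cnj (arc_mean c \<rho> a b (\<lambda>s. cnj (f s) * (s - c) / (s - z))) - arc_mean c \<rho> a b f =
    - arc_mean c \<rho> a b (\<lambda>s. f s * (s - c) / (s - circle_reflection c \<rho> z))"
proof -
  let ?\<Gamma> = "arc_points c \<rho> a b"
  have nz: "s - z \<noteq> 0" if "s \<in> ?\<Gamma>" for s
    using arc_points_norm[OF that] \<rho> z by auto
  have "continuous_on ?\<Gamma> (\<lambda>s. cnj (cnj (f s) * (s - c) / (s - z)))"
    by (intro continuous_intros f) (use nz in auto)
  then have "cnj (arc_mean c \<rho> a b (\<lambda>s. cnj (f s) * (s - c) / (s - z))) - arc_mean c \<rho> a b f =
      arc_mean c \<rho> a b (\<lambda>s. cnj (cnj (f s) * (s - c) / (s - z)) - f s)"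
    by (simp only: arc_mean_diff[OF _ f] arc_mean_cnj)
  also have "\<dots> = arc_mean c \<rho> a b (\<lambda>s. - (f s * (s - c) / (s - circle_reflection c \<rho> z)))"
  proof (rule arc_mean_cong)
    fix s assume d: "s \<in> ?\<Gamma>"
    define d where "d = s - c"
    define u where "u = z - c"
    have ss: "of_real (\<rho>^2) = d * cnj d"
      using arc_points_norm[OF d] \<rho> by (simp only: d_def complex_norm_square[symmetric])
    have u: "cnj u \<noteq> 0" "d \<noteq> 0" using z arc_points_norm[OF d] \<rho> by (auto simp: u_def d_def)
    have su: "cnj d - cnj u \<noteq> 0" using nz[OF d] by (simp add: d_def u_def flip: complex_cnj_diff)
    have "s - circle_reflection c \<rho> z = d - d * cnj d / cnj u"
      unfolding circle_reflection_def ss by (simp add: d_def u_def)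
    also have "\<dots> = - (d * (cnj d - cnj u) / cnj u)" using u by (simp add: field_simps)
    finally have "f s * (s - c) / (s - circle_reflection c \<rho> z) = - (f s * cnj u / (cnj d - cnj u))"
      using u su by (simp add: d_def[symmetric])
    moreover have "cnj (cnj (f s) * (s - c) / (s - z)) = f s * cnj d / (cnj d - cnj u)"
      by (simp add: d_def u_def)
    moreover have "f s * cnj d / (cnj d - cnj u) - f s = f s * cnj u / (cnj d - cnj u)"
      using su by (simp add: field_simps)
    ultimately show "cnj (cnj (f s) * (s - c) / (s - z)) - f s =
        - (f s * (s - c) / (s - circle_reflection c \<rho> z))" by simp
  qed
  finally show ?thesis by (simp only: arc_mean_uminus)
qed

lemma reflection_tendsto:
  assumes "cmod (z0 - c) = \<rho>" "\<rho> > 0"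
  shows "(circle_reflection c \<rho> \<longlongrightarrow> z0) (at z0 within S)"
proof -
  have nz: "cnj (z0 - c) \<noteq> 0" using assms by auto
  have "(circle_reflection c \<rho> \<longlongrightarrow> circle_reflection c \<rho> z0) (at z0 within S)"
    unfolding circle_reflection_def by (intro tendsto_intros nz)
  moreover have "of_real (\<rho>^2) / cnj (z0 - c) = z0 - c"
    using nz unfolding assms(1)[symmetric] complex_norm_square by simp
  ultimately show ?thesis by (simp add: circle_reflection_def)
qed

lemma rat_calculus_at_point:
  assumes "rat_calculus X A f F" "z \<in> X"
  shows "rat_calculus X (\<lambda>w :: complex. z * w) f (\<lambda>w. f z * w)"
  using assms
proof induction
  case (const c)
  then show ?case using rat_calculus.const[of X "\<lambda>w. z * w" c] by (simp add: scaleC_complex_def)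
next
  case (pole a)
  then have "z \<noteq> a" by auto
  then show ?case
    using rat_calculus.pole[OF pole(1), of "\<lambda>w. z * w"] by (simp add: resolvent_mult)
next
  case (add f F g G)
  then show ?case
    using rat_calculus.add[of X "\<lambda>w. z * w" f "\<lambda>w. f z * w" g "\<lambda>w. g z * w"] by (simp add: distrib_right)
next
  case (mult f F g G)
  then show ?case
    using rat_calculus.mult[of X "\<lambda>w. z * w" f "\<lambda>w. f z * w" g "\<lambda>w. g z * w"] by (simp add: mult.assoc)
qed (auto intro: rat_calculus.ident)

context crescent_contour
begin

text \<open>
  The open crescent.
\<close>

definition W :: "complex set" where "W = {z. cmod (z - c1) < \<rho>1 \<and> \<rho>2 < cmod (z - c2)}"

lemma open_W: "open W"
  unfolding W_def Collect_conj_eq by (intro open_Int open_Collect_less continuous_intros)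

lemma bounded_W: "bounded W"
  by (rule bounded_subset[OF bounded_ball[of c1 \<rho>1]]) (auto simp: W_def dist_norm norm_minus_commute)

lemma arcs_avoid_W: "s \<in> \<Gamma> \<Longrightarrow> z \<in> W \<Longrightarrow> s \<noteq> z"
  using radii by (auto simp: W_def arc_points_norm)

lemma W_subset_X: "W \<subseteq> X"
  by (auto simp: W_def crescent_def)

lemma crescent_calculus_at_point:
  assumes z: "z \<in> W"
  shows "crescent_calculus (\<lambda>w. z * w) c1 \<rho>1 a1 b1 c2 \<rho>2 a2 b2 (cmod (z - c1)) (cmod (z - c2))"
proof unfold_locales
  show "crescent_op c1 (cmod (z - c1)) c2 (cmod (z - c2)) (\<lambda>w. z * w)"
    using z radii by (intro crescent_op_mult) (auto simp: crescent_def W_def)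
qed (use z in \<open>auto simp: W_def\<close>)

text \<open>
  The scalar case of \<open>conj_form\<close>.
\<close>

definition conj_function :: "(complex \<Rightarrow> complex) \<Rightarrow> complex \<Rightarrow> complex" where
  "conj_function f z = I (\<lambda>s. cnj (f s) / (s - z)) - cnj (mean1 f - mean2 f)"

abbreviation "cauchy1 f z \<equiv> mean1 (\<lambda>s. f s * (s - c1) / (s - z))"
abbreviation "cauchy2 f z \<equiv> mean2 (\<lambda>s. f s * (s - c2) / (s - z))"

lemma conj_function_eq:
  "conj_function f z = cauchy1 (\<lambda>s. cnj (f s)) z
    - cauchy2 (\<lambda>s. cnj (f s)) z - cnj (mean1 f) + cnj (mean2 f)"
  by (simp add: conj_function_def crescent_mean_def)

lemma holomorphic_conj_function:
  assumes "f analytic_on X"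
  shows "conj_function f holomorphic_on W"
proof -
  have c: "continuous_on \<Gamma>1 f" "continuous_on \<Gamma>2 f"
    using analytic_continuous[OF assms] by (auto intro: continuous_on_subset)
  have "(\<lambda>z. cauchy1 (\<lambda>s. cnj (f s)) z) holomorphic_on W"
    by (rule holomorphic_on_subset[OF Cauchy_transform_holomorphic])
      (use arcs_avoid_W in \<open>auto intro!: continuous_intros c\<close>)
  moreover have "(\<lambda>z. cauchy2 (\<lambda>s. cnj (f s)) z) holomorphic_on W"
    by (rule holomorphic_on_subset[OF Cauchy_transform_holomorphic])
      (use arcs_avoid_W in \<open>auto intro!: continuous_intros c\<close>)
  ultimately show ?thesis
    unfolding conj_function_eq[abs_def] by (intro holomorphic_intros)
qed

context
  fixes f :: "complex \<Rightarrow> complex"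
  assumes f: "f analytic_on X" and le: "\<And>z. z \<in> X \<Longrightarrow> cmod (f z) \<le> 1"
begin

lemma fc: "continuous_on \<Gamma>1 f" "continuous_on \<Gamma>2 f"
  using analytic_continuous[OF f] by (auto intro: continuous_on_subset)

lemma Cauchy_outside:
  assumes "z \<notin> X"
  shows "cauchy1 f z = cauchy2 f z"
proof -
  have "(\<lambda>s. f s / (s - z)) analytic_on X" using assms by (auto intro!: analytic_intros f)
  from cauchy[OF this] show ?thesis by (simp add: crescent_mean_def)
qed

text \<open>
  The mirror image \<open>z'\<close> of \<open>z\<close> in the outer circle lies outside the crescent. By reflection and by
  Cauchy's theorem, the outer part of the conjugate of \<open>g z\<close> is an integral over the inner arc with
  pole \<open>z'\<close>. If the pole were \<open>z\<close>, it would combine with the inner part of \<open>g z\<close> to the Poisson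
  integral of \<open>f\<close> over the inner arc.
\<close>

lemma conj_function_near_outer_arc:
  assumes z: "z \<in> W" "z \<noteq> c1"
  defines "q \<equiv> cauchy2 f"
  shows "cmod (conj_function f z) \<le> 1 + cmod (q z - q (circle_reflection c1 \<rho>1 z))"
proof -
  interpret S: crescent_calculus "\<lambda>w. z * w" c1 \<rho>1 a1 b1 c2 \<rho>2 a2 b2 "cmod (z - c1)" "cmod (z - c2)"
    by (rule crescent_calculus_at_point[OF z(1)])
  define z' where "z' = circle_reflection c1 \<rho>1 z"
  have "cmod (z' - c1) = \<rho>1^2 / cmod (z - c1)" by (simp add: z'_def circle_reflection_def norm_divide norm_power del: complex_cnj_diff)
  also have "\<dots> > \<rho>1"
    using z radii by (simp add: W_def pos_less_divide_eq power2_eq_square)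
  finally have out: "z' \<notin> X" by (simp add: crescent_def)
  have 1: "cnj (cauchy1 (\<lambda>s. cnj (f s)) z) - mean1 f = - q z'"
    using arc_mean_reflection[OF fc(1) radii(1) z(2)] z(1) Cauchy_outside[OF out]
    by (simp add: W_def q_def z'_def[symmetric])
  have res: "res_form (\<lambda>w. z * w) 1 1 s = 1 / (s - z)" if "s \<in> \<Gamma>2" for s
    using arcs_avoid_W[of s z] that z by (intro res_form_mult) auto
  have "mean2 (\<lambda>s. f s * S.poisson c2 1 1 s) =
      q z + cnj (cauchy2 (\<lambda>s. cnj (f s)) z) - mean2 f"
    using S.mean_poisson[OF fc(2), of 1 1] S.excess_pos
    by (simp add: q_def res cinner_complex_def cong: arc_mean_cong)
  moreover have "cnj (conj_function f z) = cnj (cauchy1 (\<lambda>s. cnj (f s)) z)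
      - cnj (cauchy2 (\<lambda>s. cnj (f s)) z) - mean1 f + mean2 f"
    unfolding conj_function_eq complex_cnj_add complex_cnj_diff complex_cnj_cnj ..
  ultimately have "cnj (conj_function f z) = (q z - q z') - mean2 (\<lambda>s. f s * S.poisson c2 1 1 s)"
    using 1 by algebra
  then have "cmod (conj_function f z) = cmod ((q z - q z') - mean2 (\<lambda>s. f s * S.poisson c2 1 1 s))"
    by (metis complex_mod_cnj)
  also have "\<dots> \<le> cmod (q z - q z') + cmod (mean2 (\<lambda>s. f s * S.poisson c2 1 1 s))"
    by (rule norm_triangle_ineq4)
  also have "cmod (mean2 (\<lambda>s. f s * S.poisson c2 1 1 s)) \<le> norm (1 :: complex) * norm (1 :: complex)"
    using S.inside radii full arcs le fc by (intro S.inner_arc_poisson_le) auto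
  finally show ?thesis by (simp add: z'_def)
qed

lemma conj_function_near_inner_arc:
  assumes z: "z \<in> W"
  defines "q \<equiv> cauchy1 f"
  shows "cmod (conj_function f z) \<le> 1 + cmod (q z - q (circle_reflection c2 \<rho>2 z))"
proof -
  interpret S: crescent_calculus "\<lambda>w. z * w" c1 \<rho>1 a1 b1 c2 \<rho>2 a2 b2 "cmod (z - c1)" "cmod (z - c2)"
    by (rule crescent_calculus_at_point[OF z])
  define z' where "z' = circle_reflection c2 \<rho>2 z"
  have zc: "z \<noteq> c2" using z radii by (auto simp: W_def)
  have "cmod (z' - c2) = \<rho>2^2 / cmod (z - c2)" by (simp add: z'_def circle_reflection_def norm_divide norm_power del: complex_cnj_diff)
  also have "\<dots> < \<rho>2"
    using z zc radii by (simp add: W_def pos_divide_less_eq power2_eq_square)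
  finally have out: "z' \<notin> X" by (simp add: crescent_def)
  have 1: "cnj (cauchy2 (\<lambda>s. cnj (f s)) z) - mean2 f = - q z'"
    using arc_mean_reflection[OF fc(2) radii(2) zc] z Cauchy_outside[OF out]
    by (simp add: W_def q_def z'_def[symmetric])
  have res: "res_form (\<lambda>w. z * w) 1 1 s = 1 / (s - z)" if "s \<in> \<Gamma>1" for s
    using arcs_avoid_W[of s z] that z by (intro res_form_mult) auto
  have "mean1 (\<lambda>s. f s * S.poisson c1 1 1 s) =
      q z + cnj (cauchy1 (\<lambda>s. cnj (f s)) z) - mean1 f"
    using S.mean_poisson[OF fc(1), of 1 1] S.excess_pos
    by (simp add: q_def res cinner_complex_def cong: arc_mean_cong)
  moreover have "cnj (conj_function f z) = cnj (cauchy1 (\<lambda>s. cnj (f s)) z)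
      - cnj (cauchy2 (\<lambda>s. cnj (f s)) z) - mean1 f + mean2 f"
    unfolding conj_function_eq complex_cnj_add complex_cnj_diff complex_cnj_cnj ..
  ultimately have "cnj (conj_function f z) = mean1 (\<lambda>s. f s * S.poisson c1 1 1 s) - (q z - q z')"
    using 1 by algebra
  then have "cmod (conj_function f z) = cmod (mean1 (\<lambda>s. f s * S.poisson c1 1 1 s) - (q z - q z'))"
    by (metis complex_mod_cnj)
  also have "\<dots> \<le> cmod (mean1 (\<lambda>s. f s * S.poisson c1 1 1 s)) + cmod (q z - q z')"
    by (rule norm_triangle_ineq4)
  also have "cmod (mean1 (\<lambda>s. f s * S.poisson c1 1 1 s)) \<le> norm (1 :: complex) * norm (1 :: complex)"
    using S.inside radii full arcs le fc by (intro S.outer_arc_poisson_le) auto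
  finally show ?thesis by (simp add: z'_def)
qed

text \<open>
  At a boundary point off one circle, the integral over the arc of that circle is continuous, and the
  point is its own mirror image in the other circle.
\<close>

lemma conj_function_frontier:
  assumes z0: "z0 \<in> frontier W" "\<not> (cmod (z0 - c1) = \<rho>1 \<and> cmod (z0 - c2) = \<rho>2)" and e: "e > 0"
  shows "\<forall>\<^sub>F z in at z0 within W. cmod (conj_function f z) \<le> 1 + e"
proof -
  have "closed X" using compact_crescent by (rule compact_imp_closed)
  then have "closure W \<subseteq> X" using W_subset_X by (rule closure_minimal[rotated])
  then have z0X: "z0 \<in> X" "z0 \<notin> W" using z0(1) open_W by (auto simp: frontier_def interior_open)
  have inW: "\<forall>\<^sub>F z in at z0 within W. z \<in> W" by (simp add: eventually_at_filter)
  have vanish: "\<forall>\<^sub>F z in at z0 within W. cmod (q z - q (circle_reflection c \<rho> z)) < e"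
    if "q holomorphic_on - \<Gamma>" "closed \<Gamma>" "z0 \<notin> \<Gamma>" "cmod (z0 - c) = \<rho>" "\<rho> > 0" for q \<Gamma> c \<rho>
  proof -
    have "isCont q z0"
      using that holomorphic_on_imp_continuous_on[OF that(1)]
      by (simp add: continuous_on_eq_continuous_at open_Compl)
    then have "((\<lambda>z. q z - q (circle_reflection c \<rho> z)) \<longlongrightarrow> q z0 - q z0) (at z0 within W)"
      by (intro tendsto_diff isCont_tendsto_compose[OF _ reflection_tendsto[OF that(4,5)]])
        (auto simp: isCont_def intro: tendsto_within_subset)
    then have "((\<lambda>z. cmod (q z - q (circle_reflection c \<rho> z))) \<longlongrightarrow> 0) (at z0 within W)"
      by (auto dest: tendsto_norm)
    then show ?thesis using e by (rule order_tendstoD)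
  qed
  consider "cmod (z0 - c1) = \<rho>1" "\<rho>2 < cmod (z0 - c2)" | "cmod (z0 - c2) = \<rho>2" "cmod (z0 - c1) < \<rho>1"
    using z0(2) z0X by (auto simp: W_def crescent_def)
  then show ?thesis
  proof cases
    case 1
    have "cauchy2 f holomorphic_on - \<Gamma>2"
      by (intro Cauchy_transform_holomorphic continuous_intros fc)
    note vanish[OF this compact_imp_closed[OF compact_arc_points] _ 1(1) radii(1)]
    moreover have "z0 \<notin> \<Gamma>2" using 1 radii by (auto simp: arc_points_norm)
    ultimately have "\<forall>\<^sub>F z in at z0 within W. cmod (cauchy2 f z
        - cauchy2 f (circle_reflection c1 \<rho>1 z)) < e" by blast
    moreover have "z0 \<noteq> c1" using 1 radii by auto
    then have "\<forall>\<^sub>F z in at z0 within W. z \<noteq> c1"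
      by (intro tendsto_imp_eventually_ne[OF tendsto_ident_at])
    ultimately show ?thesis using inW
      by eventually_elim (use conj_function_near_outer_arc in fastforce)
  next
    case 2
    have "cauchy1 f holomorphic_on - \<Gamma>1"
      by (intro Cauchy_transform_holomorphic continuous_intros fc)
    note vanish[OF this compact_imp_closed[OF compact_arc_points] _ 2(1) radii(2)]
    moreover have "z0 \<notin> \<Gamma>1" using 2 radii by (auto simp: arc_points_norm)
    ultimately have "\<forall>\<^sub>F z in at z0 within W. cmod (cauchy1 f z
        - cauchy1 f (circle_reflection c2 \<rho>2 z)) < e" by blast
    then show ?thesis using inW
      by eventually_elim (use conj_function_near_inner_arc in fastforce)
  qed
qed

end

text \<open>
  The exceptional points of the maximum principle are the corners. The a priori bound is
  \<open>\<bar>g\<bar> \<le> \<bar>f + cnj g\<bar> + \<bar>f\<bar> \<le> 3\<close>.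
\<close>

theorem norm_conj_function_le:
  assumes f: "rat_calculus X A f F" and le: "\<And>z. z \<in> X \<Longrightarrow> cmod (f z) \<le> 1" and w: "w \<in> W"
  shows "cmod (conj_function f w) \<le> 1"
proof (rule maximum_modulus_finite_exceptions[where W = W and M = 3
      and g = "conj_function f" and w = w
      and E = "{z. cmod (z - c1) = \<rho>1 \<and> cmod (z - c2) = \<rho>2}"])
  note fa = rat_calculus_analytic[OF f]
  show "open W" "bounded W" "conj_function f holomorphic_on W"
    by (rule open_W bounded_W holomorphic_conj_function[OF fa])+
  show "finite {z. cmod (z - c1) = \<rho>1 \<and> cmod (z - c2) = \<rho>2}"
    by (rule finite_circle_inter_circle) (use w in \<open>auto simp: W_def\<close>)
  show "\<forall>\<^sub>F z in at z0 within W. cmod (conj_function f z) \<le> 1 + e"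
    if "z0 \<in> frontier W" "z0 \<notin> {z. cmod (z - c1) = \<rho>1 \<and> cmod (z - c2) = \<rho>2}" "e > 0" for z0 e
    using that by (intro conj_function_frontier[OF fa le]) auto
  show "cmod (conj_function f z) \<le> 3" if z: "z \<in> W" for z
  proof -
    interpret S: crescent_calculus "\<lambda>w. z * w" c1 \<rho>1 a1 b1 c2 \<rho>2 a2 b2 "cmod (z - c1)" "cmod (z - c2)"
      by (rule crescent_calculus_at_point[OF z])
    have zX: "z \<in> X" using z W_subset_X by blast
    have "I (\<lambda>s. cnj (f s) * res_form (\<lambda>w. z * w) 1 1 s) = I (\<lambda>s. cnj (f s) / (s - z))"
      by (rule I_cong) (use arcs_avoid_W[OF _ z] res_form_mult in force)
    then have "S.conj_form f 1 1 = conj_function f z"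
      by (simp add: S.conj_form_def conj_function_def cinner_complex_def)
    then have "cmod (f z + cnj (conj_function f z)) \<le> 2"
      using S.norm_calculus_plus_conjugate[OF rat_calculus_at_point[OF f zX] le, of 1 1]
      by (simp add: cinner_complex_def)
    then show ?thesis
      using le[OF zX] norm_triangle_ineq4[of "f z + cnj (conj_function f z)" "f z"] by simp
  qed
qed (use w in \<open>auto simp: W_def\<close>)

end

section \<open>Riemann sums\<close>

lemma riemann_sum_error:
  fixes \<phi> :: "real \<Rightarrow> complex"
  assumes cont: "continuous_on {a..b} \<phi>" and h: "h \<ge> 0" "a + real n * h \<le> b"
    and osc: "\<And>s t. s \<in> {a..b} \<Longrightarrow> t \<in> {a..b} \<Longrightarrow> \<bar>s - t\<bar> \<le> h \<Longrightarrow> cmod (\<phi> s - \<phi> t) \<le> e"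
  shows "cmod (integral {a..a + real n * h} \<phi> - (\<Sum>j<n. of_real h * \<phi> (a + real j * h))) \<le> real n * h * e"
  using h(2)
proof (induction n)
  case 0
  then show ?case by simp
next
  case (Suc n)
  define m where "m = a + real n * h"
  have m: "a \<le> m" "m + h \<le> b" "a + real (Suc n) * h = m + h"
    using Suc.prems h(1) by (simp_all add: m_def algebra_simps)
  have c: "continuous_on {a..m + h} \<phi>" "continuous_on {m..m + h} \<phi>"
    using m h(1) by (auto intro: continuous_on_subset[OF cont])
  have split: "integral {a..m + h} \<phi> = integral {a..m} \<phi> + integral {m..m + h} \<phi>"
    using m h(1) c(1)
    by (intro Henstock_Kurzweil_Integration.integral_combine[symmetric] integrable_continuous_real) auto
  have "integral {m..m + h} \<phi> - of_real h * \<phi> m = integral {m..m + h} (\<lambda>t. \<phi> t - \<phi> m)"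
    using h(1) c(2) by (subst integral_diff) (auto intro: integrable_continuous_real simp: scaleR_conv_of_real)
  also have "cmod \<dots> \<le> e * (m + h - m)"
    using m h(1) by (intro integral_bound continuous_intros c osc) auto
  finally have step: "cmod (integral {m..m + h} \<phi> - of_real h * \<phi> m) \<le> h * e" by (simp add: mult.commute)
  have "cmod (integral {a..m} \<phi> - (\<Sum>j<n. of_real h * \<phi> (a + real j * h))) \<le> real n * h * e"
    using Suc.IH m h(1) by (simp add: m_def)
  with step have "cmod ((integral {a..m} \<phi> - (\<Sum>j<n. of_real h * \<phi> (a + real j * h)))
      + (integral {m..m + h} \<phi> - of_real h * \<phi> m)) \<le> real n * h * e + h * e"
    by (intro order_trans[OF norm_triangle_ineq] add_mono)
  then show ?case unfolding m(3) split sum.lessThan_Suc m_def[symmetric] by (simp add: algebra_simps)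
qed

text \<open>
  Cauchy kernels \<open>1 / (s - z)\<close> with \<open>z\<close> at distance at least \<open>1 / M\<close> and resolvent forms
  share these bounds up to the scale \<open>S\<close>, so one Riemann sum
  approximates the integrals of all of them at once.
\<close>

definition tame_kernel :: "complex set \<Rightarrow> real \<Rightarrow> real \<Rightarrow> (complex \<Rightarrow> complex) \<Rightarrow> bool" where
  "tame_kernel \<Gamma> M S k \<longleftrightarrow> (\<forall>s\<in>\<Gamma>. cmod (k s) \<le> M * S) \<and>
    (\<forall>s\<in>\<Gamma>. \<forall>t\<in>\<Gamma>. cmod (k s - k t) \<le> M^2 * S * cmod (s - t))"

lemma tame_kernel_continuous:
  assumes "tame_kernel \<Gamma> M S k" "S \<ge> 0"
  shows "continuous_on \<Gamma> k"
proof (rule lipschitz_on_continuous_on)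
  show "(M^2 * S)-lipschitz_on \<Gamma> k"
    using assms by (intro lipschitz_onI) (auto simp: tame_kernel_def dist_norm)
qed

lemma arc_quadrature:
  assumes m: "continuous_on (arc_points c \<rho> a b) m" and M: "M \<ge> 0" and \<epsilon>: "\<epsilon> > 0"
  obtains L :: "(complex \<times> complex) list" where
    "\<And>w p. (w, p) \<in> set L \<Longrightarrow> p \<in> arc_points c \<rho> a b"
    "\<And>k S. tame_kernel (arc_points c \<rho> a b) M S k \<Longrightarrow> S \<ge> 0 \<Longrightarrow>
      cmod (arc_mean c \<rho> a b (\<lambda>s. m s * k s) - (\<Sum>(w, p)\<leftarrow>L. w * k p)) \<le> \<epsilon> * S"
proof (cases "a \<le> b")
  case False
  then show thesis using \<epsilon> by (intro that[of "[]"]) (auto simp: arc_mean_def)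
next
  case True
  let ?\<Gamma> = "arc_points c \<rho> a b" and ?p = "\<lambda>t. c + of_real \<rho> * cis t"
  have mt: "continuous_on {a..b} (\<lambda>t. m (?p t))" by (rule continuous_on_arc[OF m])
  obtain C where C: "C > 0" "\<And>t. t \<in> {a..b} \<Longrightarrow> cmod (m (?p t)) \<le> C"
    using compact_imp_bounded[OF compact_continuous_image[OF mt compact_Icc]] by (auto simp: bounded_pos)
  define e where "e = \<epsilon> * (2 * pi) / (b - a + 1)"
  have e: "e > 0" using \<epsilon> True by (simp add: e_def)
  define e1 where "e1 = e / (2 * (M + 1))"
  define e2 where "e2 = e / (2 * (C * M^2 + 1))"
  have CM: "C * M^2 \<ge> 0" using C by simp
  have e12: "e1 > 0" "e2 > 0" using e M CM by (simp_all add: e1_def e2_def add_nonneg_pos)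
  have e1M: "e1 * M \<le> e / 2" using e M by (simp add: e1_def field_simps)
  have e2M: "C * (M^2 * e2) \<le> e / 2"
  proof -
    have "C * (M^2 * e2) = e / 2 * (C * M^2 / (C * M^2 + 1))" by (simp add: e2_def)
    also have "\<dots> \<le> e / 2 * 1" using e CM by (intro mult_left_mono) (auto simp: divide_le_eq)
    finally show ?thesis by simp
  qed
  obtain d1 where d1: "d1 > 0"
    "\<And>s t. s \<in> {a..b} \<Longrightarrow> t \<in> {a..b} \<Longrightarrow> dist t s < d1 \<Longrightarrow> dist (m (?p t)) (m (?p s)) < e1"
    using compact_uniformly_continuous[OF mt compact_Icc] e12(1) unfolding uniformly_continuous_on_def by metis
  obtain d2 where d2: "d2 > 0"
    "\<And>s t. s \<in> {a..b} \<Longrightarrow> t \<in> {a..b} \<Longrightarrow> dist t s < d2 \<Longrightarrow> dist (?p t) (?p s) < e2"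
    using compact_uniformly_continuous[OF continuous_on_circle[of "{a..b}" c \<rho>] compact_Icc] e12(2)
    unfolding uniformly_continuous_on_def by metis
  define d where "d = min d1 d2"
  have d: "d > 0" using d1 d2 by (simp add: d_def)
  obtain N :: nat where N: "(b - a) / d < real N" using reals_Archimedean2 by blast
  have "0 \<le> (b - a) / d" using True d by simp
  then have N0: "N > 0" using N by (cases N) auto
  define h where "h = (b - a) / real N"
  have h: "h \<ge> 0" "h < d" "a + real N * h = b"
    using True N0 N d by (simp_all add: h_def field_simps)
  define L where "L = map (\<lambda>j. (of_real h * m (?p (a + real j * h)) / of_real (2 * pi), ?p (a + real j * h))) [0..<N]"
  have node: "a + real j * h \<in> {a..b}" if "j < N" for j
    using that h(1) mult_right_mono[of "real j" "real N" h] h(3) by auto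
  show thesis
  proof (rule that[of L])
    show "p \<in> ?\<Gamma>" if "(w, p) \<in> set L" for w p
      using that node by (auto simp: L_def intro!: arc_points_I)
    fix k S assume k: "tame_kernel ?\<Gamma> M S k" and S: "S \<ge> (0 :: real)"
    define \<phi> where "\<phi> = (\<lambda>t. m (?p t) * k (?p t))"
    have \<phi>c: "continuous_on {a..b} \<phi>"
      unfolding \<phi>_def by (intro continuous_intros mt continuous_on_arc tame_kernel_continuous[OF k S])
    have osc: "cmod (\<phi> s - \<phi> t) \<le> e * S" if st: "s \<in> {a..b}" "t \<in> {a..b}" "\<bar>s - t\<bar> \<le> h" for s t
    proof -
      have in\<Gamma>: "?p s \<in> ?\<Gamma>" "?p t \<in> ?\<Gamma>" using st by (auto intro: arc_points_I)
      have close: "cmod (m (?p s) - m (?p t)) \<le> e1" "cmod (?p s - ?p t) \<le> e2"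
        using d1(2)[of t s] d2(2)[of t s] st h(2) by (auto simp: d_def dist_norm)
      have k1: "cmod (k (?p s)) \<le> M * S" "cmod (k (?p s) - k (?p t)) \<le> M^2 * S * cmod (?p s - ?p t)"
        using k in\<Gamma> unfolding tame_kernel_def by blast+
      have "M^2 * S * cmod (?p s - ?p t) \<le> M^2 * S * e2" using close(2) S by (intro mult_left_mono) auto
      then have "cmod ((m (?p s) - m (?p t)) * k (?p s)) + cmod (m (?p t) * (k (?p s) - k (?p t)))
          \<le> e1 * (M * S) + C * (M^2 * S * e2)"
        unfolding norm_mult using close(1) k1 C st(2) e12 by (intro add_mono mult_mono) auto
      moreover have "\<phi> s - \<phi> t = (m (?p s) - m (?p t)) * k (?p s) + m (?p t) * (k (?p s) - k (?p t))"
        by (simp add: \<phi>_def algebra_simps)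
      ultimately have "cmod (\<phi> s - \<phi> t) \<le> e1 * (M * S) + C * (M^2 * S * e2)"
        by (metis norm_triangle_ineq order_trans)
      also have "\<dots> = (e1 * M + C * (M^2 * e2)) * S" by (simp add: algebra_simps)
      also have "\<dots> \<le> e * S" using e1M e2M S by (intro mult_right_mono) auto
      finally show ?thesis .
    qed
    have "(\<Sum>(w, p)\<leftarrow>L. w * k p) = (\<Sum>j<N. of_real h * \<phi> (a + real j * h)) / of_real (2 * pi)"
      by (simp add: L_def \<phi>_def o_def interv_sum_list_conv_sum_set_nat atLeast0LessThan sum_divide_distrib mult_ac)
    then have "arc_mean c \<rho> a b (\<lambda>s. m s * k s) - (\<Sum>(w, p)\<leftarrow>L. w * k p) =
        (integral {a..b} \<phi> - (\<Sum>j<N. of_real h * \<phi> (a + real j * h))) / of_real (2 * pi)"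
      by (simp add: arc_mean_def \<phi>_def diff_divide_distrib)
    also have "cmod \<dots> = cmod (integral {a..b} \<phi> - (\<Sum>j<N. of_real h * \<phi> (a + real j * h))) / (2 * pi)"
      by (simp only: norm_divide norm_of_real) simp
    also have "\<dots> \<le> (b - a) * (e * S) / (2 * pi)"
      using riemann_sum_error[OF \<phi>c h(1) _ osc, of N] h(3) by (intro divide_right_mono) (auto simp: algebra_simps)
    also have "\<dots> = \<epsilon> * ((b - a) / (b - a + 1)) * S" by (simp add: e_def)
    also have "\<dots> \<le> \<epsilon> * 1 * S" using \<epsilon> True S by (intro mult_left_mono mult_right_mono) auto
    finally show "cmod (arc_mean c \<rho> a b (\<lambda>s. m s * k s) - (\<Sum>(w, p)\<leftarrow>L. w * k p)) \<le> \<epsilon> * S" by simp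
  qed
qed

lemma (in crescent_contour) quadrature:
  assumes m: "continuous_on \<Gamma> m" and M: "M \<ge> 0" and \<epsilon>: "\<epsilon> > 0"
  obtains L :: "(complex \<times> complex) list" where
    "\<And>w p. (w, p) \<in> set L \<Longrightarrow> p \<in> \<Gamma>"
    "\<And>k S. tame_kernel \<Gamma> M S k \<Longrightarrow> S \<ge> 0 \<Longrightarrow>
      cmod (I (\<lambda>s. m s * k s) - (\<Sum>(w, p)\<leftarrow>L. w * k p)) \<le> \<epsilon> * S"
proof -
  have c: "continuous_on \<Gamma>1 m" "continuous_on \<Gamma>2 m" using m by (auto intro: continuous_on_subset)
  have e2: "\<epsilon> / 2 > 0" using \<epsilon> by simp
  have c1: "continuous_on \<Gamma>1 (\<lambda>s. m s * (s - c1))" and c2: "continuous_on \<Gamma>2 (\<lambda>s. m s * (s - c2))"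
    by (intro continuous_intros c)+
  obtain L1 where L1: "\<And>w p. (w, p) \<in> set L1 \<Longrightarrow> p \<in> \<Gamma>1"
    "\<And>k S. tame_kernel \<Gamma>1 M S k \<Longrightarrow> S \<ge> 0 \<Longrightarrow>
      cmod (mean1 (\<lambda>s. m s * (s - c1) * k s) - (\<Sum>(w, p)\<leftarrow>L1. w * k p)) \<le> \<epsilon> / 2 * S"
    using arc_quadrature[OF c1 M e2] by blast
  obtain L2 where L2: "\<And>w p. (w, p) \<in> set L2 \<Longrightarrow> p \<in> \<Gamma>2"
    "\<And>k S. tame_kernel \<Gamma>2 M S k \<Longrightarrow> S \<ge> 0 \<Longrightarrow>
      cmod (mean2 (\<lambda>s. m s * (s - c2) * k s) - (\<Sum>(w, p)\<leftarrow>L2. w * k p)) \<le> \<epsilon> / 2 * S"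
    using arc_quadrature[OF c2 M e2] by blast
  define L where "L = L1 @ map (\<lambda>(w, p). (- w, p)) L2"
  have neg: "(\<Sum>(w, p)\<leftarrow>map (\<lambda>(w, p). (- w, p)) L'. w * k p) = - (\<Sum>(w, p)\<leftarrow>L'. w * k p)"
    for L' and k :: "complex \<Rightarrow> complex" by (induction L') auto
  show thesis
  proof (rule that[of L])
    show "p \<in> \<Gamma>" if "(w, p) \<in> set L" for w p
      using that L1(1) L2(1) by (auto simp: L_def)
    fix k S assume "tame_kernel \<Gamma> M S k" and S: "S \<ge> (0 :: real)"
    then have k: "tame_kernel \<Gamma>1 M S k" "tame_kernel \<Gamma>2 M S k" by (auto simp: tame_kernel_def)
    have I_eq: "I (\<lambda>s. m s * k s) = mean1 (\<lambda>s. m s * (s - c1) * k s) - mean2 (\<lambda>s. m s * (s - c2) * k s)"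
      unfolding crescent_mean_def by (intro arg_cong2[where f = "(-)"] arc_mean_cong) (simp_all only: mult_ac)
    have sum_eq: "(\<Sum>(w, p)\<leftarrow>L. w * k p) = (\<Sum>(w, p)\<leftarrow>L1. w * k p) - (\<Sum>(w, p)\<leftarrow>L2. w * k p)"
      using neg[of k L2] by (simp add: L_def)
    have "cmod (I (\<lambda>s. m s * k s) - (\<Sum>(w, p)\<leftarrow>L. w * k p)) =
        cmod ((mean1 (\<lambda>s. m s * (s - c1) * k s) - (\<Sum>(w, p)\<leftarrow>L1. w * k p))
          - (mean2 (\<lambda>s. m s * (s - c2) * k s) - (\<Sum>(w, p)\<leftarrow>L2. w * k p)))"
      unfolding I_eq sum_eq by (rule arg_cong[of _ _ cmod]) algebra
    also have "\<dots> \<le> \<epsilon> / 2 * S + \<epsilon> / 2 * S"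
      by (rule order_trans[OF norm_triangle_ineq4 add_mono[OF L1(2)[OF k(1) S] L2(2)[OF k(2) S]]])
    also have "\<dots> = \<epsilon> * S" by (simp add: field_simps)
    finally show "cmod (I (\<lambda>s. m s * k s) - (\<Sum>(w, p)\<leftarrow>L. w * k p)) \<le> \<epsilon> * S" .
  qed
qed

lemma rat_calculus_pole_sum:
  assumes "\<And>w p. (w, p) \<in> set L \<Longrightarrow> p \<notin> X"
  shows "rat_calculus X A (\<lambda>z. \<Sum>(w, p)\<leftarrow>L. w * (1 / (p - z))) (\<lambda>x. \<Sum>(w, p)\<leftarrow>L. (- w) *\<^sub>C resolvent A p x)"
  using assms
proof (induction L)
  case Nil
  then show ?case using rat_calculus.const[of X A 0] by simp
next
  case (Cons wp L)
  obtain w p where wp: "wp = (w, p)" by (cases wp)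
  have flip: "w * (1 / (p - z)) = (- w) * (1 / (z - p))" for z
    by (metis minus_diff_eq minus_divide_right minus_mult_minus mult_minus_left)
  have "rat_calculus X A (\<lambda>z. w * (1 / (p - z))) (\<lambda>x. (- w) *\<^sub>C resolvent A p x)"
    unfolding flip using Cons.prems by (intro rat_calculus_scale rat_calculus.pole) (auto simp: wp)
  moreover have "rat_calculus X A (\<lambda>z. \<Sum>(w, p)\<leftarrow>L. w * (1 / (p - z)))
      (\<lambda>x. \<Sum>(w, p)\<leftarrow>L. (- w) *\<^sub>C resolvent A p x)"
    by (rule Cons.IH) (use Cons.prems in auto)
  ultimately show ?case
    unfolding wp list.map sum_list.Cons case_prod_conv by (rule rat_calculus.add)
qed

lemma cinner_pole_sum:
  "cinner (\<Sum>(w, p)\<leftarrow>L. (- w) *\<^sub>C resolvent A p x) y = (\<Sum>(w, p)\<leftarrow>L. w * res_form A x y p)"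
  by (induction L) (auto simp: cinner_simps res_form_def)

section \<open>Spectral constants of crescents\<close>

context crescent_calculus
begin

text \<open>
  Riemann sums for the integrals that define \<open>g\<close> and \<open>g(A)\<close>, with common nodes on the boundary of the
  larger crescent.
\<close>

lemma rational_partner:
  assumes f: "rat_calculus X A f F" and le: "\<And>z. z \<in> X \<Longrightarrow> cmod (f z) \<le> 1" and \<eta>: "\<eta> > 0"
    and \<rho>': "R < \<rho>1'" "\<rho>1' < \<rho>1" "\<rho>2 < \<rho>2'" "\<rho>2' < r"
  shows "\<exists>g G. rat_calculus (crescent c1 \<rho>1' c2 \<rho>2') A g G \<and>
    (\<forall>z\<in>crescent c1 \<rho>1' c2 \<rho>2'. cmod (g z) \<le> 1 + \<eta>) \<and>
    (\<forall>x y. cmod (cinner (F x) y + cinner x (G y)) \<le> (2 + \<eta>) * norm x * norm y)"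
proof -
  let ?X' = "crescent c1 \<rho>1' c2 \<rho>2'"
  define e0 where "e0 = min (\<rho>1 - \<rho>1') (\<rho>2' - \<rho>2)"
  have e0: "e0 > 0" using \<rho>' by (simp add: e0_def)
  have fc: "continuous_on \<Gamma> (\<lambda>s. cnj (f s))"
    by (intro continuous_intros analytic_continuous rat_calculus_analytic[OF f])
  obtain L where L: "\<And>w p. (w, p) \<in> set L \<Longrightarrow> p \<in> \<Gamma>"
    "\<And>k S. tame_kernel \<Gamma> (1 / e0) S k \<Longrightarrow> S \<ge> 0 \<Longrightarrow>
      cmod (I (\<lambda>s. cnj (f s) * k s) - (\<Sum>(w, p)\<leftarrow>L. w * k p)) \<le> \<eta> * S"
    using quadrature[OF fc _ \<eta>, of "1 / e0"] e0 by auto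
  define \<kappa> where "\<kappa> = cnj (mean1 f - mean2 f)"
  define g where "g = (\<lambda>z. (\<Sum>(w, p)\<leftarrow>L. w * (1 / (p - z))) + (- \<kappa>))"
  define G where "G = (\<lambda>x. (\<Sum>(w, p)\<leftarrow>L. (- w) *\<^sub>C resolvent A p x) + (- \<kappa>) *\<^sub>C x)"
  have outside: "p \<notin> ?X'" if "p \<in> \<Gamma>" for p
    using that \<rho>' radii by (auto simp: crescent_def arc_points_norm)
  have "rat_calculus ?X' A g G"
    unfolding g_def G_def using L(1) outside
    by (intro rat_calculus.add rat_calculus.const rat_calculus_pole_sum) blast
  moreover have "cmod (g z) \<le> 1 + \<eta>" if z: "z \<in> ?X'" for z
  proof -
    have zW: "z \<in> W" using z \<rho>' by (auto simp: crescent_def W_def)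
    have far: "e0 \<le> cmod (s - z)" if s: "s \<in> \<Gamma>" for s
    proof -
      have "cmod (s - c1) \<le> cmod (s - z) + cmod (z - c1)"
        "cmod (z - c2) \<le> cmod (s - z) + cmod (s - c2)"
        using norm_triangle_ineq[of "s - z" "z - c1"] norm_triangle_ineq[of "z - s" "s - c2"]
        by (simp_all add: norm_minus_commute)
      moreover have "cmod (z - c1) \<le> \<rho>1'" "\<rho>2' \<le> cmod (z - c2)" using z by (auto simp: crescent_def)
      moreover have "cmod (s - c1) = \<rho>1 \<or> cmod (s - c2) = \<rho>2" using s radii by (auto simp: arc_points_norm)
      ultimately show ?thesis by (auto simp: e0_def)
    qed
    have "tame_kernel \<Gamma> (1 / e0) 1 (\<lambda>s. 1 / (s - z))"
      unfolding tame_kernel_def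
    proof (intro conjI ballI)
      fix s assume s: "s \<in> \<Gamma>"
      show "cmod (1 / (s - z)) \<le> 1 / e0 * 1"
        using far[OF s] e0 by (simp add: norm_divide frac_le)
      fix t assume t: "t \<in> \<Gamma>"
      have nz: "s - z \<noteq> 0" "t - z \<noteq> 0" using far[OF s] far[OF t] e0 by auto
      have "1 / (s - z) - 1 / (t - z) = (t - s) / ((s - z) * (t - z))"
        using nz by (simp add: diff_frac_eq)
      then have "cmod (1 / (s - z) - 1 / (t - z)) = cmod (s - t) / (cmod (s - z) * cmod (t - z))"
        by (simp add: norm_divide norm_mult norm_minus_commute)
      also have "\<dots> \<le> cmod (s - t) / (e0 * e0)"
        using far[OF s] far[OF t] e0 by (intro divide_left_mono mult_mono mult_pos_pos) auto
      finally show "cmod (1 / (s - z) - 1 / (t - z)) \<le> (1 / e0)^2 * 1 * cmod (s - t)"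
        by (simp add: power2_eq_square)
    qed
    from L(2)[OF this] have "cmod (conj_function f z - g z) \<le> \<eta>"
      by (simp add: conj_function_def g_def \<kappa>_def)
    moreover have "cmod (conj_function f z) \<le> 1" by (rule norm_conj_function_le[OF f le zW])
    ultimately show ?thesis
      using norm_triangle_ineq2[of "g z" "conj_function f z"] by (simp add: norm_minus_commute)
  qed
  moreover have "cmod (cinner (F x) y + cinner x (G y)) \<le> (2 + \<eta>) * norm x * norm y" for x y
  proof -
    have exe: "e0 \<le> ex s" if "s \<in> \<Gamma>" for s
      using excess_on_arcs[OF that] \<rho>' by (simp add: e0_def)
    have "tame_kernel \<Gamma> (1 / e0) (norm x * norm y) (res_form A y x)"
      unfolding tame_kernel_def
    proof (intro conjI ballI)
      fix s assume s: "s \<in> \<Gamma>"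
      have "cmod (res_form A y x s) \<le> norm y * norm x / ex s"
        by (rule norm_res_form[OF excess_pos[OF s]])
      also have "\<dots> \<le> norm y * norm x / e0"
        using exe[OF s] e0 by (intro divide_left_mono mult_pos_pos) auto
      finally show "cmod (res_form A y x s) \<le> 1 / e0 * (norm x * norm y)" by (simp add: mult.commute)
      fix t assume t: "t \<in> \<Gamma>"
      have "cmod (res_form A y x s - res_form A y x t) \<le> cmod (s - t) * (norm y * norm x / (ex s * ex t))"
        by (rule res_form_Lipschitz[OF excess_pos[OF s] excess_pos[OF t]])
      also have "\<dots> \<le> cmod (s - t) * (norm y * norm x / (e0 * e0))"
        using exe[OF s] exe[OF t] e0 by (intro mult_left_mono divide_left_mono mult_mono mult_pos_pos) auto
      finally show "cmod (res_form A y x s - res_form A y x t) \<le> (1 / e0)^2 * (norm x * norm y) * cmod (s - t)"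
        by (simp add: power2_eq_square mult_ac)
    qed
    note err = L(2)[OF this]
    have "conj_form f y x - cinner (G y) x =
        I (\<lambda>s. cnj (f s) * res_form A y x s) - (\<Sum>(w, p)\<leftarrow>L. w * res_form A y x p)"
      unfolding conj_form_def G_def cinner_add_left cinner_pole_sum cinner_scaleC_left \<kappa>_def
      by (simp add: algebra_simps)
    also have "cmod \<dots> \<le> norm x * norm y * \<eta>" using err by (simp add: mult.commute)
    finally have "cmod (cnj (conj_form f y x - cinner (G y) x)) \<le> norm x * norm y * \<eta>"
      by (simp only: complex_mod_cnj)
    moreover have "cnj (conj_form f y x - cinner (G y) x) = cnj (conj_form f y x) - cinner x (G y)"
      by (simp flip: cinner_commute)
    ultimately have close: "cmod (cnj (conj_form f y x) - cinner x (G y)) \<le> norm x * norm y * \<eta>"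
      by simp
    have "cmod (cinner (F x) y + cinner x (G y)) =
        cmod ((cinner (F x) y + cnj (conj_form f y x)) - (cnj (conj_form f y x) - cinner x (G y)))"
      by simp
    also have "\<dots> \<le> 2 * norm x * norm y + norm x * norm y * \<eta>"
      by (rule order_trans[OF norm_triangle_ineq4 add_mono[OF norm_calculus_plus_conjugate[OF f le] close]])
    finally show ?thesis by (simp add: algebra_simps)
  qed
  ultimately show ?thesis by blast
qed

end

lemma spectrum_crescent_op:
  fixes A :: "'a :: complex_hilbert_space \<Rightarrow> 'a"
  assumes "crescent_op c1 R c2 r A" "R \<ge> 0"
  shows "spectrum A \<subseteq> crescent c1 R c2 r"
proof
  fix \<mu> assume "\<mu> \<in> spectrum A"
  then have "\<not> excess c1 R c2 r \<mu> > 0"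
    using crescent_op_resolvent(1)[OF assms] by (auto simp: spectrum_def)
  then show "\<mu> \<in> crescent c1 R c2 r" by (auto simp: excess_def crescent_def less_max_iff_disj)
qed

text \<open>
  The family for \<open>crouzeix_palencia_bound\<close> consists of the functions bounded by one on some crescent
  with enlargement \<open>\<epsilon> > \<delta>0\<close>. It is closed under passing from \<open>F\<close> to \<open>F G F\<close>, which needs a slightly
  smaller \<open>\<epsilon>\<close>, and it is bounded by Cauchy's formula on the boundary of the \<open>\<delta>0\<close>-crescent.
\<close>

theorem crescent_spectral_bound:
  fixes A :: "'a :: complex_hilbert_space \<Rightarrow> 'a"
  assumes A: "crescent_op c1 R c2 r A" and R: "R > 0" and meets: "r < cmod (c1 - c2) + R"
    and \<delta>: "0 < \<delta>" "\<delta> < r"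
    and f: "rat_calculus (crescent c1 (R + \<delta>) c2 (r - \<delta>)) A f F"
      "\<And>z. z \<in> crescent c1 (R + \<delta>) c2 (r - \<delta>) \<Longrightarrow> cmod (f z) \<le> 1"
  shows "onorm F \<le> 1 + sqrt 2"
proof -
  define Y where "Y = (\<lambda>\<epsilon>. crescent c1 (R + \<epsilon>) c2 (r - \<epsilon>))"
  have Y_mono: "Y \<epsilon> \<subseteq> Y \<epsilon>'" if "\<epsilon> \<le> \<epsilon>'" for \<epsilon> \<epsilon>' using that by (auto simp: Y_def crescent_def)
  have lin: "bounded_clinear A" using A by (simp add: crescent_op_def)
  have spec: "spectrum A \<subseteq> Y \<epsilon>" if "\<epsilon> > 0" for \<epsilon>
    using spectrum_crescent_op[OF A] R Y_mono[of 0 \<epsilon>] that by (auto simp: Y_def)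
  have contour: "\<exists>a1 b1 a2 b2. crescent_calculus A c1 (R + \<epsilon>) a1 b1 c2 (r - \<epsilon>) a2 b2 R r"
    if \<epsilon>: "0 < \<epsilon>" "\<epsilon> < r" for \<epsilon>
  proof -
    obtain a1 b1 a2 b2 where "crescent_contour c1 (R + \<epsilon>) a1 b1 c2 (r - \<epsilon>) a2 b2"
      using crescent_contour_exists[of "R + \<epsilon>" "r - \<epsilon>" c1 c2] \<epsilon> R meets by auto
    moreover have "crescent_operator A c1 R c2 r" using A R by unfold_locales auto
    ultimately have "crescent_calculus A c1 (R + \<epsilon>) a1 b1 c2 (r - \<epsilon>) a2 b2 R r"
      using \<epsilon> by (simp add: crescent_calculus_def crescent_calculus_axioms_def)
    then show ?thesis by blast
  qed
  define \<delta>0 where "\<delta>0 = \<delta> / 2"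
  have \<delta>0: "0 < \<delta>0" "\<delta>0 < \<delta>" using \<delta> by (simp_all add: \<delta>0_def)
  define \<F> where "\<F> = {F. \<exists>\<epsilon> f. \<delta>0 < \<epsilon> \<and> \<epsilon> < r \<and> rat_calculus (Y \<epsilon>) A f F \<and> (\<forall>z\<in>Y \<epsilon>. cmod (f z) \<le> 1)}"
  have "F \<in> \<F>" unfolding \<F>_def using f \<delta> \<delta>0 by (auto simp: Y_def)
  then show ?thesis
  proof (rule crouzeix_palencia_bound[rotated -1])
    show "bounded_clinear F" if "F \<in> \<F>" for F
      using that rat_calculus_bounded_clinear[OF _ lin spec] \<delta>0 by (fastforce simp: \<F>_def)
    obtain a1 b1 a2 b2 where "crescent_calculus A c1 (R + \<delta>0) a1 b1 c2 (r - \<delta>0) a2 b2 R r"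
      using contour[of \<delta>0] \<delta> \<delta>0 by auto
    then interpret C: crescent_calculus A c1 "R + \<delta>0" a1 b1 c2 "r - \<delta>0" a2 b2 R r .
    show "onorm F \<le> (R + \<delta>0 + (r - \<delta>0)) / min (R + \<delta>0 - R) (r - (r - \<delta>0))" if FF: "F \<in> \<F>" for F
    proof -
      obtain \<epsilon> f where \<epsilon>: "\<delta>0 < \<epsilon>" "rat_calculus (Y \<epsilon>) A f F" "\<forall>z\<in>Y \<epsilon>. cmod (f z) \<le> 1"
        using FF by (auto simp: \<F>_def)
      have sub: "Y \<delta>0 \<subseteq> Y \<epsilon>" using \<epsilon>(1) by (intro Y_mono) simp
      have "norm (F x) \<le> (R + \<delta>0 + (r - \<delta>0)) / min (R + \<delta>0 - R) (r - (r - \<delta>0)) * norm x" for x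
        by (rule C.norm_Cauchy_formula[of f])
          (use rat_calculus_mono[OF \<epsilon>(2) sub] \<epsilon>(3) sub in \<open>auto simp: Y_def\<close>)
      then show ?thesis using R \<delta> \<delta>0 by (intro onorm_bound) auto
    qed
    show "\<exists>G. bounded_clinear G \<and>
        (\<forall>u v. cmod (cinner (F u) v + cinner u (G v)) \<le> (2 + \<eta>) * norm u * norm v) \<and>
        (\<lambda>x. of_real (1 / (1 + \<eta>)) *\<^sub>C F (G (F x))) \<in> \<F>" if F: "F \<in> \<F>" and \<eta>: "\<eta> > 0" for F \<eta>
    proof -
      obtain \<epsilon> f where \<epsilon>: "\<delta>0 < \<epsilon>" "\<epsilon> < r" and f: "rat_calculus (Y \<epsilon>) A f F" "\<And>z. z \<in> Y \<epsilon> \<Longrightarrow> cmod (f z) \<le> 1"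
        using F by (auto simp: \<F>_def)
      obtain a1 b1 a2 b2 where "crescent_calculus A c1 (R + \<epsilon>) a1 b1 c2 (r - \<epsilon>) a2 b2 R r"
        using contour[of \<epsilon>] \<epsilon> \<delta>0 by auto
      then interpret D: crescent_calculus A c1 "R + \<epsilon>" a1 b1 c2 "r - \<epsilon>" a2 b2 R r .
      define \<epsilon>' where "\<epsilon>' = (\<delta>0 + \<epsilon>) / 2"
      have \<epsilon>': "\<delta>0 < \<epsilon>'" "\<epsilon>' < \<epsilon>" using \<epsilon> by (simp_all add: \<epsilon>'_def)
      obtain g G where g: "rat_calculus (Y \<epsilon>') A g G" "\<And>z. z \<in> Y \<epsilon>' \<Longrightarrow> cmod (g z) \<le> 1 + \<eta>"
        and G: "\<And>x y. cmod (cinner (F x) y + cinner x (G y)) \<le> (2 + \<eta>) * norm x * norm y"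
        using D.rational_partner[of f F \<eta> "R + \<epsilon>'" "r - \<epsilon>'"] f \<eta> \<epsilon>' \<delta>0 by (auto simp: Y_def)
      have sub: "Y \<epsilon>' \<subseteq> Y \<epsilon>" using \<epsilon>' by (intro Y_mono) simp
      note f' = rat_calculus_mono[OF f(1) sub]
      have calc: "rat_calculus (Y \<epsilon>') A (\<lambda>z. of_real (1 / (1 + \<eta>)) * (f z * (g z * f z)))
          (\<lambda>x. of_real (1 / (1 + \<eta>)) *\<^sub>C F (G (F x)))"
        by (intro rat_calculus_scale rat_calculus.mult f' g)
      have "cmod (of_real (1 / (1 + \<eta>)) * (f z * (g z * f z))) \<le> 1" if z: "z \<in> Y \<epsilon>'" for z
      proof -
        have fz: "cmod (f z) \<le> 1" using z sub f(2) by blast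
        have "cmod (f z * (g z * f z)) \<le> 1 * ((1 + \<eta>) * 1)"
          unfolding norm_mult using fz g(2)[OF z] \<eta> by (intro mult_mono) auto
        then have "1 / (1 + \<eta>) * cmod (f z * (g z * f z)) \<le> 1 / (1 + \<eta>) * (1 + \<eta>)"
          using \<eta> by (intro mult_left_mono) auto
        then show ?thesis using \<eta> by (simp only: norm_mult[of "of_real _"] norm_of_real) simp
      qed
      then have "(\<lambda>x. of_real (1 / (1 + \<eta>)) *\<^sub>C F (G (F x))) \<in> \<F>"
        unfolding \<F>_def using calc \<epsilon>' \<epsilon> by force
      moreover have "bounded_clinear G"
        by (rule rat_calculus_bounded_clinear[OF g(1) lin spec]) (use \<epsilon>' \<delta>0 in auto)
      ultimately show ?thesis using G by blast
    qed
  qed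
qed

section \<open>The closure of a crescent\<close>

text \<open>
  A boundary point is approached from inside along a straight line: away from \<open>c2\<close> or towards \<open>c1\<close> if it
  lies on one circle only, along the difference of the unit normals if the circles cross
  or touch from outside there.
  At a point of internal tangency it is approached along the circle about \<open>c2\<close>.
\<close>

lemma closure_crescent:
  assumes r: "r > 0" and R: "R > 0" and meets: "r < cmod (c1 - c2) + R"
  shows "closure {z. cmod (z - c1) < R \<and> r < cmod (z - c2)} = crescent c1 R c2 r" (is "closure ?\<Omega> = ?X")
proof
  show "closure ?\<Omega> \<subseteq> ?X"
    by (rule closure_minimal) (auto simp: crescent_def intro: compact_imp_closed[OF compact_crescent[unfolded crescent_def]])
next
  have approach: "z \<in> closure ?\<Omega>"
    if "(y \<longlongrightarrow> z) (at_right (0 :: real))" "\<forall>\<^sub>F t in at_right 0. y t \<in> closure ?\<Omega>" for y z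
    by (rule Lim_in_closed_set[OF closed_closure that(2) _ that(1)]) simp
  have pos: "\<forall>\<^sub>F t :: real in at_right 0. 0 < t" by (rule eventually_at_right_less)
  have line: "((\<lambda>t. z + of_real t * e) \<longlongrightarrow> z) (at_right 0)" for z e :: complex
  proof -
    have "((\<lambda>t. z + of_real t * e) \<longlongrightarrow> z + of_real 0 * e) (at_right 0)" by (intro tendsto_intros)
    then show ?thesis by simp
  qed
  have half_open: "z \<in> closure ?\<Omega>" if z: "cmod (z - c1) < R" "r \<le> cmod (z - c2)" for z
  proof (rule approach[OF line[of z "z - c2"]])
    have "\<forall>\<^sub>F t in at_right 0. cmod (z + of_real t * (z - c2) - c1) < R"
      by (rule order_tendstoD(2)[OF tendsto_norm[OF tendsto_diff[OF line tendsto_const]] z(1)])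
    then show "\<forall>\<^sub>F t in at_right 0. z + of_real t * (z - c2) \<in> closure ?\<Omega>" using pos
    proof eventually_elim
      case (elim t)
      have "z + of_real t * (z - c2) - c2 = of_real (1 + t) * (z - c2)" by (simp add: algebra_simps)
      then have "cmod (z + of_real t * (z - c2) - c2) = (1 + t) * cmod (z - c2)"
        using elim by (simp only: norm_mult norm_of_real)
      also have "\<dots> = cmod (z - c2) + t * cmod (z - c2)" by (simp add: algebra_simps)
      also have "\<dots> > r" using elim z(2) r by (smt (verit) mult_pos_pos)
      finally show ?case using elim by (intro subsetD[OF closure_subset]) auto
    qed
  qed
  show "?X \<subseteq> closure ?\<Omega>"
  proof
    fix z assume z: "z \<in> ?X"
    define u where "u = z - c2"
    define v where "v = z - c1"
    have uv: "r \<le> cmod u" "cmod v \<le> R" using z by (auto simp: crescent_def u_def v_def)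
    define q where "q = Re v * Re u + Im v * Im u"
    consider "cmod v < R" | "cmod v = R" "r < cmod u" | "cmod v = R" "cmod u = r" "q < r * R"
      | "cmod v = R" "cmod u = r" "r * R \<le> q" using uv by linarith
    then show "z \<in> closure ?\<Omega>"
    proof cases
      case 1
      then show ?thesis using uv half_open by (simp add: u_def v_def)
    next
      case 2
      show ?thesis
      proof (rule approach[OF line[of z "- v"]])
        have "\<forall>\<^sub>F t in at_right 0. r < cmod (z + of_real t * - v - c2)"
          by (rule order_tendstoD(1)[OF tendsto_norm[OF tendsto_diff[OF line tendsto_const]]])
            (use 2 in \<open>simp add: u_def\<close>)
        moreover have "\<forall>\<^sub>F t :: real in at_right 0. t < 1"
          by (rule eventually_at_rightI[of 0 1]) auto
        ultimately show "\<forall>\<^sub>F t in at_right 0. z + of_real t * - v \<in> closure ?\<Omega>" using pos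
        proof eventually_elim
          case (elim t)
          have "z + of_real t * - v - c1 = of_real (1 - t) * v" by (simp add: v_def algebra_simps)
          then have "cmod (z + of_real t * - v - c1) = (1 - t) * R"
            using elim 2(1) by (simp only: norm_mult norm_of_real)
          also have "\<dots> < R" using elim R by (simp add: algebra_simps)
          finally show ?case using elim by (intro half_open) auto
        qed
      qed
    next
      case 3
      define e where "e = u / of_real r - v / of_real R"
      have sq: "Re u * Re u + Im u * Im u = r * r" "Re v * Re v + Im v * Im v = R * R"
        using cmod_power2[of u] cmod_power2[of v] 3 by (simp_all add: power2_eq_square)
      have Ree: "Re e = Re u / r - Re v / R" "Im e = Im u / r - Im v / R" by (simp_all add: e_def)
      have ve: "Re v * Re e + Im v * Im e = q / r - R"
      proof -
        have "Re v * Re e + Im v * Im e = q / r - (Re v * Re v + Im v * Im v) / R"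
          by (simp add: Ree q_def algebra_simps add_divide_distrib diff_divide_distrib)
        then show ?thesis using sq R by simp
      qed
      have ue: "Re u * Re e + Im u * Im e = r - q / R"
      proof -
        have "Re u * Re e + Im u * Im e = (Re u * Re u + Im u * Im u) / r - q / R"
          by (simp add: Ree q_def algebra_simps add_divide_distrib diff_divide_distrib)
        then show ?thesis using sq r by simp
      qed
      have neg: "q / r - R < 0" "0 < r - q / R" using 3 r R by (simp_all add: field_simps)
      have expand: "(cmod (w + of_real t * e))^2 = (cmod w)^2 + t * (2 * (Re w * Re e + Im w * Im e) + t * (cmod e)^2)"
        for w t unfolding cmod_power2 by (simp add: power2_eq_square algebra_simps)
      show ?thesis
      proof (rule approach[OF line[of z e]])
        have "((\<lambda>t. 2 * (q / r - R) + t * (cmod e)^2) \<longlongrightarrow> 2 * (q / r - R) + 0 * (cmod e)^2) (at_right 0)"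
          by (intro tendsto_intros)
        then have "\<forall>\<^sub>F t in at_right 0. 2 * (q / r - R) + t * (cmod e)^2 < 0"
          using neg by (intro order_tendstoD(2)) auto
        then show "\<forall>\<^sub>F t in at_right 0. z + of_real t * e \<in> closure ?\<Omega>" using pos
        proof eventually_elim
          case (elim t)
          have "(cmod (v + of_real t * e))^2 = R^2 + t * (2 * (q / r - R) + t * (cmod e)^2)"
            using expand[of v t] ve 3 by simp
          also have "\<dots> < R^2" using elim by (simp add: mult_less_0_iff)
          finally have 1: "cmod (v + of_real t * e) < R" by (rule power2_less_imp_less) (use R in simp)
          have "r^2 \<le> r^2 + t * (2 * (r - q / R) + t * (cmod e)^2)" using elim neg by simp
          also have "\<dots> = (cmod (u + of_real t * e))^2" using expand[of u t] ue 3 by simp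
          finally have 2: "r \<le> cmod (u + of_real t * e)" by (rule power2_le_imp_le) simp
          show ?case
            by (rule half_open) (use 1 2 in \<open>simp_all add: u_def v_def algebra_simps\<close>)
        qed
      qed
    next
      case 4
      \<comment> \<open>The circles touch at \<open>z\<close> from the same side; turning \<open>z\<close> about \<open>c2\<close> enters the outer disc.\<close>
      have "(cmod (of_real R * u - of_real r * v))^2 = R^2 * (cmod u)^2 + r^2 * (cmod v)^2 - 2 * (r * R) * q"
        unfolding cmod_power2 by (simp add: q_def power2_eq_square algebra_simps)
      also have "\<dots> = 2 * (r * R) * (r * R - q)" using 4 by (simp add: power2_eq_square algebra_simps)
      also have "\<dots> \<le> 0" using 4 r R by (intro mult_nonneg_nonpos) auto
      finally have "of_real R * u = of_real r * v" by simp
      then have v: "v = of_real (R / r) * u" using r by (simp add: field_simps)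
      have "c1 - c2 = of_real (1 - R / r) * u" using v by (simp add: u_def v_def algebra_simps)
      then have "cmod (c1 - c2) = \<bar>1 - R / r\<bar> * r" using 4 by (simp only: norm_mult norm_of_real)
      also have "\<dots> = \<bar>r - R\<bar>" using r by (simp add: abs_if field_simps)
      finally have rR: "r < R" using meets by (auto simp: abs_if split: if_splits)
      define l where "l = R / r"
      have l: "l > 1" using rR r by (simp add: l_def)
      show ?thesis
      proof (rule approach[where y = "\<lambda>s. z + u * (cis s - 1)"])
        have "((\<lambda>s. z + u * (cis s - 1)) \<longlongrightarrow> z + u * (cis 0 - 1)) (at_right 0)" by (intro tendsto_intros)
        then show "((\<lambda>s. z + u * (cis s - 1)) \<longlongrightarrow> z) (at_right 0)" by simp
        have "\<forall>\<^sub>F s :: real in at_right 0. s < pi" by (rule eventually_at_rightI[of 0 pi]) auto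
        then show "\<forall>\<^sub>F s in at_right 0. z + u * (cis s - 1) \<in> closure ?\<Omega>" using pos
        proof eventually_elim
          case (elim s)
          have "z + u * (cis s - 1) - c2 = u * cis s" by (simp add: u_def algebra_simps)
          then have 1: "cmod (z + u * (cis s - 1) - c2) = r" using 4 by (simp add: norm_mult)
          have c: "cos s < 1" using elim cos_monotone_0_pi[of 0 s] by simp
          have "(cmod (of_real (l - 1) + cis s))^2 = (l - 1)^2 + ((sin s)^2 + (cos s)^2) + 2 * (l - 1) * cos s"
            unfolding cmod_power2 by (simp add: power2_eq_square algebra_simps)
          also have "\<dots> < (l - 1)^2 + 1 + 2 * (l - 1) * 1"
          proof -
            have "2 * (l - 1) * cos s < 2 * (l - 1) * 1"
              by (rule mult_strict_left_mono) (use c l in auto)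
            then show ?thesis using sin_cos_squared_add[of s] by linarith
          qed
          also have "\<dots> = l^2" by (simp add: power2_eq_square algebra_simps)
          finally have "cmod (of_real (l - 1) + cis s) < l" by (rule power2_less_imp_less) (use l in simp)
          then have "r * cmod (of_real (l - 1) + cis s) < r * l" using r by simp
          also have "r * l = R" using r by (simp add: l_def)
          finally have "cmod (u * (of_real (l - 1) + cis s)) < R" using 4 by (simp add: norm_mult)
          moreover have "z + u * (cis s - 1) - c1 = u * (of_real (l - 1) + cis s)"
            using v by (simp add: l_def v_def algebra_simps)
          ultimately show ?case using 1 by (intro half_open) auto
        qed
      qed
    qed
  qed
qed

section \<open>Crescents as spectral sets\<close>

theorem theorem9:
  fixes A :: "'a::complex_hilbert_space \<Rightarrow> 'a"
    and \<omega>1 \<omega>2 :: complex and R1 R2 :: real and D1 D2 \<Omega> :: "complex set"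
  assumes "R1 > 0" and "R2 > 0"
    and "D1 = {z. cmod (z - \<omega>1) < R1}"
    and "D2 = {z. cmod (z - \<omega>2) > 1 / R2}"
    and "\<Omega> = D1 \<inter> D2" and "\<Omega> \<noteq> {}"
    and "bounded_clinear A"
    and "op_invertible (\<lambda>x. A x - \<omega>2 *\<^sub>C x)"
    and "onorm (\<lambda>x. A x - \<omega>1 *\<^sub>C x) \<le> R1"
    and "onorm (inv (\<lambda>x. A x - \<omega>2 *\<^sub>C x)) \<le> R2"
  shows "spectral_set (1 + sqrt 2) (closure \<Omega>) A"
proof -
  define r where "r = 1 / R2"
  have r: "r > 0" using assms(2) by (simp add: r_def)
  have \<Omega>: "\<Omega> = {z. cmod (z - \<omega>1) < R1 \<and> r < cmod (z - \<omega>2)}"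
    using assms(3-5) by (auto simp: r_def)
  obtain z0 where "z0 \<in> \<Omega>" using assms(6) by blast
  then have meets: "r < cmod (\<omega>1 - \<omega>2) + R1"
    using norm_triangle_ineq[of "z0 - \<omega>1" "\<omega>1 - \<omega>2"] by (simp add: \<Omega>)
  have X: "closure \<Omega> = crescent \<omega>1 R1 \<omega>2 r"
    unfolding \<Omega> by (rule closure_crescent[OF r assms(1) meets])
  have A: "crescent_op \<omega>1 R1 \<omega>2 r A"
    unfolding crescent_op_def
  proof (intro conjI allI assms(7,8))
    note shift = bounded_clinear_shift[OF assms(7)]
    show "norm (A x - \<omega>1 *\<^sub>C x) \<le> R1 * norm x" for x
      using onorm[OF bounded_clinearD(6)[OF shift[of \<omega>1]], of x] assms(9)
      by (meson mult_right_mono norm_ge_zero order_trans)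
    note inv = op_invertible_inv[OF assms(8)]
    show "r * norm x \<le> norm (A x - \<omega>2 *\<^sub>C x)" for x
    proof -
      have "norm x = norm (inv (\<lambda>x. A x - \<omega>2 *\<^sub>C x) (A x - \<omega>2 *\<^sub>C x))" by (simp add: inv(2))
      also have "\<dots> \<le> R2 * norm (A x - \<omega>2 *\<^sub>C x)"
        using onorm[OF bounded_clinearD(6)[OF inv(1)]] assms(10)
        by (meson mult_right_mono norm_ge_zero order_trans)
      finally show ?thesis using assms(2) by (simp add: r_def pos_divide_le_eq mult.commute)
    qed
  qed
  have spec: "spectrum A \<subseteq> closure \<Omega>" unfolding X by (rule spectrum_crescent_op[OF A]) (use assms(1) in simp)
  show ?thesis
    unfolding spectral_set_def
  proof (intro conjI allI impI spec closed_closure)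
    fix p q :: "complex poly"
    assume q: "q \<noteq> 0" "\<forall>z\<in>closure \<Omega>. poly q z \<noteq> 0"
      and bdd: "bounded ((\<lambda>z. poly p z / poly q z) ` closure \<Omega>)"
    define f where "f = (\<lambda>z. poly p z / poly q z)"
    define B where "B = (SUP z\<in>closure \<Omega>. cmod (f z))"
    obtain a where "\<And>z. z \<in> closure \<Omega> \<Longrightarrow> cmod (f z) \<le> a"
      using bdd by (auto simp: f_def bounded_iff)
    then have "bdd_above ((\<lambda>z. cmod (f z)) ` closure \<Omega>)" by (rule bdd_aboveI2)
    then have fB: "cmod (f z) \<le> B" if "z \<in> closure \<Omega>" for z
      unfolding B_def using that by (intro cSUP_upper)
    have "z0 \<in> closure \<Omega>" using \<open>z0 \<in> \<Omega>\<close> closure_subset by blast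
    then have B: "B \<ge> 0" using fB[of z0] norm_ge_zero[of "f z0"] by linarith
    have "onorm (rat_op p q A) \<le> (1 + sqrt 2) * (B + \<epsilon>)" if \<epsilon>: "\<epsilon> > 0" for \<epsilon>
    proof -
      \<comment> \<open>On a slightly larger crescent \<open>q\<close> still has no zeros and \<open>f\<close> exceeds \<open>B\<close> by less than \<open>\<epsilon>\<close>.\<close>
      define U where "U = {z. poly q z \<noteq> 0} \<inter> (\<lambda>z. cmod (f z)) -` {..<B + \<epsilon>}"
      have oq: "open {z. poly q z \<noteq> 0}"
        by (intro open_Collect_neq continuous_intros)
      have oU: "open U"
        unfolding U_def f_def by (intro continuous_open_preimage continuous_intros oq) auto
      have XU: "closure \<Omega> \<subseteq> U" using q fB \<epsilon> by (fastforce simp: U_def)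
      obtain \<delta> where \<delta>: "0 < \<delta>" "\<delta> < r" "crescent \<omega>1 (R1 + \<delta>) \<omega>2 (r - \<delta>) \<subseteq> U"
      proof (cases "crescent \<omega>1 (R1 + r / 2) \<omega>2 (r - r / 2) \<subseteq> U")
        case True
        then show thesis using r by (intro that[of "r / 2"]) auto
      next
        case False
        define K where "K = crescent \<omega>1 (R1 + r / 2) \<omega>2 (r - r / 2) - U"
        have "compact K" unfolding K_def by (intro compact_diff compact_crescent oU)
        moreover have "K \<noteq> {}" using False by (auto simp: K_def)
        ultimately obtain k where k: "k \<in> K" "\<And>z. z \<in> K \<Longrightarrow> excess \<omega>1 R1 \<omega>2 r k \<le> excess \<omega>1 R1 \<omega>2 r z"
          using continuous_attains_inf[OF _ _ continuous_on_excess] by metis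
        have "k \<notin> closure \<Omega>" using k(1) XU by (auto simp: K_def)
        then have kpos: "excess \<omega>1 R1 \<omega>2 r k > 0"
          using crescent_excess[of \<omega>1 R1 0 \<omega>2 r] by (simp add: X)
        define \<delta> where "\<delta> = min (r / 2) (excess \<omega>1 R1 \<omega>2 r k / 2)"
        have \<delta>: "0 < \<delta>" "\<delta> \<le> r / 2" "\<delta> < excess \<omega>1 R1 \<omega>2 r k" using r kpos by (auto simp: \<delta>_def)
        have "z \<in> U" if "z \<in> crescent \<omega>1 (R1 + \<delta>) \<omega>2 (r - \<delta>)" for z
        proof (rule ccontr)
          assume "z \<notin> U"
          moreover have ez: "excess \<omega>1 R1 \<omega>2 r z \<le> \<delta>" using that by (simp add: crescent_excess)
          then have "z \<in> crescent \<omega>1 (R1 + r / 2) \<omega>2 (r - r / 2)" using \<delta>(2) unfolding crescent_excess by simp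
          ultimately have "z \<in> K" by (simp add: K_def)
          then show False using k(2)[of z] ez \<delta>(3) by simp
        qed
        then show thesis using \<delta> r by (intro that[of \<delta>]) auto
      qed
      let ?Y = "crescent \<omega>1 (R1 + \<delta>) \<omega>2 (r - \<delta>)"
      have "spectrum A \<subseteq> ?Y" using spec \<delta>(1) by (auto simp: X crescent_def)
      then have calc: "rat_calculus ?Y A f (rat_op p q A)"
        unfolding f_def using q(1) \<delta>(3) assms(7) by (intro rat_calculus_rat_op) (auto simp: U_def)
      have B\<epsilon>: "B + \<epsilon> > 0" using B \<epsilon> by simp
      have "onorm (\<lambda>x. of_real (1 / (B + \<epsilon>)) *\<^sub>C rat_op p q A x) \<le> 1 + sqrt 2"
      proof (rule crescent_spectral_bound[OF A assms(1) meets \<delta>(1,2) rat_calculus_scale[OF calc]])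
        show "cmod (of_real (1 / (B + \<epsilon>)) * f z) \<le> 1" if "z \<in> ?Y" for z
          using that \<delta>(3) B\<epsilon> by (auto simp: U_def norm_mult simp del: of_real_divide of_real_add)
      qed
      moreover have "bounded_linear (\<lambda>x. of_real (1 / (B + \<epsilon>)) *\<^sub>C rat_op p q A x)"
        by (rule bounded_clinearD(6)[OF rat_calculus_bounded_clinear[OF rat_calculus_scale[OF calc] assms(7)]])
          (fact \<open>spectrum A \<subseteq> ?Y\<close>)
      ultimately have n: "norm (of_real (1 / (B + \<epsilon>)) *\<^sub>C rat_op p q A x) \<le> (1 + sqrt 2) * norm x" for x
        using onorm[of "\<lambda>x. of_real (1 / (B + \<epsilon>)) *\<^sub>C rat_op p q A x" x]
        by (meson mult_right_mono norm_ge_zero order_trans)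
      have "norm (rat_op p q A x) \<le> (1 + sqrt 2) * (B + \<epsilon>) * norm x" for x
        using n[of x] B\<epsilon> unfolding norm_scaleC norm_of_real by (simp add: pos_divide_le_eq mult_ac)
      then show ?thesis using B\<epsilon> by (intro onorm_bound) auto
    qed
    then have le: "onorm (rat_op p q A) \<le> (1 + sqrt 2) * B + (1 + sqrt 2) * \<epsilon>" if "\<epsilon> > 0" for \<epsilon>
      using that by (simp add: distrib_left)
    have K: "1 + sqrt 2 > (0 :: real)" using real_sqrt_ge_zero[of 2] by linarith
    have "onorm (rat_op p q A) \<le> (1 + sqrt 2) * B"
    proof (rule field_le_epsilon)
      fix e :: real assume "e > 0"
      then have "e / (1 + sqrt 2) > 0" using K by (rule divide_pos_pos)
      moreover have "(1 + sqrt 2) * (e / (1 + sqrt 2)) = e" using K by simp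
      ultimately show "onorm (rat_op p q A) \<le> (1 + sqrt 2) * B + e" using le[of "e / (1 + sqrt 2)"] by simp
    qed
    then show "onorm (rat_op p q A) \<le> (1 + sqrt 2) * (SUP z\<in>closure \<Omega>. cmod (poly p z / poly q z))"
      by (simp add: B_def f_def)
  qed
qed

end
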